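(* Let $p\ge 3$, let $V=\mathbb{C}^p$, let $\Delta(z)=z_1^2+\cdots+z_p^2$ and let $Q=\Delta^2$. Let $K=\mathrm{Conf}(V,Q)$, $\mathfrak{k}=\mathrm{Lie}(K)$, let $\mathfrak{p}$ be the space of polynomials on $V$ spanned by the translates $Q(\cdot-a)$ ($a\in V$), with the representation $\kappa$ of $K$ on $\mathfrak p$, let $E,F\in\mathfrak p$, $H\in\mathfrak k$, and equip $\mathfrak{g}=\mathfrak{k}\oplus\mathfrak{p}$ with its Lie algebra structure, all as defined in the context. Let $\mathfrak{g}_{\mathbb R}=\mathfrak{k}_{\mathbb R}+\mathfrak{p}_{\mathbb R}$ be the real form of $\mathfrak g$ defined in the context. Then the pair $(\mathfrak g,\mathfrak k)$ is isomorphic to $(\mathfrak{sl}(p+2,\mathbb{C}),\mathfrak{o}(p+2,\mathbb{C}))$, i.e. there is an isomorphism of complex Lie algebras $\mathfrak g\to\mathfrak{sl}(p+2,\mathbb C)$ mapping $\mathfrak k$ onto $\mathfrak o(p+2,\mathbb C)$; and the pair $(\mathfrak g_{\mathbb R},\mathfrak k_{\mathbb R})$ is isomorphic to $(\mathfrak{sl}(p+2,\mathbb{R}),\mathfrak{o}(p+2))$, i.e. there is an isomorphism of real Lie algebras $\mathfrak g_{\mathbb R}\to\mathfrak{sl}(p+2,\mathbb R)$ mapping $\mathfrak k_{\mathbb R}$ onto $\mathfrak o(p+2)$.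
   Context: Structure group: $\mathrm{Str}(V,Q)=\{g\in \mathrm{GL}(V) : \exists\,\gamma(g)\in\mathbb{C}^*,\ Q(g\cdot z)=\gamma(g)Q(z)\ \forall z\}$. Every $\ell\in\mathrm{Str}(V,Q)$ satisfies $\Delta(\ell\cdot z)=\chi(\ell)\Delta(z)$ for a character $\chi$ of $\mathrm{Str}(V,Q)$, and $\chi^2=\gamma$. Conformal group: $K=\mathrm{Conf}(V,Q)$ is the group of rational transformations of $V$ generated by the translations $z\mapsto z+a$ ($a\in V$), the maps $z\mapsto \ell\cdot z$ ($\ell\in \mathrm{Str}(V,Q)$), and the inversion $\sigma(z)=-z/\Delta(z)$. It is a complex Lie group, with Lie algebra $\mathfrak{k}$. Representation $\kappa$: $\mathfrak p$ denotes the finite-dimensional complex vector space of polynomials on $V$ spanned by all $z\mapsto Q(z-a)$, $a\in V$. For $g\in K$ put $\mu(g,z)=\chi\big((Dg(z))^{-1}\big)$, where $Dg(z)$ is the differential of $g$ at $z$ (it belongs to $\mathrm{Str}(V,Q)$ where defined). Then $K$ acts linearly on $\mathfrak p$ by $(\kappa(g)f)(z)=\mu(g^{-1},z)\,f(g^{-1}\cdot z)$. In particular $(\kappa(\sigma)f)(z)=Q(z)\,f(-z/\Delta(z))$, and translation by $a$ acts by $f\mapsto f(\cdot-a)$. Its differential is denoted $d\kappa:\mathfrak k\to \mathfrak{gl}(\mathfrak p)$. The elements $E,F,H$: $E:=Q\in\mathfrak p$, $F:=1\in\mathfrak p$ (constant polynomial), and $H\in\mathfrak k$ is the generator of the one-parameter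 group $h_t\cdot z=e^{-t}z$, so $d\kappa(H)E=2E$ and $d\kappa(H)F=-2F$. Lie algebra structure on $\mathfrak g=\mathfrak k\oplus\mathfrak p$ (known to exist and to be unique): the Lie bracket on $\mathfrak g$ satisfying (i) $[X,X']=[X,X']_{\mathfrak k}$ for $X,X'\in\mathfrak k$; (ii) $[X,f]=d\kappa(X)f$ for $X\in\mathfrak k$, $f\in\mathfrak p$; (iii) $[E,F]=H$. Real form: let $z\mapsto\bar z$ be the standard complex conjugation of $V=\mathbb C^p$ with respect to $V_{\mathbb R}=\mathbb R^p$. For $g\in K$ put $\bar g\cdot z=\overline{g\cdot\bar z}$ and $\alpha(g)=\sigma\circ\bar g\circ\sigma^{-1}$; $\alpha$ is a Cartan involution of $K$. Put $K_{\mathbb R}=\{g\in K:\alpha(g)=g\}$, a compact real form of $K$, and $\mathfrak k_{\mathbb R}=\mathrm{Lie}(K_{\mathbb R})$. For $f\in\mathfrak p$ let $\bar f(z)=\overline{f(\bar z)}$, and put $\mathfrak p_{\mathbb R}=\{f\in\mathfrak p:\kappa(\sigma)\bar f=f\}$. Then $\mathfrak g_{\mathbb R}:=\mathfrak k_{\mathbb R}+\mathfrak p_{\mathbb R}$ is a real form of $\mathfrak g$. Notation: $\mathfrak o(n,\mathbb C)$ and $\mathfrak o(n)$ are the Lie algebras of skew-symmetric complex, respectively real, $n\times n$ matrices. *)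

theory Defs
  imports "HOL-Analysis.Analysis" "HOL-Library.Function_Algebras"
begin

section \<open>Lie algebras and their isomorphisms\<close>

text \<open>
  A Lie algebra carried by a linear subspace \<open>L\<close> of an ambient vector space. Only the values
  of \<open>br\<close> on \<open>L\<close> matter. The library instances for functions and pairs provide
  the (pointwise, componentwise) addition.
\<close>

locale lie_algebra_on = vector_space scale
  for scale :: "'k::field \<Rightarrow> 'a::ab_group_add \<Rightarrow> 'a" +
  fixes L :: "'a set" and br :: "'a \<Rightarrow> 'a \<Rightarrow> 'a"
  assumes subspace_carrier: "subspace L"
    and bracket_closed: "\<lbrakk>x \<in> L; y \<in> L\<rbrakk> \<Longrightarrow> br x y \<in> L"
    and bracket_add_left: "\<lbrakk>x \<in> L; y \<in> L; z \<in> L\<rbrakk> \<Longrightarrow> br (x + y) z = br x z + br y z"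
    and bracket_add_right: "\<lbrakk>x \<in> L; y \<in> L; z \<in> L\<rbrakk> \<Longrightarrow> br z (x + y) = br z x + br z y"
    and bracket_scale_left: "\<lbrakk>x \<in> L; y \<in> L\<rbrakk> \<Longrightarrow> br (scale c x) y = scale c (br x y)"
    and bracket_scale_right: "\<lbrakk>x \<in> L; y \<in> L\<rbrakk> \<Longrightarrow> br x (scale c y) = scale c (br x y)"
    and bracket_alternating: "x \<in> L \<Longrightarrow> br x x = 0"
    and jacobi: "\<lbrakk>x \<in> L; y \<in> L; z \<in> L\<rbrakk> \<Longrightarrow>
      br x (br y z) + br y (br z x) + br z (br x y) = 0"

definition lie_algebra_iso ::
  "('k::field \<Rightarrow> 'a::ab_group_add \<Rightarrow> 'a) \<Rightarrow> 'a set \<Rightarrow> ('a \<Rightarrow> 'a \<Rightarrow> 'a) \<Rightarrow>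
   ('k \<Rightarrow> 'b::ab_group_add \<Rightarrow> 'b) \<Rightarrow> 'b set \<Rightarrow> ('b \<Rightarrow> 'b \<Rightarrow> 'b) \<Rightarrow> ('a \<Rightarrow> 'b) \<Rightarrow> bool" where
  "lie_algebra_iso s1 L1 br1 s2 L2 br2 \<phi> \<longleftrightarrow>
     lie_algebra_on s1 L1 br1 \<and> lie_algebra_on s2 L2 br2 \<and>
     bij_betw \<phi> L1 L2 \<and>
     (\<forall>x\<in>L1. \<forall>y\<in>L1. \<phi> (x + y) = \<phi> x + \<phi> y) \<and>
     (\<forall>c. \<forall>x\<in>L1. \<phi> (s1 c x) = s2 c (\<phi> x)) \<and>
     (\<forall>x\<in>L1. \<forall>y\<in>L1. \<phi> (br1 x y) = br2 (\<phi> x) (\<phi> y))"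

definition matrix_scale :: "'k::field \<Rightarrow> 'k^'m^'m \<Rightarrow> 'k^'m^'m" where
  "matrix_scale c A = (\<chi> i j. c * A $ i $ j)"

definition matrix_bracket :: "'k::field^'m^'m \<Rightarrow> 'k^'m^'m \<Rightarrow> 'k^'m^'m" where
  "matrix_bracket A B = A ** B - B ** A"

definition special_linear_algebra :: "('k::field^'m^'m) set" where
  "special_linear_algebra = {A. trace A = 0}"

definition orthogonal_algebra :: "('k::field^'m^'m) set" where
  "orthogonal_algebra = {A. transpose A = - A}"


section \<open>The quadratic form and the structure group\<close>

text \<open>\<open>V = complex^'n\<close>; the form is complex bilinear, so it is not the library's inner product.\<close>

definition Delta :: "complex^'n \<Rightarrow> complex" where
  "Delta z = (\<Sum>i\<in>UNIV. (z $ i)\<^sup>2)"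

definition Q :: "complex^'n \<Rightarrow> complex" where
  "Q z = (Delta z)\<^sup>2"

definition Str :: "(complex^'n \<Rightarrow> complex^'n) set" where
  "Str = {l. Vector_Spaces.linear (*s) (*s) l \<and> bij l \<and>
             (\<exists>\<gamma>. \<gamma> \<noteq> 0 \<and> (\<forall>z. Q (l z) = \<gamma> * Q z))}"

definition str_character :: "(complex^'n \<Rightarrow> complex^'n) \<Rightarrow> complex" where
  "str_character l = (THE c. \<forall>z. Delta (l z) = c * Delta z)"


section \<open>Rational transformations and the conformal group\<close>

inductive polynomial_fun :: "(complex^'n \<Rightarrow> complex) \<Rightarrow> bool" where
  const: "polynomial_fun (\<lambda>z. c)"
| coord: "polynomial_fun (\<lambda>z. z $ i)"
| add: "\<lbrakk>polynomial_fun f; polynomial_fun g\<rbrakk> \<Longrightarrow> polynomial_fun (\<lambda>z. f z + g z)"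
| mult: "\<lbrakk>polynomial_fun f; polynomial_fun g\<rbrakk> \<Longrightarrow> polynomial_fun (\<lambda>z. f z * g z)"

text \<open>
  A rational map is represented by the partial function whose domain is its full domain of
  regularity, so that two rational maps are equal iff they are equal as partial functions.
  \<open>regular_value f z w\<close> says that the rational map which agrees with \<open>f\<close> on a dense open
  set is regular at \<open>z\<close>, with value \<open>w\<close> there (\<open>w\<close> is unique by density).
  The composition of rational maps is the maximal extension of the composition as partial
  functions.
\<close>

type_synonym 'n rational_map = "complex^'n \<Rightarrow> (complex^'n) option"

definition regular_value :: "'n::finite rational_map \<Rightarrow> complex^'n \<Rightarrow> complex^'n \<Rightarrow> bool" where
  "regular_value f z w \<longleftrightarrow>
     (\<exists>P q U. (\<forall>i. polynomial_fun (\<lambda>x. P x $ i)) \<and> polynomial_fun q \<and>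
        open U \<and> closure U = UNIV \<and>
        (\<forall>x\<in>U. q x \<noteq> 0 \<and> f x = Some (inverse (q x) *s P x)) \<and>
        q z \<noteq> 0 \<and> w = inverse (q z) *s P z)"

definition rational_extension :: "'n::finite rational_map \<Rightarrow> 'n rational_map" where
  "rational_extension f z =
     (if \<exists>w. regular_value f z w then Some (THE w. regular_value f z w) else None)"

definition rational_comp :: "'n::finite rational_map \<Rightarrow> 'n rational_map \<Rightarrow> 'n rational_map"
    (infixl \<open>\<circ>\<^sub>r\<close> 55) where
  "g \<circ>\<^sub>r h = rational_extension (g \<circ>\<^sub>m h)"

definition sigma :: "'n::finite rational_map" where
  "sigma z = (if Delta z = 0 then None else Some (- (inverse (Delta z) *s z)))"

text \<open>
  The set of generators is closed under inverses (\<open>sigma\<close> is an involution), so the group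
  it generates is its closure under composition.
\<close>

inductive_set Conf :: "'n::finite rational_map set" where
  translation: "(\<lambda>z. Some (z + a)) \<in> Conf"
| linear_map: "l \<in> Str \<Longrightarrow> (\<lambda>z. Some (l z)) \<in> Conf"
| inversion: "sigma \<in> Conf"
| comp: "\<lbrakk>g \<in> Conf; h \<in> Conf\<rbrakk> \<Longrightarrow> g \<circ>\<^sub>r h \<in> Conf"

definition conf_inv :: "'n::finite rational_map \<Rightarrow> 'n rational_map" where
  "conf_inv g = (THE h. h \<in> Conf \<and> g \<circ>\<^sub>r h = Some \<and> h \<circ>\<^sub>r g = Some)"


section \<open>Lie algebras of groups of rational transformations\<close>

text \<open>
  An element of the Lie algebra of a group \<open>G\<close> of rational transformations is represented by
  the vector field on \<open>V\<close> through which it acts, i.e. the velocity at \<open>t = 0\<close> of the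
  corresponding one-parameter subgroup \<open>t \<mapsto> g t\<close> of \<open>G\<close>.
\<close>

definition one_parameter_subgroup ::
  "'n::finite rational_map set \<Rightarrow> (real \<Rightarrow> 'n rational_map) \<Rightarrow> (complex^'n \<Rightarrow> complex^'n) \<Rightarrow> bool" where
  "one_parameter_subgroup G g X \<longleftrightarrow>
     (\<forall>t. g t \<in> G) \<and> (\<forall>s t. g (s + t) = g s \<circ>\<^sub>r g t) \<and>
     (\<forall>z. (\<forall>\<^sub>F t in nhds 0. g t z \<noteq> None) \<and>
          ((\<lambda>t. the (g t z)) has_vector_derivative X z) (at 0))"

definition Lie :: "'n::finite rational_map set \<Rightarrow> (complex^'n \<Rightarrow> complex^'n) set" where
  "Lie G = {X. \<exists>g. one_parameter_subgroup G g X}"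

text \<open>
  The bracket of the Lie algebra of a group acting from the left is the opposite of the bracket
  of vector fields; on linear fields it is the commutator of endomorphisms.
\<close>

definition field_bracket ::
  "(complex^'n \<Rightarrow> complex^'n) \<Rightarrow> (complex^'n \<Rightarrow> complex^'n) \<Rightarrow> complex^'n \<Rightarrow> complex^'n" where
  "field_bracket X Y z =
     frechet_derivative X (at z) (Y z) - frechet_derivative Y (at z) (X z)"

definition conf_exp :: "(complex^'n \<Rightarrow> complex^'n) \<Rightarrow> real \<Rightarrow> 'n::finite rational_map" where
  "conf_exp X = (SOME g. one_parameter_subgroup Conf g X)"

definition lie_k :: "(complex^'n \<Rightarrow> complex^'n) set" where
  "lie_k = Lie Conf"

definition H_elem :: "complex^'n \<Rightarrow> complex^'n" where
  "H_elem z = vector_derivative (\<lambda>t. exp (- t) *\<^sub>R z) (at (0::real))"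


section \<open>The representation on polynomials\<close>

definition space_p :: "(complex^'n \<Rightarrow> complex) set" where
  "space_p = module.span (\<lambda>c f z. c * f z) (range (\<lambda>a z. Q (z - a)))"

definition mu :: "'n::finite rational_map \<Rightarrow> complex^'n \<Rightarrow> complex" where
  "mu g z = str_character (inv (frechet_derivative (\<lambda>x. the (g x)) (at z)))"

text \<open>
  The defining formula makes sense where \<open>g\<inverse>\<close> is regular, which is a dense open set; it
  determines the polynomial.
\<close>

definition kappa :: "'n::finite rational_map \<Rightarrow> (complex^'n \<Rightarrow> complex) \<Rightarrow> complex^'n \<Rightarrow> complex" where
  "kappa g f = (THE h. h \<in> space_p \<and>
     (\<forall>z w. conf_inv g z = Some w \<longrightarrow> h z = mu (conf_inv g) z * f w))"

definition d_kappa ::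
  "(complex^'n \<Rightarrow> complex^'n) \<Rightarrow> (complex^'n \<Rightarrow> complex) \<Rightarrow> complex^'n \<Rightarrow> complex" where
  "d_kappa X f z = vector_derivative (\<lambda>t. kappa (conf_exp X t) f z) (at 0)"

definition E_elem :: "complex^'n \<Rightarrow> complex" where
  "E_elem = Q"

definition F_elem :: "complex^'n \<Rightarrow> complex" where
  "F_elem = (\<lambda>z. 1)"


section \<open>The Lie algebra \<open>k \<oplus> p\<close>\<close>

type_synonym 'n gspace = "(complex^'n \<Rightarrow> complex^'n) \<times> (complex^'n \<Rightarrow> complex)"

definition g_scale :: "complex \<Rightarrow> 'n::finite gspace \<Rightarrow> 'n gspace" where
  "g_scale c = (\<lambda>(X, f). (\<lambda>z. c *s X z, \<lambda>z. c * f z))"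

definition lie_g :: "'n::finite gspace set" where
  "lie_g = lie_k \<times> space_p"

definition is_g_bracket :: "('n::finite gspace \<Rightarrow> 'n gspace \<Rightarrow> 'n gspace) \<Rightarrow> bool" where
  "is_g_bracket br \<longleftrightarrow>
     lie_algebra_on g_scale lie_g br \<and>
     (\<forall>X\<in>lie_k. \<forall>Y\<in>lie_k. br (X, 0) (Y, 0) = (field_bracket X Y, 0)) \<and>
     (\<forall>X\<in>lie_k. \<forall>f\<in>space_p. br (X, 0) (0, f) = (0, d_kappa X f)) \<and>
     br (0, E_elem) (0, F_elem) = (H_elem, 0)"

text \<open>
  On \<open>lie_g\<close> there is exactly one such bracket; the choice only concerns irrelevant values
  outside \<open>lie_g\<close>.
\<close>

definition g_bracket :: "'n::finite gspace \<Rightarrow> 'n gspace \<Rightarrow> 'n gspace" where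
  "g_bracket = (SOME br. is_g_bracket br)"


section \<open>The real form\<close>

definition vec_cnj :: "complex^'n \<Rightarrow> complex^'n" where
  "vec_cnj z = (\<chi> i. cnj (z $ i))"

definition conf_conj :: "'n::finite rational_map \<Rightarrow> 'n rational_map" where
  "conf_conj g z = map_option vec_cnj (g (vec_cnj z))"

definition alpha :: "'n::finite rational_map \<Rightarrow> 'n rational_map" where
  "alpha g = sigma \<circ>\<^sub>r conf_conj g \<circ>\<^sub>r conf_inv sigma"

definition Conf_R :: "'n::finite rational_map set" where
  "Conf_R = {g \<in> Conf. alpha g = g}"

definition lie_k_R :: "(complex^'n \<Rightarrow> complex^'n) set" where
  "lie_k_R = Lie Conf_R"

definition space_p_R :: "(complex^'n \<Rightarrow> complex) set" where
  "space_p_R = {f \<in> space_p. kappa sigma (\<lambda>z. cnj (f (vec_cnj z))) = f}"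

definition lie_g_R :: "'n::finite gspace set" where
  "lie_g_R = lie_k_R \<times> space_p_R"

end

theory Submission
  imports Defs "HOL-Computational_Algebra.Polynomial"
begin

text \<open>
  With \<open>N = n + 2\<close>, the map \<open>z \<mapsto> psi z = (z, (1 - \<Delta>(z))/2, i(1 + \<Delta>(z))/2)\<close> embeds \<open>V\<close> as an affine
  chart of the quadric of isotropic lines of \<open>C\<^sup>N\<close> with the form \<open>\<Sum> (x\<^sub>i)\<^sup>2\<close>. The conformal group becomes
  the complex orthogonal group acting on the quadric, so its one-parameter subgroups come from
  skew-symmetric matrices \<open>A\<close>. The polynomials in \<open>p\<close> are the restrictions
  \<open>S \<mapsto> (psi z)\<^sup>T S (psi z)\<close> of traceless symmetric matrices \<open>S\<close>, the representation is
  \<open>S \<mapsto> A S - S A\<close>, and the bracket of \<open>sl(N)\<close> satisfies the three conditions after the scaling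
  \<open>S \<mapsto> S/2\<close>. Uniqueness holds because \<open>E \<otimes> F\<close> is a cyclic vector of \<open>p \<otimes> p\<close> for the action
  of the Lie algebra of the conformal group. In the chosen coordinates the real form consists of the
  real matrices.
\<close>

section \<open>The complex bilinear form\<close>

text \<open>\<open>Conf\<close> carries no manifold structure: a one-parameter subgroup is a family
  of partial functions whose orbits are differentiable at time 0, and a conformal map does not
  distinguish a matrix from its negative. The obstacle on the group side is to recover a matrix
  generator from the orbits alone; the values of Delta on differences of three moving points supply
  the missing normalisation.

  The factor i in the last coordinate makes entrywise conjugation of C^N act on the chart as
  conjugation of V followed by the inversion. The involution \<alpha> thereby becomes entrywise
  conjugation of matrices, without any further change of basis.

  The factor 1/2 is forced up to sign. In the transported structure the bracket of two symmetric
  matrices is a multiple c of their commutator, and [E, F] = H demands c = 1/4. The positive sign of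
  c is what produces sl(N,R) as the real form; a negative c would produce su(N).\<close>

definition dot :: "complex^'k \<Rightarrow> complex^'k \<Rightarrow> complex" where
  "dot x y = (\<Sum>i\<in>UNIV. x $ i * y $ i)"

lemma dot_commute: "dot x y = dot y x"
  by (simp add: dot_def mult.commute)

lemma dot_add_left: "dot (x + y) z = dot x z + dot y z"
  and dot_add_right: "dot z (x + y) = dot z x + dot z y"
  and dot_diff_left: "dot (x - y) z = dot x z - dot y z"
  and dot_diff_right: "dot z (x - y) = dot z x - dot z y"
  and dot_minus_left: "dot (- x) z = - dot x z"
  and dot_minus_right: "dot z (- x) = - dot z x"
  and dot_scale_left: "dot (c *s x) z = c * dot x z"
  and dot_scale_right: "dot z (c *s x) = c * dot z x"
  and dot_zero_left: "dot 0 z = 0"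
  and dot_zero_right: "dot z 0 = 0"
  by (simp_all add: dot_def algebra_simps sum.distrib sum_subtractf sum_negf sum_distrib_left)

lemmas dot_simps = dot_add_left dot_add_right dot_diff_left dot_diff_right dot_minus_left
  dot_minus_right dot_scale_left dot_scale_right dot_zero_left dot_zero_right

lemma dot_axis_left: "dot (axis i 1) x = x $ i"
  and dot_axis_right: "dot x (axis i 1) = x $ i"
  by (simp_all add: dot_def axis_def if_distrib[where f="\<lambda>a. a * _"] if_distrib[where f="\<lambda>a. _ * a"] cong: if_cong)

lemma dot_eqI: "(\<And>y. dot x y = dot x' y) \<Longrightarrow> x = x'"
  by (metis dot_axis_right vec_eq_iff)

lemma dot_sum_left: "dot (sum f A) z = (\<Sum>a\<in>A. dot (f a) z)"
  and dot_sum_right: "dot z (sum f A) = (\<Sum>a\<in>A. dot z (f a))"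
proof -
  show "dot (sum f A) z = (\<Sum>a\<in>A. dot (f a) z)"
    by (induction A rule: infinite_finite_induct) (simp_all add: dot_simps)
  then show "dot z (sum f A) = (\<Sum>a\<in>A. dot z (f a))"
    by (simp add: dot_commute[of z])
qed

lemma Delta_eq_dot: "Delta z = dot z z"
  by (simp add: Delta_def dot_def power2_eq_square)

lemma Delta_axis: "Delta (axis i 1) = 1"
  by (simp add: Delta_eq_dot dot_axis_left)

lemma Delta_minus: "Delta (- z) = Delta z"
  and Delta_zero: "Delta 0 = 0"
  and Delta_scale: "Delta (c *s z) = c\<^sup>2 * Delta z"
  by (simp_all add: Delta_eq_dot dot_simps power2_eq_square)

lemma dot_matrix_left: "dot (A *v x) y = dot x (transpose A *v y)"
  unfolding dot_def matrix_vector_mult_def transpose_def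
  by (simp add: sum_distrib_left sum_distrib_right algebra_simps)
     (subst sum.swap, simp add: algebra_simps)

lemma matrix_mult_scale: "(A :: complex^'k^'k) *v (c *s x) = c *s (A *v x)"
  by (rule vector_scalar_commute)

lemma matrix_mult_minus: "(A :: complex^'k^'k) *v (- x) = - (A *v x)"
  by (metis matrix_mult_scale vector_sneg_minus1)

lemmas matrix_linear = matrix_vector_right_distrib matrix_vector_mult_diff_distrib matrix_mult_scale
  matrix_mult_minus

text \<open>\<open>orthogonal_matrix\<close> uses the transpose without conjugation, so over the
  complex numbers it describes the complex orthogonal group and not the unitary group.\<close>

lemma orthogonal_matrixI:
  fixes A :: "complex^'k^'k"
  assumes "\<And>x y. dot (A *v x) (A *v y) = dot x y"
  shows "orthogonal_matrix A"
proof -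
  have "(transpose A ** A) *v x = mat 1 *v x" for x
    by (rule dot_eqI) (metis assms dot_commute dot_matrix_left matrix_vector_mul_assoc matrix_vector_mul_lid)
  then have "transpose A ** A = mat 1"
    by (simp add: matrix_eq)
  then show ?thesis
    by (simp add: matrix_left_right_inverse orthogonal_matrix_def)
qed

lemma dot_orthogonal:
  "orthogonal_matrix A \<Longrightarrow> dot (A *v x) (A *v y) = dot x y"
  by (simp add: dot_matrix_left matrix_vector_mul_assoc orthogonal_matrix_def)

lemma orthogonal_matrix_mult:
  fixes A B :: "complex^'k^'k"
  assumes "orthogonal_matrix A" "orthogonal_matrix B"
  shows "orthogonal_matrix (A ** B)"
  by (rule orthogonal_matrixI) (simp add: assms dot_orthogonal flip: matrix_vector_mul_assoc)

lemma orthogonal_matrix_vec_eq_0: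
  fixes A :: "complex^'k^'k"
  assumes "orthogonal_matrix A" "A *v x = 0"
  shows "x = 0"
  by (metis assms matrix_vector_mul_assoc matrix_vector_mul_lid matrix_vector_mult_0_right orthogonal_matrix_def)


section \<open>The null cone model\<close>

text \<open>Light-cone coordinates: \<open>mk y a b\<close> has square \<open>\<Sum> (y\<^sub>i)\<^sup>2 + a b\<close>, and complex conjugation
  exchanges \<open>a\<close> and \<open>b\<close>.\<close>

definition mk :: "complex^'n \<Rightarrow> complex \<Rightarrow> complex \<Rightarrow> complex^('n::finite + bool)" where
  "mk y a b = (\<chi> i. case i of Inl j \<Rightarrow> y $ j | Inr s \<Rightarrow> if s then (a + b) / 2 else \<i> * (a - b) / 2)"

definition mid :: "complex^('n::finite + bool) \<Rightarrow> complex^'n" where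
  "mid x = (\<chi> j. x $ Inl j)"

definition hplus :: "complex^('n::finite + bool) \<Rightarrow> complex" where
  "hplus x = x $ Inr True - \<i> * x $ Inr False"

definition hminus :: "complex^('n::finite + bool) \<Rightarrow> complex" where
  "hminus x = x $ Inr True + \<i> * x $ Inr False"

lemma mk_sel: "mid (mk y a b) = y" "hplus (mk y a b) = a" "hminus (mk y a b) = b"
  by (simp_all add: mk_def mid_def hplus_def hminus_def vec_eq_iff field_simps flip: mult.assoc)

lemma mk_collapse: "mk (mid x) (hplus x) (hminus x) = x"
  by (auto simp: mk_def mid_def hplus_def hminus_def vec_eq_iff field_simps split: sum.splits)

lemma mk_eqI: "mid x = mid y \<Longrightarrow> hplus x = hplus y \<Longrightarrow> hminus x = hminus y \<Longrightarrow> x = y"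
  by (metis mk_collapse)

lemma mid_linear: "mid (x + y) = mid x + mid y" "mid (x - y) = mid x - mid y" "mid (- x) = - mid x"
    "mid (c *s x) = c *s mid x" "mid 0 = 0"
  by (simp_all add: mid_def vec_eq_iff)

lemma hplus_linear: "hplus (x + y) = hplus x + hplus y" "hplus (x - y) = hplus x - hplus y"
    "hplus (- x) = - hplus x" "hplus (c *s x) = c * hplus x" "hplus 0 = 0"
  by (simp_all add: hplus_def algebra_simps)

lemma hminus_linear: "hminus (x + y) = hminus x + hminus y" "hminus (x - y) = hminus x - hminus y"
    "hminus (- x) = - hminus x" "hminus (c *s x) = c * hminus x" "hminus 0 = 0"
  by (simp_all add: hminus_def algebra_simps)

lemmas sel_linear = mid_linear hplus_linear hminus_linear

lemma mk_linear: "mk y a b + mk y' a' b' = mk (y + y') (a + a') (b + b')"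
  "mk y a b - mk y' a' b' = mk (y - y') (a - a') (b - b')"
  "c *s mk y a b = mk (c *s y) (c * a) (c * b)"
  "- mk y a b = mk (- y) (- a) (- b)"
  by (rule mk_eqI; simp add: sel_linear mk_sel)+

lemma sum_UNIV_ext:
  fixes f :: "'n::finite + bool \<Rightarrow> 'a::comm_monoid_add"
  shows "(\<Sum>i\<in>UNIV. f i) = (\<Sum>j\<in>UNIV. f (Inl j)) + (f (Inr True) + f (Inr False))"
proof -
  have "(\<Sum>i\<in>UNIV. f i) = (\<Sum>i\<in>UNIV <+> UNIV. f i)" by simp
  also have "\<dots> = (\<Sum>j\<in>UNIV. f (Inl j)) + (\<Sum>j\<in>UNIV. f (Inr j))"
    by (subst sum.Plus) auto
  finally show ?thesis by (simp add: UNIV_bool add.commute)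
qed

lemma dot_ext: "dot x y = dot (mid x) (mid y) + (hplus x * hminus y + hminus x * hplus y) / 2"
  unfolding dot_def sum_UNIV_ext
  by (simp add: mid_def hplus_def hminus_def field_simps)

definition psi :: "complex^'n \<Rightarrow> complex^('n::finite + bool)" where
  "psi z = mk z 1 (- Delta z)"

lemma psi_sel: "mid (psi z) = z" "hplus (psi z) = 1" "hminus (psi z) = - Delta z"
  by (simp_all add: psi_def mk_sel)

text \<open>The reason the model works: up to the factor -1/2, the form of two points of the cone is
  Delta of their difference. Isometries of C^N therefore change such values only by scale factors,
  and Q(z - a) is a multiple of the square of a linear form.\<close>

lemma dot_psi: "dot (psi z) (psi w) = - Delta (z - w) / 2"
  by (simp add: dot_ext psi_sel Delta_eq_dot dot_simps dot_commute[of w z] field_simps)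

lemma psi_isotropic: "dot (psi z) (psi z) = 0"
  by (simp add: dot_psi Delta_zero)

lemma psi_nonzero: "psi z \<noteq> 0"
  by (metis hplus_linear(5) psi_sel(2) zero_neq_one)

text \<open>On the cone \<open>hminus\<close> is determined by the other coordinates once
  \<open>hplus\<close> is nonzero, so a null line misses the chart only if \<open>hplus\<close>
  vanishes on it.\<close>

lemma isotropic_psi:
  assumes "dot x x = 0" "hplus x \<noteq> 0"
  shows "x = hplus x *s psi (inverse (hplus x) *s mid x)"
proof (rule mk_eqI)
  have "Delta (mid x) = - (hplus x * hminus x)"
    using assms(1) by (simp add: dot_ext Delta_eq_dot field_simps eq_neg_iff_add_eq_0)
  then show "hminus x = hminus (hplus x *s psi (inverse (hplus x) *s mid x))"
    using assms(2) by (simp add: sel_linear psi_sel Delta_scale field_simps power2_eq_square)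
qed (use assms in \<open>simp_all add: sel_linear psi_sel vector_smult_assoc\<close>)

lemma vec_axis_sum: "(y :: complex^'n) = (\<Sum>j\<in>UNIV. y $ j *s axis j 1)"
  by (simp add: vec_eq_iff axis_def if_distrib[where f="\<lambda>a. _ * a"] cong: if_cong)

lemma mid_sum: "mid (sum f A) = (\<Sum>a\<in>A. mid (f a))"
  by (simp add: mid_def vec_eq_iff)

lemma hplus_sum: "hplus (sum f A) = (\<Sum>a\<in>A. hplus (f a))"
  by (simp add: hplus_def sum_subtractf sum_distrib_left)

lemma hminus_sum: "hminus (sum f A) = (\<Sum>a\<in>A. hminus (f a))"
  by (simp add: hminus_def sum.distrib sum_distrib_left)

text \<open>Differences of opposite points isolate the directions of V, and \<open>psi 0\<close>
  minus the mean of such a pair isolates the last null vector, because Delta is 1 on the axes.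
  Finitely many points of the chart thus span C^N, and linear maps can be tested on them.\<close>

lemma psi_frame:
  fixes x :: "complex^('n::finite + bool)" and k :: 'n
  shows "x = (\<Sum>j\<in>UNIV. (mid x $ j / 2) *s (psi (axis j 1) - psi (- axis j 1)))
     + (hplus x *s psi 0 + hminus x *s (psi 0 - (1/2) *s (psi (axis k 1) + psi (- axis k 1))))"
    (is "_ = ?S + ?T")
proof (rule mk_eqI)
  have half: "(c / 2) *s (y - - y) = c *s y" for c and y :: "complex^'n"
    by (simp add: vec_eq_iff)
  show "mid x = mid (?S + ?T)"
  proof -
    have "mid ?S = mid x"
      by (simp only: mid_sum mid_linear psi_sel half flip: vec_axis_sum)
    then show ?thesis
      by (simp add: sel_linear psi_sel)
  qed
qed (simp_all add: sel_linear psi_sel hplus_sum hminus_sum Delta_minus Delta_axis Delta_zero)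

lemma dot_psi_eq_0D:
  assumes "\<And>z. dot x (psi z) = 0"
  shows "x = 0"
proof (rule dot_eqI)
  fix y
  show "dot x y = dot 0 y"
    by (subst psi_frame[of y undefined])
       (simp add: dot_simps assms dot_sum_right)
qed

section \<open>Polynomial functions and rational extensions\<close>

lemma polynomial_fun_sum:
  "(\<And>a. a \<in> S \<Longrightarrow> polynomial_fun (f a)) \<Longrightarrow> polynomial_fun (\<lambda>z. \<Sum>a\<in>S. f a z)"
  by (induction S rule: infinite_finite_induct) (auto intro: polynomial_fun.intros)

lemma polynomial_fun_cmult: "polynomial_fun f \<Longrightarrow> polynomial_fun (\<lambda>z. c * f z)"
  by (intro polynomial_fun.mult polynomial_fun.const)

lemma polynomial_fun_minus: "polynomial_fun f \<Longrightarrow> polynomial_fun (\<lambda>z. - f z)"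
  using polynomial_fun_cmult[of f "-1"] by simp

lemma polynomial_fun_diff:
  "polynomial_fun f \<Longrightarrow> polynomial_fun g \<Longrightarrow> polynomial_fun (\<lambda>z. f z - g z)"
  using polynomial_fun.add[OF _ polynomial_fun_minus, of f g] by simp

lemma polynomial_fun_divide: "polynomial_fun f \<Longrightarrow> polynomial_fun (\<lambda>z. f z / c)"
  using polynomial_fun_cmult[of f "inverse c"] by (simp add: field_simps)

lemmas polynomial_intros = polynomial_fun.intros polynomial_fun_sum polynomial_fun_minus
  polynomial_fun_diff polynomial_fun_divide

lemma polynomial_fun_Delta: "polynomial_fun Delta"
  unfolding Delta_def power2_eq_square by (intro polynomial_intros)

lemma polynomial_fun_mk:
  assumes "\<And>j. polynomial_fun (\<lambda>z. y z $ j)" "polynomial_fun a" "polynomial_fun b"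
  shows "polynomial_fun (\<lambda>z. mk (y z) (a z) (b z) $ i)"
proof (cases i)
  case (Inr s)
  then show ?thesis
    by (cases s) (auto simp: mk_def intro!: polynomial_intros assms)
qed (auto simp: mk_def assms)

lemma polynomial_fun_matrix_psi: "polynomial_fun (\<lambda>z. (A *v psi z) $ i)"
proof -
  have "polynomial_fun (\<lambda>z. psi z $ i)" for i
    unfolding psi_def by (intro polynomial_intros polynomial_fun_mk polynomial_fun_Delta)
  then show ?thesis
    unfolding matrix_vector_mult_def by (auto intro!: polynomial_intros)
qed

lemma polynomial_fun_hplus_psi: "polynomial_fun (\<lambda>z. hplus (A *v psi z))"
  unfolding hplus_def by (intro polynomial_intros polynomial_fun_matrix_psi)

lemma polynomial_fun_mid_psi: "polynomial_fun (\<lambda>z. mid (A *v psi z) $ i)"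
  by (simp add: mid_def polynomial_fun_matrix_psi)

lemma polynomial_fun_continuous: "polynomial_fun f \<Longrightarrow> continuous_on UNIV f"
  by (induction rule: polynomial_fun.induct) (auto intro!: continuous_intros)

lemma polynomial_fun_line:
  assumes "polynomial_fun f"
  shows "\<exists>p. \<forall>t. f (z + t *s w) = poly p t"
  using assms
proof induction
  case (const c)
  show ?case by (rule exI[of _ "[:c:]"]) simp
next
  case (coord i)
  show ?case by (rule exI[of _ "[:z $ i, w $ i:]"]) simp
next
  case (add f g)
  then show ?case by (metis poly_add)
next
  case (mult f g)
  then show ?case by (metis poly_mult)
qed

lemma scaleR_eq_scale: "r *\<^sub>R (w :: complex^'k) = complex_of_real r *s w"
proof (unfold vec_eq_iff, intro allI)
  fix i
  show "(r *\<^sub>R w) $ i = (complex_of_real r *s w) $ i"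
    by (subst vector_scaleR_component, subst vector_smult_component, rule scaleR_conv_of_real)
qed

text \<open>Restriction to the complex line from z through \<open>z\<^sub>0\<close> leaves a
  polynomial in one variable that is nonzero at 1; its finitely many zeros cannot fill a short
  interval of real parameters.\<close>

lemma polynomial_fun_nonzero_dense:
  assumes "polynomial_fun q" "q z\<^sub>0 \<noteq> 0"
  shows "closure {z. q z \<noteq> 0} = UNIV"
proof -
  have "\<exists>y\<in>{z. q z \<noteq> 0}. dist y z < e" if "e > 0" for z e
  proof -
    obtain p where p: "\<And>t. q (z + t *s (z\<^sub>0 - z)) = poly p t"
      using polynomial_fun_line[OF assms(1)] by blast
    from p[of 1] assms(2) have "p \<noteq> 0" by auto
    then have fin: "finite (complex_of_real -` {t. poly p t = 0})"
      by (intro finite_vimageI poly_roots_finite) (auto simp: inj_on_def)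
    \<comment> \<open>The summand 1 keeps the denominator positive when z and
      \<open>z\<^sub>0\<close> coincide.\<close>
    define d where "d = e / (norm (z\<^sub>0 - z) + 1)"
    have pos: "norm (z\<^sub>0 - z) + 1 > 0"
      by (rule add_nonneg_pos) auto
    then have "d > 0" using that by (simp add: d_def)
    then have "infinite ({0<..<d} - complex_of_real -` {t. poly p t = 0})"
      by (intro Diff_infinite_finite fin infinite_Ioo)
    then have "{0<..<d} - complex_of_real -` {t. poly p t = 0} \<noteq> {}"
      by (metis finite.emptyI)
    then obtain t where "t \<in> {0<..<d} - complex_of_real -` {t. poly p t = 0}"
      by blast
    then have t: "0 < t" "t < d" "poly p (complex_of_real t) \<noteq> 0"
      by simp_all
    have "t * norm (z\<^sub>0 - z) \<le> t * (norm (z\<^sub>0 - z) + 1)"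
      using t by simp
    also have "\<dots> < e"
      using t pos by (simp add: d_def field_simps)
    finally have "dist (z + complex_of_real t *s (z\<^sub>0 - z)) z < e"
      using t by (simp only: dist_norm add_diff_cancel_left' norm_scaleR flip: scaleR_eq_scale)
    moreover have "q (z + complex_of_real t *s (z\<^sub>0 - z)) \<noteq> 0"
      unfolding p by (rule t)
    ultimately show ?thesis by blast
  qed
  then show ?thesis
    by (auto simp: closure_approachable)
qed

lemma open_polynomial_nonzero: "polynomial_fun q \<Longrightarrow> open {z. q z \<noteq> 0}"
  using polynomial_fun_continuous continuous_on_open_vimage[of UNIV q] open_Compl[of "{0::complex}"]
  by (auto simp: vimage_def)

lemma dense_open_Int:
  "open U \<Longrightarrow> closure U = UNIV \<Longrightarrow> closure V = UNIV \<Longrightarrow> closure (U \<inter> V) = UNIV"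
  using closure_open_Int_superset[of U V] by simp

lemma eq_on_dense:
  fixes f g :: "'a::topological_space \<Rightarrow> 'b::t2_space"
  assumes "continuous_on UNIV f" "continuous_on UNIV g" "closure U = UNIV"
    and "\<And>x. x \<in> U \<Longrightarrow> f x = g x"
  shows "f x = g x"
proof -
  have "closure U \<subseteq> {x. f x = g x}"
    using assms by (intro closure_minimal closed_Collect_eq) auto
  then show ?thesis using assms(3) by auto
qed

section \<open>Conformal maps given by orthogonal matrices\<close>

definition conf_map :: "complex^('n::finite + bool)^('n + bool) \<Rightarrow> 'n rational_map" where
  "conf_map A z = (if hplus (A *v psi z) = 0 then None
     else Some (inverse (hplus (A *v psi z)) *s mid (A *v psi z)))"

lemma conf_map_eq_Some_iff:
  assumes "orthogonal_matrix A"
  shows "conf_map A z = Some w \<longleftrightarrow> A *v psi z = hplus (A *v psi z) *s psi w" (is "_ \<longleftrightarrow> ?r")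
proof
  assume "conf_map A z = Some w"
  then show ?r
    using isotropic_psi[of "A *v psi z"] assms
    by (auto simp: conf_map_def dot_orthogonal psi_isotropic split: if_splits)
next
  assume *: ?r
  have "hplus (A *v psi z) \<noteq> 0"
    using * orthogonal_matrix_vec_eq_0[OF assms, of "psi z"] psi_nonzero[of z] by auto
  moreover have "mid (A *v psi z) = hplus (A *v psi z) *s w"
    by (subst *) (simp add: sel_linear psi_sel)
  ultimately show "conf_map A z = Some w"
    by (simp add: conf_map_def vector_smult_assoc)
qed

lemma hplus_dot: "hplus x = dot x (mk 0 0 2)"
  by (simp add: dot_ext mk_sel dot_simps)

text \<open>Otherwise a nonzero vector would be orthogonal to every \<open>psi z\<close>, although
  these span C^N.\<close>

lemma hplus_orthogonal_nonzero:
  fixes A :: "complex^('n::finite + bool)^('n + bool)"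
  assumes "orthogonal_matrix A"
  shows "\<exists>z. hplus (A *v psi z) \<noteq> 0"
proof (rule ccontr)
  assume "\<not> ?thesis"
  then have "dot (transpose A *v mk 0 0 2) (psi z) = 0" for z
    by (simp add: hplus_dot dot_matrix_left dot_commute)
  then have "transpose A *v mk 0 0 2 = 0"
    by (rule dot_psi_eq_0D)
  then have "mk 0 0 2 = (0 :: complex^('n + bool))"
    by (rule orthogonal_matrix_vec_eq_0[rotated]) (use assms in simp)
  then show False
    by (metis hminus_linear(5) mk_sel(3) zero_neq_numeral)
qed

lemma conf_map_domain:
  assumes "orthogonal_matrix A"
  shows "open {z. hplus (A *v psi z) \<noteq> 0}" "closure {z. hplus (A *v psi z) \<noteq> 0} = UNIV"
proof -
  show "open {z. hplus (A *v psi z) \<noteq> 0}"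
    by (intro open_polynomial_nonzero polynomial_fun_hplus_psi)
  obtain z where "hplus (A *v psi z) \<noteq> 0"
    using hplus_orthogonal_nonzero[OF assms] by blast
  with polynomial_fun_hplus_psi show "closure {z. hplus (A *v psi z) \<noteq> 0} = UNIV"
    by (rule polynomial_fun_nonzero_dense)
qed

text \<open>The maximal domain of a conformal map is exactly the non-vanishing set of its denominator:
  clearing the denominators of a competing fraction gives an identity that extends by density.\<close>

lemma regular_value_conf_map:
  assumes A: "orthogonal_matrix A" and U: "open U" "closure U = UNIV"
    and f: "\<And>x. x \<in> U \<Longrightarrow> f x = conf_map A x"
  shows "regular_value f z w \<longleftrightarrow> conf_map A z = Some w"
proof
  assume "regular_value f z w"
  then obtain P q U' where P: "\<And>i. polynomial_fun (\<lambda>x. P x $ i)" and q: "polynomial_fun q"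
    and U': "open U'" "closure U' = UNIV"
    and eq: "\<And>x. x \<in> U' \<Longrightarrow> q x \<noteq> 0 \<and> f x = Some (inverse (q x) *s P x)"
    and z: "q z \<noteq> 0" "w = inverse (q z) *s P z"
    unfolding regular_value_def by blast
  \<comment> \<open>The last coordinate of \<open>psi\<close> is quadratic, so two factors of q are
    needed; afterwards all coordinates are polynomials in x.\<close>
  have clear: "(q x)\<^sup>2 *s psi (inverse (q x) *s P x) = mk (q x *s P x) ((q x)\<^sup>2) (- Delta (P x))"
    if "q x \<noteq> 0" for x
    using that by (intro mk_eqI)
      (simp_all add: sel_linear psi_sel mk_sel Delta_scale vector_smult_assoc power2_eq_square field_simps)
  let ?l = "\<lambda>x i. (q x)\<^sup>2 * (A *v psi x) $ i"
  let ?r = "\<lambda>x i. hplus (A *v psi x) * mk (q x *s P x) ((q x)\<^sup>2) (- Delta (P x)) $ i"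
  have "?l z i = ?r z i" for i
  proof (rule eq_on_dense[where U="U \<inter> U'" and f="\<lambda>x. ?l x i" and g="\<lambda>x. ?r x i" and x=z])
    show "continuous_on UNIV (\<lambda>x. ?l x i)"
      by (intro continuous_intros polynomial_fun_continuous q polynomial_fun_matrix_psi)
    have "polynomial_fun (\<lambda>x. (mk (q x *s P x) ((q x)\<^sup>2) (- Delta (P x))) $ i)"
      unfolding Delta_def power2_eq_square
      by (intro polynomial_fun_mk) (auto intro!: polynomial_intros P q)
    then show "continuous_on UNIV (\<lambda>x. ?r x i)"
      by (intro continuous_intros polynomial_fun_continuous polynomial_fun_hplus_psi)
    show "closure (U \<inter> U') = UNIV"
      using U U' by (intro dense_open_Int)
    fix x assume x: "x \<in> U \<inter> U'"
    then have "conf_map A x = Some (inverse (q x) *s P x)"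
      using f eq by (metis IntE)
    then have *: "A *v psi x = hplus (A *v psi x) *s psi (inverse (q x) *s P x)"
      by (simp add: conf_map_eq_Some_iff[OF A])
    have "q x \<noteq> 0" using eq x by auto
    then show "?l x i = ?r x i"
      by (subst *, subst clear[symmetric]) auto
  qed
  then have "(q z)\<^sup>2 *s (A *v psi z) = hplus (A *v psi z) *s ((q z)\<^sup>2 *s psi w)"
    unfolding z(2) clear[OF z(1)] by (simp add: vec_eq_iff)
  then have "A *v psi z = hplus (A *v psi z) *s psi w"
    using z(1) by (simp add: vec_eq_iff)
  then show "conf_map A z = Some w"
    by (simp add: conf_map_eq_Some_iff[OF A])
next
  assume *: "conf_map A z = Some w"
  let ?V = "U \<inter> {z. hplus (A *v psi z) \<noteq> 0}"
  have "open ?V" "closure ?V = UNIV"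
    using U conf_map_domain[OF A] by (simp_all add: open_Int dense_open_Int)
  moreover have "f x = Some (inverse (hplus (A *v psi x)) *s mid (A *v psi x))" if "x \<in> ?V" for x
    using that f by (auto simp: conf_map_def)
  ultimately show "regular_value f z w"
    unfolding regular_value_def
    using * by (intro exI[of _ "\<lambda>z. mid (A *v psi z)"] exI[of _ "\<lambda>z. hplus (A *v psi z)"] exI[of _ ?V])
      (auto simp: conf_map_def polynomial_fun_hplus_psi polynomial_fun_mid_psi split: if_splits)
qed

lemma rational_extension_conf_map:
  assumes "orthogonal_matrix A" "open U" "closure U = UNIV"
    and "\<And>x. x \<in> U \<Longrightarrow> f x = conf_map A x"
  shows "rational_extension f = conf_map A"
proof
  fix z
  have "regular_value f z w \<longleftrightarrow> conf_map A z = Some w" for w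
    using assms by (rule regular_value_conf_map)
  then show "rational_extension f z = conf_map A z"
    unfolding rational_extension_def by (cases "conf_map A z") auto
qed

lemma conf_map_scale_arg:
  assumes "B *v psi z = c *s (A *v psi w)" "c \<noteq> 0"
  shows "conf_map B z = conf_map A w"
  using assms(2) by (simp add: conf_map_def assms(1) sel_linear vector_smult_assoc)

text \<open>The composite of partial functions is undefined at the poles of the inner map even where
  the product is regular. Agreement on the dense domain of the inner map suffices, since the maximal
  extension restores the other points.\<close>

lemma conf_map_comp:
  assumes "orthogonal_matrix A" "orthogonal_matrix B"
  shows "conf_map A \<circ>\<^sub>r conf_map B = conf_map (A ** B)"
  unfolding rational_comp_def
proof (rule rational_extension_conf_map)
  fix x assume x: "x \<in> {z. hplus (B *v psi z) \<noteq> 0}"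
  then obtain w where w: "conf_map B x = Some w"
    by (auto simp: conf_map_def)
  then have "B *v psi x = hplus (B *v psi x) *s psi w"
    by (simp add: conf_map_eq_Some_iff[OF assms(2)])
  then have "(A ** B) *v psi x = hplus (B *v psi x) *s (A *v psi w)"
    by (metis matrix_mult_scale matrix_vector_mul_assoc)
  then have "conf_map (A ** B) x = conf_map A w"
    by (rule conf_map_scale_arg) (use x in auto)
  then show "(conf_map A \<circ>\<^sub>m conf_map B) x = conf_map (A ** B) x"
    by (simp add: map_comp_def w)
qed (use assms in \<open>auto simp: orthogonal_matrix_mult conf_map_domain\<close>)

lemma conf_map_id: "conf_map (mat 1) = Some"
  by (rule ext) (simp add: conf_map_def psi_sel)

text \<open>This is the source of the sign ambiguity that later has to be removed from paths of
  matrices.\<close>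

lemma conf_map_uminus: "conf_map (- A) = conf_map A"
proof
  fix z
  have "(- A) *v psi z = - (A *v psi z)"
    by (simp add: matrix_vector_mult_def vec_eq_iff sum_negf)
  then show "conf_map (- A) z = conf_map A z"
    by (intro conf_map_scale_arg[of _ _ "-1"]) auto
qed

section \<open>The conformal group as a group of orthogonal matrices\<close>

lemma vec_linear_iff:
  "Vector_Spaces.linear (*s) (*s) f \<longleftrightarrow>
    (\<forall>x y. f (x + y) = f x + f y) \<and> (\<forall>c x. f (c *s x) = c *s f x)"
  for f :: "complex^'a \<Rightarrow> complex^'b"
  by (simp add: Vector_Spaces.linear_iff vec.vector_space_axioms)

section \<open>Matrices of the generators of the conformal group\<close>

lemma isometry_matrix:
  fixes f :: "complex^'k \<Rightarrow> complex^'k"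
  assumes "\<And>x y. f (x + y) = f x + f y" "\<And>c x. f (c *s x) = c *s f x"
  shows "matrix f *v x = f x"
    and "(\<And>x y. dot (f x) (f y) = dot x y) \<Longrightarrow> orthogonal_matrix (matrix f)"
proof -
  show *: "matrix f *v x = f x" for x
    by (rule matrix_works) (simp add: vec_linear_iff assms)
  show "orthogonal_matrix (matrix f)" if "\<And>x y. dot (f x) (f y) = dot x y"
    by (rule orthogonal_matrixI) (simp add: * that)
qed

text \<open>The coefficients are forced by sending \<open>psi z\<close> to
  \<open>psi (z + a)\<close>: the last coordinate expands -Delta(z + a), with \<open>hplus\<close>
  as the homogenising variable.\<close>

definition translation_mat :: "complex^'n::finite \<Rightarrow> complex^('n + bool)^('n + bool)" where
  "translation_mat a = matrix (\<lambda>x. mk (mid x + hplus x *s a) (hplus x)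
     (hminus x - 2 * dot a (mid x) - Delta a * hplus x))"

lemma translation_mat:
  shows translation_mat_apply: "translation_mat a *v x = mk (mid x + hplus x *s a) (hplus x)
     (hminus x - 2 * dot a (mid x) - Delta a * hplus x)"
    and orthogonal_translation_mat: "orthogonal_matrix (translation_mat a)"
proof -
  let ?f = "\<lambda>x. mk (mid x + hplus x *s a) (hplus x) (hminus x - 2 * dot a (mid x) - Delta a * hplus x)"
  have 1: "?f (x + y) = ?f x + ?f y" "?f (c *s x) = c *s ?f x" for x y c
    by (simp_all add: mk_linear sel_linear dot_simps algebra_simps)
  have 2: "dot (?f x) (?f y) = dot x y" for x y
    by (simp add: dot_ext mk_sel dot_simps Delta_eq_dot dot_commute[of "mid x" a] field_simps)
  show "translation_mat a *v x = ?f x" "orthogonal_matrix (translation_mat a)"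
    unfolding translation_mat_def by (rule isometry_matrix 1 2)+
qed

text \<open>On \<open>psi z\<close> with Delta(z) nonzero the exchange yields -Delta(z) times
  \<open>psi\<close> of -z/Delta(z), so it induces the inversion with the required sign.\<close>

definition swap_mat :: "complex^('n::finite + bool)^('n + bool)" where
  "swap_mat = matrix (\<lambda>x. mk (mid x) (hminus x) (hplus x))"

lemma swap_mat:
  shows swap_mat_apply: "swap_mat *v x = mk (mid x) (hminus x) (hplus x)"
    and orthogonal_swap_mat: "orthogonal_matrix swap_mat"
proof -
  let ?f = "\<lambda>x. mk (mid x) (hminus x) (hplus x)"
  have 1: "?f (x + y) = ?f x + ?f y" "?f (c *s x) = c *s ?f x" for x y c
    by (simp_all add: mk_linear sel_linear)
  have 2: "dot (?f x) (?f y) = dot x y" for x y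
    by (simp add: dot_ext mk_sel)
  show "swap_mat *v x = ?f x" "orthogonal_matrix swap_mat"
    unfolding swap_mat_def by (rule isometry_matrix 1 2)+
qed

lemma translation_mat_psi: "translation_mat a *v psi z = psi (z + a)"
  by (rule mk_eqI)
     (simp_all add: translation_mat_apply psi_sel mk_sel Delta_eq_dot dot_simps dot_commute[of a z])

lemma conf_map_translation: "conf_map (translation_mat a) = (\<lambda>z. Some (z + a))"
  by (rule ext) (simp add: conf_map_def translation_mat_psi psi_sel)

lemma conf_map_swap: "conf_map swap_mat = sigma"
  by (rule ext) (simp add: conf_map_def swap_mat_apply sigma_def psi_sel mk_sel vec_eq_iff)

lemma translation_mat_inverse: "translation_mat a ** translation_mat (- a) = mat 1"
  by (simp add: matrix_eq flip: matrix_vector_mul_assoc)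
     (auto intro!: mk_eqI simp: translation_mat_apply mk_sel dot_simps Delta_eq_dot algebra_simps)

lemma swap_mat_inverse: "swap_mat ** swap_mat = mat 1"
  by (simp add: matrix_eq flip: matrix_vector_mul_assoc) (simp add: swap_mat_apply mk_sel mk_collapse)

section \<open>Structure group elements as similarities of Delta\<close>

lemma Delta_matrix_polynomial: "polynomial_fun (\<lambda>z. Delta (M *v z))"
  unfolding Delta_def power2_eq_square matrix_vector_mult_def by (auto intro!: polynomial_intros)

text \<open>With s a square root of \<gamma>, the product of Delta(l z) - s Delta(z) and Delta(l z)
  + s Delta(z) vanishes identically. If the first factor is nonzero somewhere, it is nonzero on a
  dense set, and continuity makes the second vanish everywhere.\<close>

lemma Str_Delta:
  assumes "l \<in> Str"
  shows "\<exists>c. c \<noteq> 0 \<and> (\<forall>z. Delta (l z) = c * Delta z)"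
proof -
  from assms obtain \<gamma> where l: "Vector_Spaces.linear (*s) (*s) l" and \<gamma>: "\<gamma> \<noteq> 0"
    and Q: "\<And>z. Q (l z) = \<gamma> * Q z"
    unfolding Str_def by auto
  define s where "s = csqrt \<gamma>"
  have s: "s \<noteq> 0" "s\<^sup>2 = \<gamma>"
    using \<gamma> by (simp_all add: s_def)
  have poly: "polynomial_fun (\<lambda>z. Delta (l z))"
    using Delta_matrix_polynomial[of "matrix l"] by (simp add: matrix_works[OF l])
  have prod: "(Delta (l z) - s * Delta z) * (Delta (l z) + s * Delta z) = 0" for z
    using Q[of z] s by (simp add: Q_def algebra_simps power2_eq_square)
  show ?thesis
  proof (cases "\<forall>z. Delta (l z) = s * Delta z")
    case False
    then obtain z\<^sub>0 where z0: "Delta (l z\<^sub>0) - s * Delta z\<^sub>0 \<noteq> 0" by auto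
    have p1: "polynomial_fun (\<lambda>z. Delta (l z) - s * Delta z)"
      and p2: "polynomial_fun (\<lambda>z. Delta (l z) + s * Delta z)"
      by (intro polynomial_intros poly polynomial_fun_Delta)+
    have "Delta (l z) + s * Delta z = 0" for z
      by (rule eq_on_dense[OF polynomial_fun_continuous[OF p2] _ polynomial_fun_nonzero_dense[OF p1 z0]])
         (use prod in auto)
    then have "\<forall>z. Delta (l z) = (- s) * Delta z"
      by (simp add: eq_neg_iff_add_eq_0)
    then show ?thesis using s by (metis neg_equal_0_iff_equal)
  qed (use s in auto)
qed

text \<open>A similarity becomes an isometry after division by a square root s of its factor.
  Scaling the two null coordinates by 1/s and s preserves their product, and the quotient by
  \<open>hplus\<close> gives l back.\<close>

lemma Str_conf_map:
  assumes "l \<in> Str"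
  shows "\<exists>A. orthogonal_matrix A \<and> conf_map A = (\<lambda>z. Some (l z))"
proof -
  from assms have l: "l (x + y) = l x + l y" "l (c *s x) = c *s l x" for x y c
    by (auto simp: Str_def vec_linear_iff)
  from Str_Delta[OF assms] obtain c where c: "c \<noteq> 0" "\<And>z. Delta (l z) = c * Delta z" by auto
  define s where "s = csqrt c"
  have s: "s \<noteq> 0" "s * s = c"
    using c by (simp_all add: s_def flip: power2_eq_square)
  have polar: "dot x y = (Delta (x + y) - Delta x - Delta y) / 2" for x y :: "complex^'n"
    by (simp add: Delta_eq_dot dot_simps dot_commute[of y x])
  have dot_l: "dot (l x) (l y) = c * dot x y" for x y
    by (simp add: polar c(2) flip: l(1)) (simp add: algebra_simps)
  let ?f = "\<lambda>x. mk (inverse s *s l (mid x)) (inverse s * hplus x) (s * hminus x)"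
  have 1: "?f (x + y) = ?f x + ?f y" "?f (c *s x) = c *s ?f x" for x y c
    by (simp_all add: mk_linear sel_linear l vec_eq_iff algebra_simps)
  have 2: "dot (?f x) (?f y) = dot x y" for x y
    using s by (simp add: dot_ext mk_sel dot_simps dot_l field_simps flip: s(2))
  have 3: "matrix ?f *v x = ?f x" for x
    by (rule isometry_matrix 1)+
  have "orthogonal_matrix (matrix ?f)"
    by (rule isometry_matrix 1 2)+
  moreover have "conf_map (matrix ?f) z = Some (l z)" for z
    using s(1) by (simp add: conf_map_def 3 mk_sel psi_sel vector_smult_assoc)
  ultimately show ?thesis by blast
qed

lemma Conf_imp_conf_map:
  assumes "g \<in> Conf"
  shows "\<exists>A. orthogonal_matrix A \<and> g = conf_map A"
  using assms
proof induction
  case (translation a)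
  then show ?case by (metis conf_map_translation orthogonal_translation_mat)
next
  case (linear_map l)
  then show ?case by (metis Str_conf_map)
next
  case inversion
  then show ?case by (metis conf_map_swap orthogonal_swap_mat)
next
  case (comp g h)
  then show ?case by (metis conf_map_comp orthogonal_matrix_mult)
qed

text \<open>\<open>Conf\<close> is closed under composition by definition but not under inverses, so
  a generator is cancelled by composing with its explicit inverse matrix.\<close>

lemma conf_map_cancel_left:
  fixes A B B' :: "complex^('n::finite + bool)^('n + bool)"
  assumes "conf_map (B ** A) \<in> Conf" "conf_map B' \<in> Conf" "B' ** B = mat 1"
    "orthogonal_matrix A" "orthogonal_matrix B" "orthogonal_matrix B'"
  shows "conf_map A \<in> Conf"
proof -
  have "conf_map B' \<circ>\<^sub>r conf_map (B ** A) = conf_map A"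
    using assms by (simp add: conf_map_comp orthogonal_matrix_mult matrix_mul_assoc)
  then show ?thesis
    using assms Conf.comp by metis
qed

lemma conf_map_translation_cancel:
  assumes "conf_map (translation_mat a ** A) \<in> Conf" "orthogonal_matrix A"
  shows "conf_map A \<in> Conf"
  by (rule conf_map_cancel_left[OF assms(1), of "translation_mat (- a)"])
     (use assms translation_mat_inverse[of "- a"] Conf.translation[of "- a"] in
      \<open>simp_all add: orthogonal_translation_mat conf_map_translation\<close>)

lemma conf_map_swap_cancel:
  assumes "conf_map (swap_mat ** A) \<in> Conf" "orthogonal_matrix A"
  shows "conf_map A \<in> Conf"
  by (rule conf_map_cancel_left[OF assms(1), of swap_mat])
     (use assms Conf.inversion in
      \<open>simp_all add: orthogonal_swap_mat conf_map_swap swap_mat_inverse\<close>)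

text \<open>The point at infinity of the quadric is the line of \<open>mk 0 0 1\<close>, the origin that of
  \<open>mk 0 1 0\<close>. Stabilising both means acting linearly, stabilising the first means acting affinely,
  and translations and the inversion act transitively on the quadric.\<close>

lemma conf_map_fix_both:
  fixes C :: "complex^('n::finite + bool)^('n + bool)"
  assumes C: "orthogonal_matrix C" and c: "C *v mk 0 1 0 = c *s mk 0 1 0"
    and k: "C *v mk 0 0 1 = k *s mk 0 0 1"
  shows "conf_map C \<in> Conf"
proof -
  have ck: "c * k = 1"
    using dot_orthogonal[OF C, of "mk 0 1 0" "mk 0 0 1"]
    by (simp add: c k dot_simps) (simp add: dot_ext mk_sel dot_simps mult.commute)
  then have nz: "c \<noteq> 0" "k \<noteq> 0" by auto
  define L where "L z = mid (C *v mk z 0 0)" for z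
  \<comment> \<open>C preserves the orthogonal complement of the two fixed null lines, which is the
    copy of V.\<close>
  have CL: "C *v mk z 0 0 = mk (L z) 0 0" for z
  proof (rule mk_eqI)
    have "dot (C *v mk z 0 0) (C *v mk 0 0 1) = 0" "dot (C *v mk z 0 0) (C *v mk 0 1 0) = 0"
      by (simp_all only: dot_orthogonal[OF C]) (simp_all add: dot_ext mk_sel dot_simps)
    then show "hplus (C *v mk z 0 0) = hplus (mk (L z) 0 0)"
      "hminus (C *v mk z 0 0) = hminus (mk (L z) 0 0)"
      using nz by (simp_all add: c k dot_simps) (simp_all add: dot_ext mk_sel dot_simps)
  qed (simp add: L_def mk_sel)
  have L: "L (x + y) = L x + L y" "L (a *s x) = a *s L x" for x y a
  proof -
    have "mk (L (x + y)) 0 0 = mk (L x + L y) 0 0"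
      using matrix_vector_right_distrib[of C "mk x 0 0" "mk y 0 0"]
      by (simp add: mk_linear flip: CL) (simp add: CL mk_linear)
    then show "L (x + y) = L x + L y" by (metis mk_sel(1))
    have "mk (L (a *s x)) 0 0 = mk (a *s L x) 0 0"
      using matrix_mult_scale[of C a "mk x 0 0"]
      by (simp add: mk_linear flip: CL) (simp add: CL mk_linear)
    then show "L (a *s x) = a *s L x" by (metis mk_sel(1))
  qed
  have dot_L: "dot (L x) (L y) = dot x y" for x y
    using dot_orthogonal[OF C, of "mk x 0 0" "mk y 0 0"]
    unfolding CL by (simp add: dot_ext mk_sel)
  \<comment> \<open>The projective quotient divides by c, and 1/c = k because the form pairs the two
    null vectors.\<close>
  define l where "l z = k *s L z" for z
  have "Vector_Spaces.linear (*s) (*s) l"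
    by (simp add: vec_linear_iff l_def L vec_eq_iff algebra_simps)
  moreover have "inj l"
  proof (rule injI)
    fix x y assume "l x = l y"
    then have "L x = L y" using nz by (simp add: l_def)
    then show "x = y" by (metis dot_L dot_eqI)
  qed
  moreover from calculation have "surj l"
    by (rule vec.linear_inj_imp_surj)
  moreover have "Q (l z) = k ^ 4 * Q z" for z
    by (simp add: l_def Q_def Delta_scale) (simp add: Delta_eq_dot dot_L power_mult_distrib flip: power_mult)
  ultimately have "l \<in> Str"
    using nz by (auto simp: Str_def bij_def intro!: exI[of _ "k ^ 4"])
  moreover have "conf_map C z = Some (l z)" for z
  proof -
    have *: "psi z = mk z 0 0 + mk 0 1 0 - Delta z *s mk 0 0 1"
      by (simp add: psi_def mk_linear)
    have "C *v psi z = mk (L z) c (- Delta z * k)"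
      unfolding * by (simp only: matrix_linear CL c k) (simp add: mk_linear)
    moreover have "inverse c = k" using ck nz by (simp add: field_simps)
    ultimately show ?thesis using nz by (simp add: conf_map_def mk_sel l_def)
  qed
  ultimately show ?thesis
    using Conf.linear_map by (metis ext)
qed

lemma conf_map_fix_infinity:
  assumes B: "orthogonal_matrix B" and k: "B *v mk 0 0 1 = k *s mk 0 0 1"
  shows "conf_map B \<in> Conf"
proof -
  \<comment> \<open>The pairing of \<open>psi 0\<close> with the fixed null line is nonzero, so B
    sends the origin to a finite point.\<close>
  have hk: "hplus (B *v psi 0) * k = 1"
    using dot_orthogonal[OF B, of "psi 0" "mk 0 0 1"]
    by (simp add: k dot_simps) (simp add: dot_ext mk_sel dot_simps psi_sel mult.commute)
  have "B *v psi 0 = hplus (B *v psi 0) *s psi (inverse (hplus (B *v psi 0)) *s mid (B *v psi 0))"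
    by (rule isotropic_psi) (use hk in \<open>auto simp: dot_orthogonal[OF B] psi_isotropic\<close>)
  then obtain b where b: "B *v psi 0 = hplus (B *v psi 0) *s psi b"
    by (rule that)
  let ?C = "translation_mat (- b) ** B"
  have psi0: "psi 0 = mk 0 1 0"
    by (simp add: psi_def Delta_zero)
  have "?C *v psi 0 = hplus (B *v psi 0) *s psi 0"
    unfolding matrix_vector_mul_assoc[symmetric]
    by (subst b) (simp add: matrix_mult_scale translation_mat_psi)
  moreover have "?C *v mk 0 0 1 = k *s mk 0 0 1"
    by (simp add: k matrix_mult_scale flip: matrix_vector_mul_assoc)
       (simp add: translation_mat_apply mk_sel dot_simps mk_linear)
  ultimately have "conf_map ?C \<in> Conf"
    unfolding psi0 by (intro conf_map_fix_both orthogonal_matrix_mult orthogonal_translation_mat B)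
  then show ?thesis using B by (rule conf_map_translation_cancel)
qed

text \<open>The image of infinity is a finite point a. Translating a to 0 and inverting brings it
  back to infinity, so the product stabilises infinity.\<close>

lemma conf_map_in_Conf_aux:
  assumes A: "orthogonal_matrix A" and x: "hplus (A *v mk 0 0 1) \<noteq> 0"
  shows "conf_map A \<in> Conf"
proof -
  define x where "x = A *v mk 0 0 1"
  have "dot x x = 0"
    by (simp add: x_def dot_orthogonal[OF A]) (simp add: dot_ext mk_sel dot_simps)
  then have "x = hplus x *s psi (inverse (hplus x) *s mid x)"
    by (rule isotropic_psi) (use x in \<open>simp add: x_def\<close>)
  then obtain a where a: "x = hplus x *s psi a"
    by (rule that)
  have "(swap_mat ** (translation_mat (- a) ** A)) *v mk 0 0 1 = swap_mat *v (translation_mat (- a) *v x)"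
    by (simp add: x_def flip: matrix_vector_mul_assoc)
  also have "\<dots> = hplus x *s mk 0 0 1"
    by (subst a) (simp add: matrix_mult_scale translation_mat_psi swap_mat_apply psi_sel Delta_zero)
  finally have "conf_map (swap_mat ** (translation_mat (- a) ** A)) \<in> Conf"
    by (intro conf_map_fix_infinity orthogonal_matrix_mult orthogonal_translation_mat orthogonal_swap_mat A)
  then have "conf_map (translation_mat (- a) ** A) \<in> Conf"
    by (rule conf_map_swap_cancel) (intro orthogonal_matrix_mult orthogonal_translation_mat A)
  then show ?thesis using A by (rule conf_map_translation_cancel)
qed

lemma conf_map_in_Conf:
  assumes A: "orthogonal_matrix A"
  shows "conf_map A \<in> Conf"
proof (cases "hplus (A *v mk 0 0 1) = 0")
  case True
  define x where "x = A *v mk 0 0 1"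
  \<comment> \<open>A translation followed by the inversion moves x into the chart as soon as the
    translation produces a nonzero \<open>hminus\<close>. Failure for every c would force x =
    0.\<close>
  have "\<exists>c. hminus x - 2 * dot c (mid x) \<noteq> 0"
  proof (rule ccontr)
    assume "\<not> ?thesis"
    then have *: "hminus x = 2 * dot c (mid x)" for c by simp
    from *[of 0] have h: "hminus x = 0" by (simp add: dot_simps)
    have "mid x = 0"
      by (rule dot_eqI) (use * h in \<open>simp add: dot_simps dot_commute[of "mid x"]\<close>)
    with h True have "x = 0"
      by (intro mk_eqI) (simp_all add: sel_linear x_def)
    with orthogonal_matrix_vec_eq_0[OF A] have "mk 0 0 1 = (0 :: complex^('a + bool))"
      by (simp add: x_def)
    then show False by (metis hminus_linear(5) mk_sel(3) zero_neq_one)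
  qed
  then obtain c where c: "hminus x - 2 * dot c (mid x) \<noteq> 0" by blast
  have "hplus ((swap_mat ** (translation_mat c ** A)) *v mk 0 0 1) \<noteq> 0"
    using c True
    by (simp add: swap_mat_apply translation_mat_apply mk_sel x_def flip: matrix_vector_mul_assoc)
  then have "conf_map (swap_mat ** (translation_mat c ** A)) \<in> Conf"
    by (intro conf_map_in_Conf_aux orthogonal_matrix_mult orthogonal_translation_mat orthogonal_swap_mat A)
  then have "conf_map (translation_mat c ** A) \<in> Conf"
    by (rule conf_map_swap_cancel) (intro orthogonal_matrix_mult orthogonal_translation_mat A)
  then show ?thesis using A by (rule conf_map_translation_cancel)
qed (use A in \<open>simp add: conf_map_in_Conf_aux\<close>)

lemma conf_inv_conf_map:
  assumes "orthogonal_matrix A"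
  shows "conf_inv (conf_map A) = conf_map (transpose A)"
  unfolding conf_inv_def
proof (rule the_equality)
  have inv: "A ** transpose A = mat 1" "transpose A ** A = mat 1"
    using assms by (auto simp: orthogonal_matrix_def)
  then show "conf_map (transpose A) \<in> Conf \<and> conf_map A \<circ>\<^sub>r conf_map (transpose A) = Some \<and>
      conf_map (transpose A) \<circ>\<^sub>r conf_map A = Some"
    using assms by (simp add: conf_map_comp conf_map_in_Conf conf_map_id)
  fix h assume h: "h \<in> Conf \<and> conf_map A \<circ>\<^sub>r h = Some \<and> h \<circ>\<^sub>r conf_map A = Some"
  then obtain B where B: "orthogonal_matrix B" "h = conf_map B"
    using Conf_imp_conf_map by blast
  \<comment> \<open>Cancellation takes place among the maps, since equal maps need not have equal
    matrices.\<close>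
  have "conf_map B = conf_map (transpose A ** (A ** B))"
    by (simp add: matrix_mul_assoc inv)
  also have "\<dots> = conf_map (transpose A) \<circ>\<^sub>r conf_map (A ** B)"
    using assms B by (simp add: conf_map_comp orthogonal_matrix_mult)
  also have "conf_map (A ** B) = conf_map (mat 1)"
    using h B assms by (simp add: conf_map_id flip: conf_map_comp)
  also have "conf_map (transpose A) \<circ>\<^sub>r conf_map (mat 1) = conf_map (transpose A)"
    using assms by (simp add: conf_map_comp orthogonal_matrix_id)
  finally show "h = conf_map (transpose A)" using B by simp
qed

section \<open>Exponentials of bounded operators\<close>

text \<open>The exponential series needs a Banach algebra. The wrapper type carries composition of
  bounded operators as its multiplication; \<open>perfect_space\<close> excludes the zero space, so
  that the identity has norm 1 and differs from 0.\<close>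

typedef (overloaded) ('a :: real_normed_vector) endo = "UNIV :: ('a \<Rightarrow>\<^sub>L 'a) set"
  ..

setup_lifting type_definition_endo

instantiation endo :: ("{banach, perfect_space}") real_normed_algebra_1
begin

lift_definition zero_endo :: "'a endo" is 0 .
lift_definition one_endo :: "'a endo" is id_blinfun .
lift_definition plus_endo :: "'a endo \<Rightarrow> 'a endo \<Rightarrow> 'a endo" is "(+)" .
lift_definition minus_endo :: "'a endo \<Rightarrow> 'a endo \<Rightarrow> 'a endo" is "(-)" .
lift_definition uminus_endo :: "'a endo \<Rightarrow> 'a endo" is uminus .
lift_definition times_endo :: "'a endo \<Rightarrow> 'a endo \<Rightarrow> 'a endo" is "(o\<^sub>L)" .
lift_definition scaleR_endo :: "real \<Rightarrow> 'a endo \<Rightarrow> 'a endo" is scaleR .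
lift_definition norm_endo :: "'a endo \<Rightarrow> real" is norm .
lift_definition sgn_endo :: "'a endo \<Rightarrow> 'a endo" is sgn .

definition dist_endo :: "'a endo \<Rightarrow> 'a endo \<Rightarrow> real" where
  "dist_endo x y = norm (x - y)"

definition uniformity_endo :: "('a endo \<times> 'a endo) filter" where
  "uniformity_endo = (INF e\<in>{0<..}. principal {(x, y). dist x y < e})"

definition open_endo :: "'a endo set \<Rightarrow> bool" where
  "open_endo U = (\<forall>x\<in>U. eventually (\<lambda>(x', y). x' = x \<longrightarrow> y \<in> U) uniformity)"

instance
proof
  fix x y :: "'a endo"
  show "sgn x = scaleR (inverse (norm x)) x"
    by transfer (simp add: sgn_div_norm)
  show "norm (x + y) \<le> norm x + norm y"
    by transfer (rule norm_triangle_ineq)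
  show "norm (x * y) \<le> norm x * norm y"
    by transfer (rule norm_blinfun_compose)
  show "(0 :: 'a endo) \<noteq> 1"
    by transfer (metis norm_blinfun_id norm_zero zero_neq_one)
qed (rule dist_endo_def uniformity_endo_def open_endo_def |
    transfer, force intro!: blinfun_eqI simp: blinfun.bilinear_simps algebra_simps)+

end

lemma norm_Rep_endo: "norm (Rep_endo x) = norm x"
  by transfer simp

lemma Rep_endo_diff: "Rep_endo (x - y) = Rep_endo x - Rep_endo y"
  by transfer simp

instance endo :: ("{banach, perfect_space}") banach
proof
  fix X :: "nat \<Rightarrow> 'a endo"
  assume "Cauchy X"
  then have "Cauchy (\<lambda>n. Rep_endo (X n))"
    by (simp add: Cauchy_def dist_norm norm_Rep_endo flip: Rep_endo_diff)
  then obtain L where "(\<lambda>n. Rep_endo (X n)) \<longlonglongrightarrow> L"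
    by (auto simp: Cauchy_convergent_iff convergent_def)
  then have "(\<lambda>n. dist (Rep_endo (X n)) (Rep_endo (Abs_endo L))) \<longlonglongrightarrow> 0"
    by (subst (asm) tendsto_dist_iff) (simp add: Abs_endo_inverse)
  then have "X \<longlonglongrightarrow> Abs_endo L"
    by (subst tendsto_dist_iff) (simp add: dist_norm norm_Rep_endo flip: Rep_endo_diff)
  then show "convergent X"
    by (auto simp: convergent_def)
qed

definition endo_of :: "('a \<Rightarrow> 'a) \<Rightarrow> 'a :: {banach, perfect_space} endo" where
  "endo_of f = Abs_endo (Blinfun f)"

definition endo_apply :: "'a :: {banach, perfect_space} endo \<Rightarrow> 'a \<Rightarrow> 'a" where
  "endo_apply E = blinfun_apply (Rep_endo E)"

lemma endo_of_apply: "bounded_linear f \<Longrightarrow> endo_apply (endo_of f) = f"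
  by (simp add: endo_of_def endo_apply_def Abs_endo_inverse bounded_linear_Blinfun_apply)

lemma endo_apply_mult: "endo_apply (E * F) x = endo_apply E (endo_apply F x)"
  unfolding endo_apply_def by transfer simp

lemma endo_apply_one: "endo_apply 1 x = x"
  unfolding endo_apply_def by transfer simp

lemma endo_eqI: "(\<And>x. endo_apply E x = endo_apply F x) \<Longrightarrow> E = F"
  unfolding endo_apply_def by transfer (rule blinfun_eqI)

lemma bounded_linear_endo_apply: "bounded_linear (\<lambda>E. endo_apply E x)"
proof (rule bounded_linear_intro[of _ "norm x"])
  fix E F :: "'a endo" and r
  show "endo_apply (E + F) x = endo_apply E x + endo_apply F x"
    "endo_apply (r *\<^sub>R E) x = r *\<^sub>R endo_apply E x"
    unfolding endo_apply_def by (transfer; simp add: blinfun.bilinear_simps)+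
  show "norm (endo_apply E x) \<le> norm E * norm x"
    unfolding endo_apply_def by transfer (rule norm_blinfun)
qed

lemma exp_commutes:
  fixes x y :: "'a :: {real_normed_algebra_1, banach}"
  assumes "x * y = y * x"
  shows "exp x * y = y * exp x"
proof -
  have "exp x * y = (\<Sum>n. (x ^ n /\<^sub>R fact n) * y)"
    unfolding exp_def by (rule suminf_mult2[OF summable_exp_generic])
  also have "\<dots> = (\<Sum>n. y * (x ^ n /\<^sub>R fact n))"
    using power_commuting_commutes[OF assms] by simp
  also have "\<dots> = y * exp x"
    unfolding exp_def by (rule suminf_mult[OF summable_exp_generic])
  finally show ?thesis .
qed

definition flow :: "('a \<Rightarrow> 'a) \<Rightarrow> real \<Rightarrow> 'a \<Rightarrow> 'a :: {banach, perfect_space}" where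
  "flow f t = endo_apply (exp (t *\<^sub>R endo_of f))"

lemma flow_add: "flow f (s + t) x = flow f s (flow f t x)"
  unfolding flow_def scaleR_add_left
  by (subst exp_add_commuting) (simp_all add: endo_apply_mult)

lemma flow_0: "flow f 0 x = x"
  by (simp add: flow_def endo_apply_one)

lemma flow_has_vector_derivative:
  assumes "bounded_linear f"
  shows "((\<lambda>t. flow f t x) has_vector_derivative f (flow f t x)) (at t)"
proof -
  have "((\<lambda>t. endo_apply (exp (t *\<^sub>R endo_of f)) x) has_vector_derivative
      endo_apply (endo_of f * exp (t *\<^sub>R endo_of f)) x) (at t)"
    by (rule bounded_linear.has_vector_derivative[OF bounded_linear_endo_apply
          exp_scaleR_has_vector_derivative_left])
  then show ?thesis
    by (simp add: flow_def endo_apply_mult endo_of_apply assms)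
qed

text \<open>The flow is built over the reals. Commutation with complex scalars makes it complex
  linear, and commutation with the real linear map \<open>vec_cnj\<close> makes it real for real
  generators.\<close>

lemma flow_commutes:
  assumes f: "bounded_linear f" and c: "bounded_linear c" and "\<And>x. f (c x) = c (f x)"
  shows "flow f t (c x) = c (flow f t x)"
proof -
  have "t *\<^sub>R endo_of f * endo_of c = endo_of c * t *\<^sub>R endo_of f"
    by (rule endo_eqI)
       (simp add: endo_apply_mult endo_of_apply f c assms(3) bounded_linear.linear linear_scale
         linear_scale[OF bounded_linear.linear[OF bounded_linear_endo_apply]])
  from exp_commutes[OF this] show ?thesis
    by (metis endo_apply_mult endo_of_apply c flow_def)
qed

lemma bounded_linear_flow: "bounded_linear (flow f t)"
  unfolding flow_def endo_apply_def by (rule blinfun.bounded_linear_right)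

section \<open>Calculus for the null cone model\<close>

lemma bounded_linear_complexI:
  fixes f :: "complex^'a \<Rightarrow> complex^'b"
  assumes "\<And>x y. f (x + y) = f x + f y" "\<And>c x. f (c *s x) = c *s f x"
  shows "bounded_linear f"
  unfolding linear_conv_bounded_linear[symmetric]
  by (rule linearI) (simp_all add: assms scaleR_eq_scale)

lemma bounded_bilinear_dot: "bounded_bilinear (dot :: complex^'k \<Rightarrow> _)"
  unfolding bilinear_conv_bounded_bilinear[symmetric] bilinear_def
  by (auto intro!: linearI simp: dot_simps scaleR_eq_scale scaleR_conv_of_real)

lemma bounded_bilinear_scale: "bounded_bilinear ((*s) :: complex \<Rightarrow> complex^'k \<Rightarrow> _)"
  unfolding bilinear_conv_bounded_bilinear[symmetric] bilinear_def
  by (auto intro!: linearI simp: vec_eq_iff algebra_simps)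

lemma bounded_linear_mid: "bounded_linear mid"
  by (rule bounded_linear_complexI) (simp_all add: sel_linear)

lemma bounded_linear_hplus: "bounded_linear hplus"
  unfolding linear_conv_bounded_linear[symmetric]
  by (rule linearI) (simp_all add: sel_linear scaleR_eq_scale scaleR_conv_of_real)

lemma bounded_linear_mk: "bounded_linear (\<lambda>z. mk z 0 0)"
  by (rule bounded_linear_complexI) (simp_all add: mk_linear)

lemma bounded_linear_matrix: "bounded_linear ((*v) (A :: complex^'k^'k))"
  by (rule bounded_linear_complexI) (simp_all add: matrix_linear)

lemma bounded_linear_scale: "bounded_linear ((*s) a :: complex^'k \<Rightarrow> _)"
  by (rule bounded_bilinear.bounded_linear_right[OF bounded_bilinear_scale])

lemma bilinear_has_vector_derivative:
  assumes h: "bounded_bilinear h" and f: "(f has_vector_derivative f') (at t)"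
    and g: "(g has_vector_derivative g') (at t)"
  shows "((\<lambda>t. h (f t) (g t)) has_vector_derivative (h (f t) g' + h f' (g t))) (at t)"
  using bounded_bilinear.FDERIV[OF h f[unfolded has_vector_derivative_def] g[unfolded has_vector_derivative_def]]
  by (simp add: has_vector_derivative_def scaleR_add_right
      bounded_bilinear.scaleR_left[OF h] bounded_bilinear.scaleR_right[OF h])

lemma bilinear_differentiable:
  assumes "bounded_bilinear h" "f differentiable at t" "g differentiable at t"
  shows "(\<lambda>t. h (f t) (g t)) differentiable at t"
  using assms unfolding differentiable_def by (blast intro: bounded_bilinear.FDERIV)

lemma bounded_linear_differentiable:
  assumes "bounded_linear h" "f differentiable at t"
  shows "(\<lambda>t. h (f t)) differentiable at t"
  using assms unfolding differentiable_def by (blast intro: bounded_linear.has_derivative)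

lemma differentiable_eventually_eq:
  assumes "\<forall>\<^sub>F t in nhds x. f t = g t" "g differentiable at x"
  shows "f differentiable at x"
proof -
  from assms(2) obtain g' where g: "(g has_derivative g') (at x)"
    by (auto simp: differentiable_def)
  have "\<forall>\<^sub>F t in at x. g t = f t"
    using eventually_nhds_x_imp_x[OF assms(1)] assms(1)
    by (auto simp: eventually_at_filter elim: eventually_mono)
  moreover have "g x = f x"
    using eventually_nhds_x_imp_x[OF assms(1)] by simp
  ultimately have "(f has_derivative g') (at x)"
    using g by (intro has_derivative_transform_eventually[of g g' x UNIV f]) auto
  then show ?thesis by (auto simp: differentiable_def)
qed

lemma has_vector_derivative_eventually_eq:
  assumes "\<forall>\<^sub>F t in nhds x. f t = g t"
  shows "(f has_vector_derivative d) (at x) \<longleftrightarrow> (g has_vector_derivative d) (at x)"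
  using assms eventually_nhds_x_imp_x[OF assms]
  by (intro has_vector_derivative_cong_ev) auto

definition dpsi :: "complex^'n::finite \<Rightarrow> complex^'n \<Rightarrow> complex^('n + bool)" where
  "dpsi z h = mk h 0 (- 2 * dot z h)"

lemma psi_has_derivative: "(psi has_derivative dpsi z) (at z)"
proof -
  have psi: "psi = (\<lambda>z. mk 0 1 0 + mk z 0 0 + dot z z *s mk 0 0 (- 1))"
    by (rule ext) (simp add: psi_def mk_linear Delta_eq_dot)
  have 1: "((\<lambda>z. mk z 0 0) has_derivative (\<lambda>h. mk h 0 0)) (at z)"
    by (rule bounded_linear_imp_has_derivative[OF bounded_linear_mk])
  have "((\<lambda>z. dot z z) has_derivative (\<lambda>h. dot z h + dot h z)) (at z)"
    by (rule bounded_bilinear.FDERIV[OF bounded_bilinear_dot has_derivative_ident has_derivative_ident])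
  then have 2: "((\<lambda>z. dot z z *s mk 0 0 (- 1)) has_derivative
      (\<lambda>h. dot z z *s 0 + (dot z h + dot h z) *s mk 0 0 (- 1))) (at z)"
    by (rule bounded_bilinear.FDERIV[OF bounded_bilinear_scale _ has_derivative_const])
  have 3: "dpsi z = (\<lambda>h. 0 + mk h 0 0 + (dot z z *s 0 + (dot z h + dot h z) *s mk 0 0 (- 1)))"
    by (rule ext) (simp add: dpsi_def mk_linear dot_commute)
  show ?thesis
    unfolding psi 3 by (rule has_derivative_add[OF has_derivative_add[OF has_derivative_const 1] 2])
qed

lemma psi_differentiable: "f differentiable at t \<Longrightarrow> (\<lambda>t. psi (f t)) differentiable at t"
  by (rule differentiable_compose[of psi]) (use psi_has_derivative in \<open>auto simp only: differentiable_def\<close>)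

section \<open>One-parameter subgroups from skew-symmetric matrices\<close>

definition mat_cnj :: "complex^'k^'k \<Rightarrow> complex^'k^'k" where
  "mat_cnj A = (\<chi> i j. cnj (A $ i $ j))"

lemma vec_cnj_matrix: "vec_cnj (A *v x) = mat_cnj A *v vec_cnj x"
  by (simp add: vec_cnj_def mat_cnj_def matrix_vector_mult_def vec_eq_iff)

lemma vec_cnj_vec_cnj: "vec_cnj (vec_cnj x) = x"
  by (simp add: vec_cnj_def vec_eq_iff)

lemma vec_cnj_linear: "vec_cnj (x + y) = vec_cnj x + vec_cnj y" "vec_cnj (c *s x) = cnj c *s vec_cnj x"
  by (simp_all add: vec_cnj_def vec_eq_iff)

lemma bounded_linear_vec_cnj: "bounded_linear vec_cnj"
  unfolding linear_conv_bounded_linear[symmetric]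
  by (rule linearI) (simp_all add: vec_cnj_linear scaleR_eq_scale)

lemma mat_cnj_eqI:
  assumes "\<And>x. vec_cnj (A *v x) = A *v vec_cnj x"
  shows "mat_cnj A = A"
  unfolding matrix_eq by (metis assms vec_cnj_matrix vec_cnj_vec_cnj)

lemma skew_iff_dot: "transpose A = - A \<longleftrightarrow> (\<forall>x y. dot (A *v x) y = - dot x (A *v y))"
proof -
  have neg: "(- A) *v x = - (A *v x)" for x
    by (simp add: matrix_vector_mult_def vec_eq_iff sum_negf)
  show ?thesis
  proof
    assume "transpose A = - A"
    then show "\<forall>x y. dot (A *v x) y = - dot x (A *v y)"
      by (simp add: dot_matrix_left neg dot_simps)
  next
    assume *: "\<forall>x y. dot (A *v x) y = - dot x (A *v y)"
    have "transpose A *v y = (- A) *v y" for y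
      unfolding neg
      by (rule dot_eqI) (metis * dot_commute dot_matrix_left dot_minus_right)
    then show "transpose A = - A"
      by (simp add: matrix_eq)
  qed
qed

text \<open>A weak notion: only orbits are differentiated, and only at time 0. A path of lifts may
  fail to be a homomorphism or continuous elsewhere, because its sign is not controlled away from
  time 0.\<close>

definition deriv_at_0 :: "(real \<Rightarrow> complex^'k^'k) \<Rightarrow> complex^'k^'k \<Rightarrow> bool" where
  "deriv_at_0 E A \<longleftrightarrow> E 0 = mat 1 \<and> (\<forall>x. ((\<lambda>t. E t *v x) has_vector_derivative A *v x) (at 0))"

lemma skew_exponential:
  fixes A :: "complex^'k^'k"
  assumes "transpose A = - A"
  obtains E where "\<And>t. orthogonal_matrix (E t)" "\<And>s t. E (s + t) = E s ** E t" "deriv_at_0 E A"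
    "\<And>t. mat_cnj A = A \<Longrightarrow> mat_cnj (E t) = E t"
proof
  define E where "E t = matrix (flow ((*v) A) t)" for t
  let ?F = "flow ((*v) A)"
  have add: "?F t (x + y) = ?F t x + ?F t y" for t x y
    by (rule linear_add[OF bounded_linear.linear[OF bounded_linear_flow]])
  have scale: "?F t (c *s x) = c *s ?F t x" for t c x
    by (rule flow_commutes[OF bounded_linear_matrix bounded_linear_scale]) (simp add: matrix_linear)
  have E: "E t *v x = ?F t x" for t x
    unfolding E_def by (rule isometry_matrix add scale)+
  note deriv = flow_has_vector_derivative[OF bounded_linear_matrix[of A]]
  show "orthogonal_matrix (E t)" for t
  proof (rule orthogonal_matrixI)
    fix x y
    \<comment> \<open>Skewness of A makes the two terms of the product rule cancel.\<close>
    have "((\<lambda>t. dot (?F t x) (?F t y)) has_vector_derivative 0) (at t)" for t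
      using bilinear_has_vector_derivative[OF bounded_bilinear_dot deriv[where x=x and t=t] deriv[where x=y and t=t]] assms
      by (simp add: skew_iff_dot)
    then obtain c where "\<And>t. dot (?F t x) (?F t y) = c"
      using has_vector_derivative_zero_constant[of UNIV "\<lambda>t. dot (?F t x) (?F t y)"] by auto
    then show "dot (E t *v x) (E t *v y) = dot x y"
      by (metis E flow_0)
  qed
  show "E (s + t) = E s ** E t" for s t
    by (simp add: matrix_eq E flow_add flip: matrix_vector_mul_assoc)
  show "deriv_at_0 E A"
    using deriv[where t=0] by (simp add: deriv_at_0_def E flow_0 matrix_eq)
  show "mat_cnj (E t) = E t" if "mat_cnj A = A" for t
  proof (rule mat_cnj_eqI)
    show "vec_cnj (E t *v x) = E t *v vec_cnj x" for x
      unfolding E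
      by (rule flow_commutes[OF bounded_linear_matrix bounded_linear_vec_cnj, symmetric])
         (simp add: vec_cnj_matrix that)
  qed
qed

text \<open>The derivative of the quotient of \<open>mid\<close> by \<open>hplus\<close> at a vector
  with \<open>hplus\<close> equal to 1; the second term comes from the denominator.\<close>

definition inf_field :: "complex^('n::finite + bool)^('n + bool) \<Rightarrow> complex^'n \<Rightarrow> complex^'n" where
  "inf_field A z = mid (A *v psi z) - hplus (A *v psi z) *s z"

lemma deriv_at_0_sel:
  assumes "deriv_at_0 E A"
  shows "((\<lambda>t. hplus (E t *v x)) has_vector_derivative hplus (A *v x)) (at 0)"
    "((\<lambda>t. mid (E t *v x)) has_vector_derivative mid (A *v x)) (at 0)"
  by (intro bounded_linear.has_vector_derivative[OF bounded_linear_hplus]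
      bounded_linear.has_vector_derivative[OF bounded_linear_mid];
      use assms in \<open>simp add: deriv_at_0_def\<close>)+

lemma deriv_at_0_hplus_nonzero:
  assumes "deriv_at_0 E A"
  shows "\<forall>\<^sub>F t in nhds 0. hplus (E t *v psi z) \<noteq> 0"
proof -
  define f where "f t = hplus (E t *v psi z)" for t
  have "isCont f 0"
    unfolding f_def by (rule has_vector_derivative_continuous[OF deriv_at_0_sel(1)[OF assms]])
  then have "(f \<longlongrightarrow> f 0) (nhds 0)"
    by (simp add: isCont_def tendsto_at_iff_tendsto_nhds)
  moreover have "f 0 \<noteq> 0"
    using assms by (simp add: deriv_at_0_def psi_sel f_def)
  ultimately show ?thesis
    unfolding f_def[symmetric] by (rule tendsto_imp_eventually_ne)
qed

lemma has_vector_derivative_inverse: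
  fixes f :: "real \<Rightarrow> complex"
  assumes "(f has_vector_derivative f') (at t)" "f t \<noteq> 0"
  shows "((\<lambda>t. inverse (f t)) has_vector_derivative - (f' / (f t)\<^sup>2)) (at t)"
  using Deriv.has_derivative_inverse[OF assms(2) assms(1)[unfolded has_vector_derivative_def]] assms(2)
  by (simp add: has_vector_derivative_def power2_eq_square field_simps scaleR_conv_of_real)

lemma conf_map_has_vector_derivative:
  assumes "deriv_at_0 E A"
  shows "((\<lambda>t. the (conf_map (E t) z)) has_vector_derivative inf_field A z) (at 0)"
proof -
  have E0: "E 0 = mat 1" using assms by (simp add: deriv_at_0_def)
  have "((\<lambda>t. inverse (hplus (E t *v psi z)) *s mid (E t *v psi z)) has_vector_derivative
     (inverse (hplus (E 0 *v psi z)) *s mid (A *v psi z) +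
      - (hplus (A *v psi z) / (hplus (E 0 *v psi z))\<^sup>2) *s mid (E 0 *v psi z))) (at 0)"
    by (intro bilinear_has_vector_derivative[OF bounded_bilinear_scale] has_vector_derivative_inverse
        deriv_at_0_sel assms) (simp add: E0 psi_sel)
  moreover have "\<forall>\<^sub>F t in nhds 0. the (conf_map (E t) z) =
      inverse (hplus (E t *v psi z)) *s mid (E t *v psi z)"
    using deriv_at_0_hplus_nonzero[OF assms, of z] by eventually_elim (simp add: conf_map_def)
  ultimately show ?thesis
    by (subst has_vector_derivative_eventually_eq) (simp_all add: E0 psi_sel inf_field_def)
qed

lemma one_parameter_subgroup_conf_map:
  assumes "deriv_at_0 E A" "\<And>t. orthogonal_matrix (E t)" "\<And>s t. E (s + t) = E s ** E t"
    "\<And>t. conf_map (E t) \<in> G"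
  shows "one_parameter_subgroup G (\<lambda>t. conf_map (E t)) (inf_field A)"
  unfolding one_parameter_subgroup_def
proof (intro conjI allI)
  fix z
  show "\<forall>\<^sub>F t in nhds 0. conf_map (E t) z \<noteq> None"
    using deriv_at_0_hplus_nonzero[OF assms(1), of z] by eventually_elim (simp add: conf_map_def)
qed (simp_all add: assms conf_map_comp conf_map_has_vector_derivative)

lemma inf_field_in_Lie_Conf:
  assumes "transpose A = - A"
  shows "inf_field A \<in> Lie Conf"
proof -
  obtain E where "\<And>t. orthogonal_matrix (E t)" "\<And>s t. E (s + t) = E s ** E t" "deriv_at_0 E A"
    using skew_exponential[OF assms] by metis
  then show ?thesis
    unfolding Lie_def using one_parameter_subgroup_conf_map[of E A Conf] conf_map_in_Conf by blast
qed

section \<open>Lifting one-parameter subgroups to paths of matrices\<close>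

lemma matrix_mult_sum: "(A :: complex^'k^'k) *v sum f S = (\<Sum>a\<in>S. A *v f a)"
  by (induction S rule: infinite_finite_induct) (simp_all add: matrix_linear)

lemma Delta_double: "Delta (2 * z) = 4 * Delta z"
  by (simp add: Delta_def power_mult_distrib sum_distrib_left)

lemma matrix_frame:
  fixes M :: "complex^('n::finite + bool)^('n + bool)" and k :: 'n
  shows "M *v x = (\<Sum>j\<in>UNIV. (mid x $ j / 2) *s (M *v psi (axis j 1) - M *v psi (- axis j 1)))
     + (hplus x *s (M *v psi 0) + hminus x *s (M *v psi 0 - (1/2) *s (M *v psi (axis k 1) + M *v psi (- axis k 1))))"
  by (subst psi_frame[of x k]) (simp only: matrix_linear matrix_mult_sum)

lemma conf_map_Delta:
  assumes A: "orthogonal_matrix A" and "conf_map A z = Some w" "conf_map A z' = Some w'"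
  shows "hplus (A *v psi z) * hplus (A *v psi z') * Delta (w - w') = Delta (z - z')"
proof -
  have "dot (A *v psi z) (A *v psi z') = - Delta (z - z') / 2"
    by (simp add: dot_orthogonal[OF A] dot_psi)
  moreover have "A *v psi z = hplus (A *v psi z) *s psi w" "A *v psi z' = hplus (A *v psi z') *s psi w'"
    using assms by (simp_all add: conf_map_eq_Some_iff[OF A])
  then have "dot (A *v psi z) (A *v psi z') = hplus (A *v psi z) * (hplus (A *v psi z') * (- Delta (w - w') / 2))"
    by (metis dot_scale_left dot_scale_right dot_psi)
  ultimately show ?thesis by (simp add: mult.assoc)
qed

text \<open>The product of the first two equations, compared with the third, isolates the square of
  a. The right-hand sides 1, 1, 4 are the values of Delta on the differences of 0, e and -e.\<close>

lemma three_point_square: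
  fixes a b c x y z :: complex
  assumes "a * b * x = 1" "a * c * y = 1" "b * c * z = 4"
  shows "a\<^sup>2 = z / (4 * x * y)"
proof -
  have nz: "b * c \<noteq> 0" "x \<noteq> 0" "y \<noteq> 0" using assms by auto
  have "(b * c) * (4 * x * y * a\<^sup>2) = 4 * (a * b * x) * (a * c * y)"
    by (simp add: power2_eq_square)
  also have "\<dots> = (b * c) * z"
    using assms by simp
  finally show ?thesis using nz by (simp add: field_simps)
qed

text \<open>An idempotent of a group is the identity; here the cancelling element is the map of the
  transpose.\<close>

lemma one_parameter_subgroup_0:
  assumes "one_parameter_subgroup Conf g X"
  shows "g 0 = Some"
proof -
  have comp: "g 0 = g 0 \<circ>\<^sub>r g 0" and "g 0 \<in> Conf"
    using assms unfolding one_parameter_subgroup_def by (metis add.right_neutral, blast)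
  then obtain A where A: "orthogonal_matrix A" "g 0 = conf_map A"
    using Conf_imp_conf_map by blast
  have inv: "transpose A ** A = mat 1"
    using A by (simp add: orthogonal_matrix_def)
  have "g 0 = conf_map (transpose A ** (A ** A))"
    by (simp add: matrix_mul_assoc inv A)
  also have "\<dots> = conf_map (transpose A) \<circ>\<^sub>r g 0"
    using A comp by (simp add: orthogonal_matrix_mult flip: conf_map_comp)
  also have "\<dots> = Some"
    using A by (simp add: conf_map_comp inv conf_map_id)
  finally show ?thesis .
qed

text \<open>The denominator \<open>J\<close> of \<open>g t\<close> satisfies \<open>J z * J z' * Delta (g t z - g t z') = Delta (z - z')\<close>.
  Three points determine \<open>(J 0)\<^sup>2\<close>, so after fixing the sign of the matrix its action on the frame
  \<open>psi 0\<close>, \<open>psi (\<plusminus> e\<^sub>j)\<close> inherits differentiability at \<open>t = 0\<close> from the orbits.\<close>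

lemma one_parameter_subgroup_lift:
  fixes X :: "complex^'n::finite \<Rightarrow> complex^'n"
  assumes g: "one_parameter_subgroup Conf g X"
  obtains B A where "\<And>t. orthogonal_matrix (B t)" "\<And>t. g t = conf_map (B t)"
    "deriv_at_0 B A" "transpose A = - A" "X = inf_field A"
proof -
  have "\<exists>A. orthogonal_matrix A \<and> g t = conf_map A" for t
    using g Conf_imp_conf_map by (auto simp: one_parameter_subgroup_def)
  then obtain B' where B': "\<And>t. orthogonal_matrix (B' t)" "\<And>t. g t = conf_map (B' t)"
    by metis
  define w where "w t z = the (g t z)" for t z
  have ev: "\<forall>\<^sub>F t in nhds 0. g t z = Some (w t z)" for z
  proof -
    have "\<forall>\<^sub>F t in nhds 0. g t z \<noteq> None"
      using g by (simp add: one_parameter_subgroup_def)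
    then show ?thesis by eventually_elim (auto simp: w_def)
  qed
  have w_deriv: "((\<lambda>t. w t z) has_vector_derivative X z) (at 0)" for z
    using g by (simp add: one_parameter_subgroup_def w_def)
  then have w_diff: "(\<lambda>t. w t z) differentiable (at 0)" for z
    by (auto simp: has_vector_derivative_def differentiable_def)
  have w0: "w 0 z = z" for z
    by (simp add: w_def one_parameter_subgroup_0[OF g])
  have Delta_diff: "(\<lambda>t. Delta (w t z - w t z')) differentiable (at 0)" for z z'
    unfolding Delta_eq_dot
    by (intro bilinear_differentiable[OF bounded_bilinear_dot] differentiable_diff w_diff)

  fix k :: 'n
  define e where "e = (axis k 1 :: complex^'n)"
  \<comment> \<open>The squared denominator at the origin, by the three-point formula. At t = 0 it
    equals 4 / 4 = 1, away from the branch cut of \<open>csqrt\<close>.\<close>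
  define S where "S t = Delta (w t e - w t (- e)) / (4 * Delta (w t 0 - w t e) * Delta (w t 0 - w t (- e)))" for t
  have De: "Delta e = 1" "Delta (- e) = 1" "Delta (2 * e) = 4"
    by (simp_all add: Delta_double e_def Delta_minus Delta_axis)
  have S0: "S 0 = 1"
    by (simp add: S_def w0 De)
  have "S differentiable (at 0)"
    unfolding S_def by (intro differentiable_divide differentiable_mult Delta_diff differentiable_const)
      (simp add: w0 De)
  moreover have "csqrt differentiable (at (S 0))"
    by (simp add: S0 field_differentiable_imp_differentiable field_differentiable_at_csqrt)
  ultimately have csqrt_diff: "(\<lambda>t. csqrt (S t)) differentiable (at 0)"
    by (intro differentiable_compose[of csqrt S])
  have J'2: "\<forall>\<^sub>F t in nhds 0. (hplus (B' t *v psi 0))\<^sup>2 = S t"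
    using ev[of 0] ev[of e] ev[of "- e"]
  proof eventually_elim
    case (elim t)
    let ?J = "\<lambda>z. hplus (B' t *v psi z)"
    have "?J 0 * ?J e * Delta (w t 0 - w t e) = 1"
      "?J 0 * ?J (- e) * Delta (w t 0 - w t (- e)) = 1"
      "?J e * ?J (- e) * Delta (w t e - w t (- e)) = 4"
      using elim conf_map_Delta[OF B'(1)[of t]] De by (simp_all add: B'(2))
    then show ?case
      unfolding S_def by (rule three_point_square)
  qed

  \<comment> \<open>Both signs induce \<open>g t\<close>; near t = 0 the choice makes the
    denominator at the origin the branch of the square root with value 1 at t = 0.\<close>
  define B where "B t = (if hplus (B' t *v psi 0) = csqrt (S t) then B' t else - B' t)" for t
  have neg: "(- M) *v x = - (M *v x)" for M :: "complex^('n + bool)^('n + bool)" and x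
    by (simp add: matrix_vector_mult_def vec_eq_iff sum_negf)
  have orth: "orthogonal_matrix (B t)" for t
    by (rule orthogonal_matrixI) (simp add: B_def neg dot_simps dot_orthogonal B'(1))
  have gB: "g t = conf_map (B t)" for t
    by (simp add: B_def B'(2) conf_map_uminus)
  let ?J = "\<lambda>t z. hplus (B t *v psi z)"
  have J0: "\<forall>\<^sub>F t in nhds 0. ?J t 0 = csqrt (S t)"
    using J'2
  proof eventually_elim
    case (elim t)
    then have "(hplus (B' t *v psi 0))\<^sup>2 = (csqrt (S t))\<^sup>2" by simp
    then have "hplus (B' t *v psi 0) = csqrt (S t) \<or> hplus (B' t *v psi 0) = - csqrt (S t)"
      by (simp only: power2_eq_iff)
    then show ?case
      by (auto simp: B_def neg sel_linear)
  qed
  have J0_diff: "(\<lambda>t. ?J t 0) differentiable (at 0)"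
    by (rule differentiable_eventually_eq[OF J0 csqrt_diff])
  have J00: "?J 0 0 = 1"
    using eventually_nhds_x_imp_x[OF J0] by (simp add: S0)
  \<comment> \<open>The same relation yields the other denominators from the one at the origin.
    Apart from 0, the points of the frame all have Delta z = 1.\<close>
  have Jz: "\<forall>\<^sub>F t in nhds 0. ?J t z = 1 / (?J t 0 * Delta (w t z - w t 0))" if "Delta z = 1" for z
    using ev[of 0] ev[of z]
  proof eventually_elim
    case (elim t)
    then have "?J t z * ?J t 0 * Delta (w t z - w t 0) = 1"
      using conf_map_Delta[OF orth[of t], of z "w t z" 0 "w t 0"] that by (simp add: gB)
    then show ?case by (subst nonzero_eq_divide_eq) (auto simp: ac_simps)
  qed
  have J_diff: "(\<lambda>t. ?J t z) differentiable (at 0)" and Jz0: "?J 0 z = 1" if "Delta z = 1" for z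
  proof -
    show "(\<lambda>t. ?J t z) differentiable (at 0)"
      by (rule differentiable_eventually_eq[OF Jz[OF that]])
         (intro differentiable_divide differentiable_mult Delta_diff J0_diff differentiable_const;
          simp add: J00 w0 that)
    show "?J 0 z = 1"
      using eventually_nhds_x_imp_x[OF Jz[OF that]] by (simp add: J00 w0 that)
  qed
  have Bpsi: "\<forall>\<^sub>F t in nhds 0. B t *v psi z = ?J t z *s psi (w t z)" for z
    using ev[of z] by eventually_elim (simp add: gB flip: conf_map_eq_Some_iff[OF orth])
  have B_psi_diff: "(\<lambda>t. B t *v psi z) differentiable (at 0)" if "z = 0 \<or> Delta z = 1" for z
    by (rule differentiable_eventually_eq[OF Bpsi])
       (use that J0_diff J_diff in \<open>auto intro!: bilinear_differentiable[OF bounded_bilinear_scale] psi_differentiable w_diff\<close>)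
  have B0: "B 0 *v psi z = psi z" if "z = 0 \<or> Delta z = 1" for z
    using eventually_nhds_x_imp_x[OF Bpsi[of z]] that J00 Jz0[of z] by (auto simp: w0)
  have B_diff: "(\<lambda>t. B t *v x) differentiable (at 0)" for x
    by (subst matrix_frame[where k = k])
       (intro differentiable_add differentiable_sum ballI bounded_linear_differentiable[OF bounded_linear_scale]
          differentiable_diff B_psi_diff finite; simp add: Delta_axis Delta_minus)
  have B0_id: "B 0 = mat 1"
    unfolding matrix_eq
    by (subst matrix_frame[where k = k], subst matrix_frame[where k = k and M = "mat 1"])
       (simp add: B0 Delta_axis Delta_minus)
  define a where "a x = vector_derivative (\<lambda>t. B t *v x) (at 0)" for x
  have a: "((\<lambda>t. B t *v x) has_vector_derivative a x) (at 0)" for x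
    unfolding a_def using B_diff by (simp add: vector_derivative_works)
  have a_add: "a (x + y) = a x + a y" for x y
    using has_vector_derivative_add[OF a[of x] a[of y]] a[of "x + y"]
    by (simp add: matrix_linear vector_derivative_unique_at)
  have a_scale: "a (c *s x) = c *s a x" for c x
    using bounded_linear.has_vector_derivative[OF bounded_linear_scale a[of x], of c] a[of "c *s x"]
    by (simp add: matrix_linear vector_derivative_unique_at)
  define A where "A = matrix a"
  have A: "A *v x = a x" for x
    unfolding A_def by (rule isometry_matrix a_add a_scale)+
  have deriv: "deriv_at_0 B A"
    by (simp add: deriv_at_0_def B0_id A a)
  have skew: "transpose A = - A"
    unfolding skew_iff_dot
  proof (intro allI)
    fix x y
    have "((\<lambda>t. dot (B t *v x) (B t *v y)) has_vector_derivative (dot x (a y) + dot (a x) y)) (at 0)"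
      using bilinear_has_vector_derivative[OF bounded_bilinear_dot a[of x] a[of y]] by (simp add: B0_id)
    moreover have "((\<lambda>t. dot (B t *v x) (B t *v y)) has_vector_derivative 0) (at 0)"
      by (simp add: dot_orthogonal[OF orth])
    ultimately have "dot x (a y) + dot (a x) y = 0"
      by (rule vector_derivative_unique_at)
    then show "dot (A *v x) y = - dot x (A *v y)"
      by (simp add: A eq_neg_iff_add_eq_0 add.commute)
  qed
  have "X z = inf_field A z" for z
    using conf_map_has_vector_derivative[OF deriv, of z] w_deriv[of z]
    by (simp add: w_def gB vector_derivative_unique_at)
  then show thesis
    using that[of B A] orth gB deriv skew by blast
qed

lemma lie_k_eq: "lie_k = inf_field ` {A. transpose A = - A}"
  unfolding lie_k_def
  using inf_field_in_Lie_Conf by (auto simp: Lie_def elim!: one_parameter_subgroup_lift)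

text \<open>If the field vanishes, every \<open>psi z\<close> is an eigenvector of \<open>A\<close>; by skewness the eigenvalues of
  two points at non-zero distance are opposite, so the three eigenvalues on a frame vanish.\<close>

lemma inf_field_eq_0:
  fixes A :: "complex^('n::finite + bool)^('n + bool)"
  assumes skew: "transpose A = - A" and "inf_field A = (\<lambda>z. 0)"
  shows "A = 0"
proof -
  let ?h = "\<lambda>z. hplus (A *v psi z)"
  have sk: "dot (A *v x) y = - dot x (A *v y)" for x y
    using skew by (simp add: skew_iff_dot)
  have A: "A *v psi z = ?h z *s psi z" for z
  proof -
    have "dot (psi z) (A *v psi z) = 0"
      using sk[of "psi z" "psi z"] by (simp add: dot_commute)
    moreover have "mid (A *v psi z) = ?h z *s z"
      using fun_cong[OF assms(2), of z] by (simp add: inf_field_def)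
    ultimately have "hminus (A *v psi z) = - ?h z * Delta z"
      by (simp add: dot_ext psi_sel dot_simps Delta_eq_dot field_simps)
         (metis add.commute eq_neg_iff_add_eq_0 mult_2)
    with \<open>mid (A *v psi z) = ?h z *s z\<close> show ?thesis
      by (intro mk_eqI) (simp_all add: sel_linear psi_sel)
  qed
  have opp: "?h z' = - ?h z" if "Delta (z - z') \<noteq> 0" for z z'
  proof -
    have "?h z * dot (psi z) (psi z') = - (?h z' * dot (psi z) (psi z'))"
      using sk[of "psi z" "psi z'"] A dot_scale_left dot_scale_right by metis
    then have "?h z * Delta (z - z') = (- ?h z') * Delta (z - z')"
      by (simp add: dot_psi) (metis minus_equation_iff)
    with that show ?thesis by (metis mult_right_cancel neg_equal_iff_equal minus_minus)
  qed
  have zero: "?h 0 = 0" "?h (axis j 1) = 0" "?h (- axis j 1) = 0" for j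
  proof -
    have "?h (axis j 1) = - ?h 0" "?h (- axis j 1) = - ?h 0" "?h (- axis j 1) = - ?h (axis j 1)"
      by (rule opp; simp add: Delta_minus Delta_axis Delta_double)+
    then show "?h 0 = 0" "?h (axis j 1) = 0" "?h (- axis j 1) = 0" by auto
  qed
  have "A *v psi 0 = 0" "A *v psi (axis j 1) = 0" "A *v psi (- axis j 1) = 0" for j
    using A[of 0] A[of "axis j 1"] A[of "- axis j 1"] unfolding zero by simp_all
  then have "A *v x = 0 *v x" for x
    by (subst matrix_frame[where k = undefined]) simp
  then show ?thesis by (simp add: matrix_eq)
qed

section \<open>Quadratic forms on the null cone\<close>

definition quad :: "complex^('n::finite + bool)^('n + bool) \<Rightarrow> complex^'n \<Rightarrow> complex" where
  "quad S z = dot (psi z) (S *v psi z)"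

definition outer :: "complex^'k \<Rightarrow> complex^'k \<Rightarrow> complex^'k^'k" where
  "outer x y = (\<chi> i j. x $ i * y $ j)"

lemma matrix_mult_left_linear:
  fixes S T :: "complex^'k^'k"
  shows "(S + T) *v x = S *v x + T *v x" "(S - T) *v x = S *v x - T *v x" "(- S) *v x = - (S *v x)"
    "matrix_scale c S *v x = c *s (S *v x)" "0 *v x = (0 :: complex^'k)"
  by (simp_all add: matrix_vector_mult_def matrix_scale_def vec_eq_iff algebra_simps sum.distrib
      sum_subtractf sum_negf sum_distrib_left)

lemma outer_apply: "outer x y *v w = dot y w *s x"
  by (simp add: outer_def dot_def matrix_vector_mult_def vec_eq_iff sum_distrib_left sum_distrib_right mult_ac)

lemma quad_linear: "quad (S + T) z = quad S z + quad T z" "quad (S - T) z = quad S z - quad T z"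
    "quad (matrix_scale c S) z = c * quad S z" "quad 0 z = 0" "quad (- S) z = - quad S z"
  by (simp_all add: quad_def matrix_mult_left_linear dot_simps)

lemma quad_transpose: "quad (transpose S) z = quad S z"
  unfolding quad_def by (metis dot_commute dot_matrix_left)

text \<open>Scalar matrices are invisible on the cone; this is why representatives are taken
  traceless.\<close>

lemma quad_id: "quad (mat 1) z = 0"
  by (simp add: quad_def psi_isotropic)

lemma quad_outer: "quad (outer x y) z = dot x (psi z) * dot y (psi z)"
  by (simp add: quad_def outer_apply dot_simps dot_commute[of "psi z" x])

lemma polynomial_fun_quad: "polynomial_fun (quad S)"
  unfolding quad_def[abs_def] dot_def
  using polynomial_fun_matrix_psi[of "mat 1"]
  by (auto intro!: polynomial_intros polynomial_fun_matrix_psi)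

lemma two_plus_of_nat: "(2 + of_nat n :: complex) \<noteq> 0"
  by (metis add_is_0 of_nat_add of_nat_eq_0_iff of_nat_numeral zero_neq_numeral)

lemma quartic_eq_0:
  fixes a b c d e :: complex
  assumes "\<And>t. a + t * b + t\<^sup>2 * c + t ^ 3 * d + t ^ 4 * e = 0"
  shows "a = 0" "b = 0" "c = 0" "d = 0" "e = 0"
  using assms[of 0] assms[of 1] assms[of "- 1"] assms[of 2] assms[of "- 2"]
  by (simp_all, algebra+)

text \<open>A form vanishing on the quadric is a multiple of the defining form, and the trace
  condition kills the multiple. Along t z the function \<open>quad S\<close> is a quartic in t,
  whose coefficients give the entries of S in null coordinates.\<close>

lemma quad_eq_0:
  fixes S :: "complex^('n::finite + bool)^('n + bool)"
  assumes sym: "transpose S = S" and tr: "trace S = 0" and zero: "\<And>z. quad S z = 0"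
  shows "S = 0"
proof -
  define s where "s x y = dot x (S *v y)" for x y
  have s_sym: "s x y = s y x" for x y
    unfolding s_def by (metis dot_commute dot_matrix_left sym)
  have s_lin: "s (x + x') y = s x y + s x' y" "s (c *s x) y = c * s x y"
    "s x (y + y') = s x y + s x y'" "s x (c *s y) = c * s x y"
    "s (x - x') y = s x y - s x' y" "s x (y - y') = s x y - s x y'" for x x' y y' c
    by (simp_all add: s_def dot_simps matrix_linear)
  have s_sum: "s (sum f I) y = (\<Sum>i\<in>I. s (f i) y)" for f :: "'n \<Rightarrow> _" and I y
    by (simp add: s_def dot_sum_left)
  define u v :: "complex^('n + bool)" where "u = mk 0 2 0" and "v = mk 0 0 2"
  let ?b = "\<lambda>z. mk z 0 0"
  have decomp: "mk y p q = ?b y + ((p / 2) *s u + (q / 2) *s v)" for y p q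
    by (simp add: u_def v_def mk_linear)
  have coeffs: "s u u = 0" "s u (?b z) = 0" "s (?b z) (?b z) = Delta z * (s u v / 2)"
    "Delta z * s (?b z) v = 0" "Delta z * (Delta z * s v v) = 0" for z
  proof -
    have "s u u / 4 + t * s u (?b z) + t\<^sup>2 * (s (?b z) (?b z) - Delta z * s u v / 2)
       + t ^ 3 * (- (Delta z * s (?b z) v)) + t ^ 4 * (Delta z * (Delta z * s v v) / 4) = 0" for t
    proof -
      have b: "?b (t *s z) = t *s ?b z" by (simp add: mk_linear)
      have "psi (t *s z) = mk (t *s z) 1 (- (t\<^sup>2 * Delta z))"
        by (simp add: psi_def Delta_scale)
      also have "\<dots> = t *s ?b z + ((1 / 2) *s u + (- (t\<^sup>2 * Delta z) / 2) *s v)"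
        by (subst decomp) (simp only: b)
      finally have "psi (t *s z) = t *s ?b z + ((1 / 2) *s u + (- (t\<^sup>2 * Delta z) / 2) *s v)" .
      moreover have "s (psi (t *s z)) (psi (t *s z)) = 0"
        using zero[of "t *s z"] by (simp add: quad_def s_def)
      moreover have "s (t *s ?b z + ((1 / 2) *s u + k *s v)) (t *s ?b z + ((1 / 2) *s u + k *s v)) =
          s u u / 4 + t * s u (?b z) + t\<^sup>2 * s (?b z) (?b z) + k * s u v + 2 * t * k * s (?b z) v + k\<^sup>2 * s v v" for k
        by (simp add: s_lin s_sym[of "?b z" u] s_sym[of v u] s_sym[of v "?b z"])
          (simp add: field_simps power2_eq_square)
      ultimately have "s u u / 4 + t * s u (?b z) + t\<^sup>2 * s (?b z) (?b z) + (- (t\<^sup>2 * Delta z) / 2) * s u v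
          + 2 * t * (- (t\<^sup>2 * Delta z) / 2) * s (?b z) v + (- (t\<^sup>2 * Delta z) / 2)\<^sup>2 * s v v = 0"
        by metis
      then show ?thesis
        by (simp add: field_simps power2_eq_square power3_eq_cube power4_eq_xxxx)
    qed
    note quartic_eq_0[OF this]
    then show "s u u = 0" "s u (?b z) = 0" "s (?b z) (?b z) = Delta z * (s u v / 2)"
      "Delta z * s (?b z) v = 0" "Delta z * (Delta z * s v v) = 0"
      by simp_all
  qed
  \<comment> \<open>The known coefficient carries a factor Delta z, so it is used at the axis
    vectors, where Delta is 1, and extended linearly.\<close>
  have bv: "s (?b y) v = 0" for y
  proof -
    have "?b y = (\<Sum>j\<in>UNIV. y $ j *s ?b (axis j 1))"
      by (rule mk_eqI) (simp_all add: mid_sum hplus_sum hminus_sum sel_linear mk_sel flip: vec_axis_sum)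
    moreover have "s (?b (axis j 1)) v = 0" for j
      using coeffs(4)[of "axis j 1"] by (simp add: Delta_axis)
    ultimately show ?thesis by (simp add: s_sum s_lin)
  qed
  have vv: "s v v = 0"
    using coeffs(5)[of "axis undefined 1"] by (simp add: Delta_axis)
  define c where "c = s u v / 2"
  have diag: "s x x = c * dot x x" for x
  proof -
    have x: "x = ?b (mid x) + ((hplus x / 2) *s u + (hminus x / 2) *s v)"
      by (metis decomp mk_collapse)
    have "s x x = c * (Delta (mid x) + hplus x * hminus x)"
      by (subst x, subst (2) x)
        (simp add: s_lin s_sym[of "?b _" u] s_sym[of v u] s_sym[of v "?b _"] coeffs bv vv c_def algebra_simps)
    then show ?thesis
      by (simp add: dot_ext Delta_eq_dot)
  qed
  have "s x y = c * dot x y" for x y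
    using diag[of "x + y"] diag[of x] diag[of y]
    by (simp add: s_lin s_sym[of y x] dot_simps dot_commute[of y x] algebra_simps)
  then have S: "S *v y = c *s y" for y
    by (intro dot_eqI[of "S *v y"]) (simp add: s_def dot_simps dot_commute[of "S *v y"] dot_commute[of y])
  have "S $ i $ i = c" for i
    using arg_cong[OF S[of "axis i 1"], of "\<lambda>x. x $ i"]
    by (simp add: axis_def matrix_vector_mult_def if_distrib[where f="\<lambda>a. _ * a"] cong: if_cong)
  then have "c = 0"
    using tr two_plus_of_nat by (simp add: trace_def)
  then have "S *v y = 0 *v y" for y
    by (simp add: S matrix_mult_left_linear)
  then show ?thesis by (simp add: matrix_eq)
qed

section \<open>The space of translates of \<open>Q\<close>\<close>

interpretation fs: vector_space "\<lambda>c f (z :: complex^'n). c * f z :: complex"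
  by unfold_locales (simp_all add: fun_eq_iff algebra_simps)

text \<open>The derivative of \<open>translation_mat\<close> along t d at t = 0, that is, the
  infinitesimal translation by d. Its cube is zero.\<close>

definition shift_mat :: "complex^'n::finite \<Rightarrow> complex^('n + bool)^('n + bool)" where
  "shift_mat d = matrix (\<lambda>x. mk (hplus x *s d) 0 (- 2 * dot d (mid x)))"

lemma shift_mat_apply: "shift_mat d *v x = mk (hplus x *s d) 0 (- 2 * dot d (mid x))"
  unfolding shift_mat_def
  by (rule isometry_matrix) (simp_all add: mk_linear sel_linear dot_simps vec_eq_iff algebra_simps)

lemma shift_mat_skew: "transpose (shift_mat d) = - shift_mat d"
  by (auto simp: skew_iff_dot shift_mat_apply dot_ext mk_sel dot_simps dot_commute)

lemma quad_bracket:
  assumes "transpose A = - A"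
  shows "quad (matrix_bracket A S) z = - dot (A *v psi z) (S *v psi z) - dot (psi z) (S *v (A *v psi z))"
proof -
  have "dot (psi z) (A *v (S *v psi z)) = - dot (A *v psi z) (S *v psi z)"
    using assms by (simp add: skew_iff_dot)
  then show ?thesis
    by (simp add: quad_def matrix_bracket_def matrix_mult_left_linear dot_simps flip: matrix_vector_mul_assoc)
qed

text \<open>Skewness turns right multiplication by A into the action of A on y, so the bracket is a
  derivation on products of linear forms.\<close>

lemma quad_bracket_outer:
  assumes "transpose A = - A"
  shows "quad (matrix_bracket A (outer x y)) z = quad (outer (A *v x) y) z + quad (outer x (A *v y)) z"
proof -
  have sk: "dot w (A *v psi z) = - dot (A *v w) (psi z)" for w
    using assms by (simp add: skew_iff_dot)
  show ?thesis
    by (simp add: quad_bracket[OF assms] quad_outer outer_apply dot_simps sk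
        dot_commute[of "A *v psi z" x] dot_commute[of "psi z" x] algebra_simps)
qed

lemma sum_fun_apply: "(\<Sum>i\<in>I. f i) z = (\<Sum>i\<in>I. f i z)"
  for f :: "'i \<Rightarrow> 'b \<Rightarrow> complex"
  by (induction I rule: infinite_finite_induct) auto

text \<open>The relation \<open>\<Sum>\<^sub>i (x\<^sub>i)\<^sup>2 + uv = 0\<close> on the cone separates the two summands of the second
  derivatives of \<open>Q = u\<^sup>2\<close>.\<close>

lemma quad_generation:
  fixes W :: "(complex^'n::finite \<Rightarrow> complex) set"
  assumes W: "fs.subspace W" and Q: "quad (outer (mk 0 2 0) (mk 0 2 0)) \<in> W"
    and closed: "\<And>S d. quad S \<in> W \<Longrightarrow> quad (matrix_bracket (shift_mat d) S) \<in> W"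
  shows "quad S \<in> W"
proof -
  define pr :: "complex^('n + bool) \<Rightarrow> complex^('n + bool) \<Rightarrow> complex^'n \<Rightarrow> complex"
    where "pr x y = quad (outer x y)" for x y
  have pr_apply: "pr x y z = dot x (psi z) * dot y (psi z)" for x y z
    by (simp add: pr_def quad_outer)
  \<comment> \<open>As linear forms on the cone, u is -Delta and v is the constant 1; the remaining
    coordinates are the linear functions on V.\<close>
  define u v :: "complex^('n + bool)" where "u = mk 0 2 0" and "v = mk 0 0 2"
  let ?e = "\<lambda>j :: 'n. mk (axis j 1) 0 0"
  have add: "(\<lambda>z. f z + g z) \<in> W" if "f \<in> W" "g \<in> W" for f g
    using fs.subspace_add[OF W that] by (simp add: plus_fun_def)
  have scale: "(\<lambda>z. c * f z) \<in> W" if "f \<in> W" for c f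
    using fs.subspace_scale[OF W that] .
  have unscale: "f \<in> W" if "(\<lambda>z. c * f z) \<in> W" "c \<noteq> 0" for c f
    using scale[OF that(1), of "inverse c"] that(2) by (simp flip: mult.assoc)
  have sum: "(\<lambda>z. \<Sum>i\<in>I. f i z) \<in> W" if "\<And>i. i \<in> I \<Longrightarrow> f i \<in> W" for I :: "'i set" and f
  proof -
    have "(\<Sum>i\<in>I. f i) \<in> W" using that by (rule fs.subspace_sum[OF W])
    moreover have "(\<Sum>i\<in>I. f i) = (\<lambda>z. \<Sum>i\<in>I. f i z)"
      by (rule ext) (rule sum_fun_apply)
    ultimately show ?thesis by simp
  qed
  have deriv_mem: "(\<lambda>z. pr (shift_mat d *v x) y z + pr x (shift_mat d *v y) z) \<in> W" if "pr x y \<in> W" for d x y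
    using closed[of "outer x y" d] that
    by (simp add: pr_def quad_bracket_outer[OF shift_mat_skew, abs_def])
  \<comment> \<open>An infinitesimal translation lowers u to the coordinates, these to v, and v to
    0.\<close>
  have shift: "shift_mat d *v u = 2 *s mk d 0 0" "shift_mat d *v v = 0"
    "shift_mat d *v mk d' 0 0 = (- dot d d') *s v" for d d'
    by (simp_all add: shift_mat_apply u_def v_def mk_sel mk_linear dot_simps mult.commute)
       (simp_all add: mk_def vec_eq_iff split: sum.splits)
  have uu: "pr u u \<in> W"
    using Q by (simp add: pr_def u_def)
  have eu: "pr (?e i) u \<in> W" for i
    using deriv_mem[OF uu, of "axis i 1"]
    by - (rule unscale[of 4], simp_all add: shift pr_apply[abs_def] dot_simps algebra_simps)
  have ee': "(\<lambda>z. 2 * pr (?e i) (?e j) z - dot (axis j 1) (axis i 1) * pr u v z) \<in> W" for i j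
    using deriv_mem[OF eu, of "axis j 1" i]
    by (simp add: shift pr_apply[abs_def] dot_simps algebra_simps)
  have rel: "(\<Sum>i\<in>UNIV. pr (?e i) (?e i) z) = - pr u v z" for z
    by (simp add: pr_apply u_def v_def dot_ext[of _ "psi z"] mk_sel psi_sel dot_simps dot_axis_left
        Delta_def power2_eq_square)
  \<comment> \<open>Summing the diagonal relations and inserting the equation of the cone leaves -(n
    + 2) times the product of u and v. The coefficient is nonzero, which separates this product from
    the products of coordinates.\<close>
  have "(\<lambda>z. \<Sum>i\<in>(UNIV :: 'n set). 2 * pr (?e i) (?e i) z - pr u v z) \<in> W"
    using ee'[of i i for i] by (intro sum) (simp add: Delta_axis[unfolded Delta_eq_dot])
  also have "(\<lambda>z. \<Sum>i\<in>(UNIV :: 'n set). 2 * pr (?e i) (?e i) z - pr u v z)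
      = (\<lambda>z. - (2 + of_nat CARD('n)) * pr u v z)"
    by (rule ext) (simp add: sum_subtractf rel algebra_simps flip: sum_distrib_left)
  finally have uv: "pr u v \<in> W"
    by (rule unscale) (simp only: neg_equal_0_iff_equal two_plus_of_nat not_False_eq_True)
  have ee: "pr (?e i) (?e j) \<in> W" for i j
    using add[OF ee'[of i j] scale[OF uv, of "dot (axis j 1) (axis i 1)"]] by - (rule unscale[of 2], simp_all)
  have ev: "pr (?e i) v \<in> W" for i
    using deriv_mem[OF uv, of "axis i 1"]
    by - (rule unscale[of 2], simp_all add: shift pr_apply[abs_def] dot_simps algebra_simps)
  have vv: "pr v v \<in> W"
    using deriv_mem[OF ev, of "axis i 1" i for i]
    by - (rule unscale[of "-1"], simp_all add: shift pr_apply[abs_def] dot_simps Delta_axis[unfolded Delta_eq_dot])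
  have pr_sym: "pr x y = pr y x" for x y
    by (rule ext) (simp add: pr_apply)
  have expand: "pr x y z = (\<Sum>j\<in>UNIV. mid x $ j * pr (?e j) y z)
      + (hplus x / 2 * pr u y z + hminus x / 2 * pr v y z)" for x y z
  proof -
    have "dot x (psi z) = (\<Sum>j\<in>UNIV. mid x $ j * dot (?e j) (psi z)) + (hplus x / 2 * dot u (psi z) + hminus x / 2 * dot v (psi z))"
      by (simp add: dot_ext[of _ "psi z"] u_def v_def mk_sel psi_sel dot_simps dot_axis_left)
        (simp add: dot_def field_simps)
    then show ?thesis
      by (simp add: pr_apply distrib_right sum_distrib_right mult.assoc)
  qed
  have step: "pr x y \<in> W" if "\<And>j. pr (?e j) y \<in> W" "pr u y \<in> W" "pr v y \<in> W" for x y
  proof -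
    have "pr x y = (\<lambda>z. (\<Sum>j\<in>UNIV. mid x $ j * pr (?e j) y z) + (hplus x / 2 * pr u y z + hminus x / 2 * pr v y z))"
      by (rule ext) (rule expand)
    also have "\<dots> \<in> W"
      by (intro add sum scale that)
    finally show ?thesis .
  qed
  have ue: "pr u (?e j) \<in> W" "pr v (?e j) \<in> W" "pr v u \<in> W" for j
    using eu ev uv by (simp_all only: pr_sym[of u "?e j"] pr_sym[of v "?e j"] pr_sym[of v u])
  have "pr x (?e j) \<in> W" "pr x u \<in> W" "pr x v \<in> W" for x j
    by (rule step; rule ee ue eu ev uv uu vv)+
  then have all: "pr x y \<in> W" for x y
    using step[of y x] pr_sym by metis
  have "quad S = (\<lambda>z. \<Sum>i\<in>UNIV. \<Sum>j\<in>UNIV. S $ i $ j * pr (axis i 1) (axis j 1) z)"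
    by (rule ext)
       (simp only: quad_def pr_apply dot_axis_left dot_def[of "psi _" "_ *v _"], simp add: matrix_vector_mult_def sum_distrib_left mult_ac)
  also have "\<dots> \<in> W"
    by (intro sum scale all)
  finally show ?thesis .
qed

text \<open>The factor 4 compensates the square of the -1/2 in the form of two cone points.\<close>

lemma Q_eq_quad: "Q (z - a) = quad (matrix_scale 4 (outer (psi a) (psi a))) z"
  by (simp add: Q_def quad_linear quad_outer dot_psi power2_eq_square)
     (metis Delta_minus minus_diff_eq mult.commute)

lemma space_p_def': "space_p = fs.span (range (\<lambda>a z. Q (z - a)))"
  by (simp add: space_p_def)

lemma fs_subspace_quad: "fs.subspace (range quad :: (complex^'n::finite \<Rightarrow> complex) set)"
proof (rule fs.subspaceI)
  show "0 \<in> range quad"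
    by (rule range_eqI[of _ _ 0]) (auto simp: fun_eq_iff quad_linear)
  fix f g :: "complex^'n \<Rightarrow> complex" and c
  assume "f \<in> range quad"
  then obtain S where S: "f = quad S" by auto
  show "(\<lambda>z. c * f z) \<in> range quad"
    by (rule range_eqI[of _ _ "matrix_scale c S"]) (auto simp: fun_eq_iff quad_linear S)
  assume "g \<in> range quad"
  then obtain T where T: "g = quad T" by auto
  show "f + g \<in> range quad"
    by (rule range_eqI[of _ _ "S + T"]) (auto simp: fun_eq_iff quad_linear S T)
qed

lemma space_p_translate:
  fixes f :: "complex^'n::finite \<Rightarrow> complex"
  assumes "f \<in> space_p"
  shows "(\<lambda>z. f (z + b)) \<in> space_p"
  using assms unfolding space_p_def'
proof (induction f rule: fs.span_induct)
  show "fs.subspace {f. (\<lambda>z. f (z + b)) \<in> fs.span (range (\<lambda>a z. Q (z - a)))}"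
  proof (rule fs.subspaceI; clarify)
    show "(\<lambda>z. (0 :: complex^'n \<Rightarrow> complex) (z + b)) \<in> fs.span (range (\<lambda>a z. Q (z - a)))"
      using fs.span_zero by (simp add: zero_fun_def)
    fix f g :: "complex^'n \<Rightarrow> complex" and c
    assume f: "(\<lambda>z. f (z + b)) \<in> fs.span (range (\<lambda>a z. Q (z - a)))"
    show "(\<lambda>z. c * f (z + b)) \<in> fs.span (range (\<lambda>a z. Q (z - a)))"
      by (rule fs.span_scale[OF f])
    assume g: "(\<lambda>z. g (z + b)) \<in> fs.span (range (\<lambda>a z. Q (z - a)))"
    show "(\<lambda>z. (f + g) (z + b)) \<in> fs.span (range (\<lambda>a z. Q (z - a)))"
      using fs.span_add[OF f g] by (simp add: plus_fun_def)
  qed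
  fix f :: "complex^'n \<Rightarrow> complex" assume "f \<in> range (\<lambda>a z. Q (z - a))"
  then obtain a where "f = (\<lambda>z. Q (z - a))" by auto
  then have "(\<lambda>z. f (z + b)) = (\<lambda>z. Q (z - (a - b)))"
    by (simp add: algebra_simps)
  then show "(\<lambda>z. f (z + b)) \<in> fs.span (range (\<lambda>a z. Q (z - a)))"
    by (auto intro: fs.span_base)
qed

text \<open>The five-point stencil is exact in degree four, so a span of translates of quartics is closed
  under differentiation.\<close>

lemma quartic_five_point:
  fixes a b c d e :: complex
  assumes "\<And>t. p t = a + t * b + t\<^sup>2 * c + t ^ 3 * d + t ^ 4 * e"
  shows "(1 / 12) * (p 2 - p (- 2)) + (2 / 3) * (p (- 1) - p 1) = - b"
  by (simp add: assms field_simps)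

text \<open>Along z + t d the function \<open>quad S\<close> is quartic in t, so the stencil is
  exact. It computes minus the derivative because translation by d acts on functions by f(z -
  d).\<close>

lemma quad_five_point:
  "quad (matrix_bracket (shift_mat d) S) z =
    (1 / 12) * (quad S (z + 2 *s d) - quad S (z + - 2 *s d)) + (2 / 3) * (quad S (z + - d) - quad S (z + d))"
proof -
  define a where "a x y = dot x (S *v y)" for x y
  have a_lin: "a (x + x') y = a x y + a x' y" "a (c *s x) y = c * a x y"
    "a x (y + y') = a x y + a x y'" "a x (c *s y) = c * a x y" for x x' y y' c
    by (simp_all add: a_def dot_simps matrix_linear)
  let ?N = "shift_mat d" and ?w = "mk 0 0 (- Delta d)"
  \<comment> \<open>The exponential of t times the nilpotent shift; \<open>?w\<close> is half of the
    square of the shift applied to \<open>psi z\<close>.\<close>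
  have psi: "psi (z + t *s d) = psi z + (t *s (?N *v psi z) + t\<^sup>2 *s ?w)" for t
    by (rule mk_eqI)
       (simp_all add: sel_linear psi_sel mk_sel shift_mat_apply Delta_eq_dot dot_simps dot_commute[of d z]
         power2_eq_square algebra_simps)
  have q: "quad S (z + t *s d) = a (psi z) (psi z) + t * (a (?N *v psi z) (psi z) + a (psi z) (?N *v psi z))
    + t\<^sup>2 * (a (?N *v psi z) (?N *v psi z) + a (psi z) ?w + a ?w (psi z))
    + t ^ 3 * (a (?N *v psi z) ?w + a ?w (?N *v psi z)) + t ^ 4 * a ?w ?w" for t
    by (simp only: quad_def psi a_def[symmetric] a_lin)
       (simp add: algebra_simps power2_eq_square power3_eq_cube power4_eq_xxxx)
  have "quad (matrix_bracket ?N S) z = - (a (?N *v psi z) (psi z) + a (psi z) (?N *v psi z))"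
    by (simp add: quad_bracket[OF shift_mat_skew] a_def)
  then show ?thesis
    using quartic_five_point[OF q] by simp
qed

text \<open>Every translate of Q is a multiple of the square of a linear form. Conversely, the span
  of the translates contains Q and is stable under infinitesimal translations, which generate all
  restricted forms from Q.\<close>

lemma space_p_eq: "space_p = (range quad :: (complex^'n::finite \<Rightarrow> complex) set)"
proof
  have "range (\<lambda>a z. Q (z - a)) \<subseteq> (range quad :: (complex^'n \<Rightarrow> complex) set)"
  proof clarify
    fix a :: "complex^'n"
    show "(\<lambda>z. Q (z - a)) \<in> range quad"
      by (rule range_eqI[of _ _ "matrix_scale 4 (outer (psi a) (psi a))"]) (simp add: fun_eq_iff Q_eq_quad)
  qed
  then show "space_p \<subseteq> (range quad :: (complex^'n \<Rightarrow> complex) set)"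
    unfolding space_p_def' by (rule fs.span_minimal) (rule fs_subspace_quad)
  have "quad S \<in> space_p" for S :: "complex^('n + bool)^('n + bool)"
  proof (rule quad_generation)
    show sub: "fs.subspace (space_p :: (complex^'n \<Rightarrow> complex) set)"
      unfolding space_p_def' by (rule fs.subspace_span)
    have "quad (outer (mk 0 2 0) (mk 0 2 0)) = (\<lambda>z :: complex^'n. Q (z - 0))"
      by (rule ext) (simp add: quad_outer dot_ext mk_sel psi_sel dot_simps Q_def power2_eq_square)
    then show "quad (outer (mk 0 2 0) (mk 0 2 0)) \<in> (space_p :: (complex^'n \<Rightarrow> complex) set)"
      unfolding space_p_def' by (simp only:) (rule fs.span_base[OF rangeI])
    fix S d assume S: "quad S \<in> (space_p :: (complex^'n \<Rightarrow> complex) set)"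
    have t: "(\<lambda>z. quad S (z + b)) \<in> space_p" for b
      by (rule space_p_translate[OF S])
    have lin: "(\<lambda>z. c * (f z - g z) + c' * (f' z - g' z)) \<in> space_p"
      if "f \<in> space_p" "g \<in> space_p" "f' \<in> space_p" "g' \<in> space_p"
      for f g f' g' :: "complex^'n \<Rightarrow> complex" and c c'
      using fs.subspace_add[OF sub fs.subspace_scale[OF sub fs.subspace_diff[OF sub that(1,2)], of c]
          fs.subspace_scale[OF sub fs.subspace_diff[OF sub that(3,4)], of c']]
      by (simp add: plus_fun_def)
    show "quad (matrix_bracket (shift_mat d) S) \<in> space_p"
      unfolding quad_five_point[abs_def] by (intro lin t)
  qed
  then show "range quad \<subseteq> (space_p :: (complex^'n \<Rightarrow> complex) set)" by auto
qed

section \<open>The representation in the null cone model\<close>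

lemma conf_map_has_derivative:
  assumes C: "orthogonal_matrix C" and w: "conf_map C z = Some w"
  defines "J \<equiv> hplus (C *v psi z)"
  shows "((\<lambda>x. the (conf_map C x)) has_derivative
    (\<lambda>h. inverse J *s (mid (C *v dpsi z h) - hplus (C *v dpsi z h) *s w))) (at z)"
proof -
  have J: "J \<noteq> 0"
    using w by (auto simp: J_def conf_map_def split: if_splits)
  have mid_w: "mid (C *v psi z) = J *s w"
    using w unfolding conf_map_eq_Some_iff[OF C] J_def by (metis mid_linear(4) psi_sel(1))
  have Cpsi: "((\<lambda>x. C *v psi x) has_derivative (\<lambda>h. C *v dpsi z h)) (at z)"
    by (rule bounded_linear.has_derivative[OF bounded_linear_matrix psi_has_derivative])
  have "((\<lambda>x. inverse (hplus (C *v psi x)) *s mid (C *v psi x)) has_derivative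
    (\<lambda>h. inverse J *s mid (C *v dpsi z h) + (- (inverse J * hplus (C *v dpsi z h) * inverse J)) *s mid (C *v psi z))) (at z)"
    unfolding J_def using J
    by (intro bounded_bilinear.FDERIV[OF bounded_bilinear_scale] Deriv.has_derivative_inverse
        bounded_linear.has_derivative[OF bounded_linear_hplus Cpsi]
        bounded_linear.has_derivative[OF bounded_linear_mid Cpsi]) (simp add: J_def)
  moreover have "(\<lambda>h. inverse J *s mid (C *v dpsi z h) + (- (inverse J * hplus (C *v dpsi z h) * inverse J)) *s mid (C *v psi z))
      = (\<lambda>h. inverse J *s (mid (C *v dpsi z h) - hplus (C *v dpsi z h) *s w))"
    using J by (simp add: mid_w vec_eq_iff fun_eq_iff field_simps)
  ultimately have "((\<lambda>x. inverse (hplus (C *v psi x)) *s mid (C *v psi x)) has_derivative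
     (\<lambda>h. inverse J *s (mid (C *v dpsi z h) - hplus (C *v dpsi z h) *s w))) (at z)"
    by simp
  then show ?thesis
  proof (rule has_derivative_transform_within_open[OF _ conf_map_domain(1)[OF C]])
    show "z \<in> {z. hplus (C *v psi z) \<noteq> 0}"
      using J by (simp add: J_def)
  qed (simp add: conf_map_def)
qed

text \<open>Up to a multiple of the isotropic vector \<open>psi w\<close>, the isometry C applied to
  \<open>dpsi\<close> is the denominator times the differential. The differential is thus a
  similarity, whose factor is the inverse square of the denominator, and \<mu> evaluates the
  character at its inverse.\<close>

lemma mu_conf_map:
  fixes C :: "complex^('n::finite + bool)^('n + bool)"
  assumes C: "orthogonal_matrix C" and w: "conf_map C z = Some w"
  shows "mu (conf_map C) z = (hplus (C *v psi z))\<^sup>2"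
proof -
  define J where "J = hplus (C *v psi z)"
  have Cpsi: "C *v psi z = J *s psi w"
    using w by (simp add: conf_map_eq_Some_iff[OF C] J_def)
  have J: "J \<noteq> 0"
    using w by (auto simp: J_def conf_map_def split: if_splits)
  define D where "D h = inverse J *s (mid (C *v dpsi z h) - hplus (C *v dpsi z h) *s w)" for h
  have D: "frechet_derivative (\<lambda>x. the (conf_map C x)) (at z) = D"
    using frechet_derivative_at[OF conf_map_has_derivative[OF C w]] by (simp add: D_def[abs_def] J_def)
  have lin: "linear D"
    using has_derivative_linear[OF conf_map_has_derivative[OF C w]] by (simp add: D_def[abs_def] J_def)
  \<comment> \<open>Subtracting this multiple of \<open>psi w\<close> makes \<open>hplus\<close>
    vanish and leaves J times the differential in the middle. Since \<open>psi w\<close> is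
    isotropic and orthogonal to the first term, the square is unchanged.\<close>
  define r where "r h = C *v dpsi z h - hplus (C *v dpsi z h) *s psi w" for h
  have r_sel: "mid (r h) = J *s D h" "hplus (r h) = 0" for h
    using J by (simp_all add: r_def D_def sel_linear psi_sel vector_smult_assoc)
  have orth: "dot (C *v dpsi z h) (psi w) = 0" for h
  proof -
    have "J * dot (C *v dpsi z h) (psi w) = dot (C *v dpsi z h) (C *v psi z)"
      by (simp add: Cpsi dot_simps)
    also have "\<dots> = 0"
      by (simp only: dot_orthogonal[OF C])
         (simp add: dot_ext dpsi_def psi_sel mk_sel dot_commute[of h z])
    finally show ?thesis using J by simp
  qed
  have iso: "dot (r h) (r h) = dot (dpsi z h) (dpsi z h)" for h
    unfolding r_def
    by (simp add: dot_simps orth dot_commute[of "psi w" "C *v _"] psi_isotropic dot_orthogonal[OF C])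
  have Delta_D: "J\<^sup>2 * Delta (D h) = Delta h" for h
  proof -
    have "J\<^sup>2 * Delta (D h) = dot (r h) (r h)"
      by (simp add: dot_ext r_sel dot_simps Delta_eq_dot power2_eq_square)
    also have "\<dots> = Delta h"
      unfolding iso by (simp add: dot_ext dpsi_def mk_sel Delta_eq_dot)
    finally show ?thesis .
  qed
  \<comment> \<open>Injectivity gives surjectivity in finite dimension, so that \<open>inv D\<close>
    is a right inverse to which the similarity relation applies.\<close>
  have "h = 0" if "D h = 0" for h
  proof -
    have "dot (r h) (psi w) = 0"
      by (simp add: r_def dot_simps orth psi_isotropic)
    then have "hminus (r h) = 0"
      using that by (simp add: dot_ext r_sel psi_sel dot_simps)
    then have "r h = 0"
      using that by (intro mk_eqI) (simp_all add: r_sel sel_linear)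
    then have "C *v (J *s dpsi z h - hplus (C *v dpsi z h) *s psi z) = 0"
      by (simp add: matrix_linear Cpsi r_def vec_eq_iff algebra_simps)
    then have "J *s dpsi z h - hplus (C *v dpsi z h) *s psi z = 0"
      by (rule orthogonal_matrix_vec_eq_0[OF C])
    then have *: "J *s dpsi z h = hplus (C *v dpsi z h) *s psi z" by simp
    have "hplus (C *v dpsi z h) = 0"
      using arg_cong[OF *, of hplus] by (simp add: sel_linear psi_sel dpsi_def mk_sel)
    with * J have "dpsi z h = 0" by simp
    then show "h = 0"
      by (metis dpsi_def mid_linear(5) mk_sel(1))
  qed
  then have "inj D"
    using linear_injective_0[OF lin] by blast
  then have "surj D"
    by (rule eucl.linear_inj_imp_surj[OF lin])
  then have "D (inv D k) = k" for k
    by (rule surj_f_inv_f)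
  then have "Delta (inv D k) = J\<^sup>2 * Delta k" for k
    by (metis Delta_D)
  then have "str_character (inv D) = J\<^sup>2"
    unfolding str_character_def
    by (intro the_equality) (simp, metis Delta_axis mult.right_neutral)
  then show ?thesis
    by (simp add: mu_def D J_def)
qed

text \<open>Quadratic forms are homogeneous of degree two, so replacing the transported vector by
  its chart representative produces exactly the factor \<mu>. Density of the domain determines the
  polynomial.\<close>

lemma kappa_conf_map:
  fixes B S :: "complex^('n::finite + bool)^('n + bool)"
  assumes B: "orthogonal_matrix B"
  shows "kappa (conf_map B) (quad S) = quad (B ** S ** transpose B)"
  unfolding kappa_def conf_inv_conf_map[OF B]
proof (rule the_equality)
  have C: "orthogonal_matrix (transpose B)" using B by simp
  let ?C = "transpose B"
  have eq: "quad (B ** S ** transpose B) z = mu (conf_map ?C) z * quad S w" if "conf_map ?C z = Some w" for z w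
  proof -
    have *: "?C *v psi z = hplus (?C *v psi z) *s psi w"
      using that by (simp only: conf_map_eq_Some_iff[OF C])
    have "quad (B ** S ** ?C) z = dot (psi z) (B *v (S *v (?C *v psi z)))"
      by (simp only: quad_def matrix_vector_mul_assoc[symmetric])
    also have "\<dots> = dot (?C *v psi z) (S *v (?C *v psi z))"
      by (metis dot_commute dot_matrix_left)
    also have "\<dots> = (hplus (?C *v psi z))\<^sup>2 * quad S w"
      by (subst *, subst (2) *)
         (simp only: matrix_mult_scale dot_simps quad_def power2_eq_square mult.assoc)
    finally show ?thesis
      by (simp only: mu_conf_map[OF C that])
  qed
  then show "quad (B ** S ** transpose B) \<in> space_p \<and>
      (\<forall>z w. conf_map ?C z = Some w \<longrightarrow> quad (B ** S ** transpose B) z = mu (conf_map ?C) z * quad S w)"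
    by (simp add: space_p_eq)
  fix h assume h: "h \<in> space_p \<and> (\<forall>z w. conf_map ?C z = Some w \<longrightarrow> h z = mu (conf_map ?C) z * quad S w)"
  then obtain T where T: "h = quad T"
    by (auto simp: space_p_eq)
  show "h = quad (B ** S ** transpose B)"
  proof
    fix z
    show "h z = quad (B ** S ** transpose B) z"
    proof (rule eq_on_dense[OF _ _ conf_map_domain(2)[OF C]])
      show "continuous_on UNIV h" "continuous_on UNIV (quad (B ** S ** transpose B))"
        unfolding T by (intro polynomial_fun_continuous polynomial_fun_quad)+
      fix z assume "z \<in> {z. hplus (?C *v psi z) \<noteq> 0}"
      then have "conf_map ?C z \<noteq> None"
        by (simp only: conf_map_def mem_Collect_eq) simp
      then obtain w where w: "conf_map ?C z = Some w" by blast
      show "h z = quad (B ** S ** transpose B) z"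
        using h w eq[OF w] by simp
    qed
  qed
qed

lemma inf_field_linear:
  "inf_field (A + B) z = inf_field A z + inf_field B z"
  "inf_field (A - B) z = inf_field A z - inf_field B z"
  "inf_field (matrix_scale c A) z = c *s inf_field A z"
  by (simp_all add: inf_field_def matrix_mult_left_linear sel_linear vec_eq_iff algebra_simps)

lemma inf_field_inject:
  assumes "transpose A = - A" "transpose B = - B" "inf_field A = inf_field B"
  shows "A = B"
proof -
  have "transpose (A - B) = - (A - B)"
    using assms(1,2) unfolding skew_iff_dot by (simp add: matrix_mult_left_linear dot_simps)
  moreover have "inf_field (A - B) = (\<lambda>z. 0)"
    by (rule ext) (simp add: inf_field_linear assms(3))
  ultimately show ?thesis
    using inf_field_eq_0 by force
qed

text \<open>\<open>conf_exp\<close> is an arbitrary one-parameter subgroup with the given velocity.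
  The generator of its lift has the same vector field, hence is A, and the derivative at 0 depends
  on nothing else.\<close>

lemma d_kappa_inf_field:
  fixes A S :: "complex^('n::finite + bool)^('n + bool)"
  assumes skew: "transpose A = - A"
  shows "d_kappa (inf_field A) (quad S) = quad (matrix_bracket A S)"
proof
  fix z
  have "\<exists>g. one_parameter_subgroup Conf g (inf_field A)"
    using inf_field_in_Lie_Conf[OF skew] by (simp add: Lie_def)
  then have "one_parameter_subgroup Conf (conf_exp (inf_field A)) (inf_field A)"
    unfolding conf_exp_def by (rule someI_ex)
  then obtain B A' where B: "\<And>t. orthogonal_matrix (B t)" "\<And>t. conf_exp (inf_field A) t = conf_map (B t)"
    "deriv_at_0 B A'" "transpose A' = - A'" "inf_field A = inf_field A'"
    using one_parameter_subgroup_lift by blast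
  have A': "A' = A"
    using inf_field_inject[OF skew B(4,5)] by simp
  have B0: "B 0 = mat 1" and B_deriv: "((\<lambda>t. B t *v x) has_vector_derivative A *v x) (at 0)" for x
    using B(3) by (simp_all add: deriv_at_0_def A')
  \<comment> \<open>Expresses the transpose through orbits of basis vectors, whose differentiability
    is known.\<close>
  have tr: "transpose M *v x = (\<Sum>i\<in>UNIV. dot (M *v axis i 1) x *s axis i 1)"
    for M :: "complex^('n + bool)^('n + bool)" and x
    by (subst vec_axis_sum) (simp only: dot_axis_left[symmetric] dot_matrix_left)
  have Bt_deriv: "((\<lambda>t. transpose (B t) *v x) has_vector_derivative transpose A *v x) (at 0)" for x
    unfolding tr
    by (intro has_vector_derivative_sum bounded_linear.has_vector_derivative[OF
          bounded_bilinear.bounded_linear_left[OF bounded_bilinear_scale]]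
        bounded_linear.has_vector_derivative[OF bounded_bilinear.bounded_linear_left[OF bounded_bilinear_dot]] B_deriv)
  have "kappa (conf_exp (inf_field A) t) (quad S) z
      = dot (transpose (B t) *v psi z) (S *v (transpose (B t) *v psi z))" for t
  proof -
    have "kappa (conf_exp (inf_field A) t) (quad S) z = dot (psi z) (B t *v (S *v (transpose (B t) *v psi z)))"
      unfolding B(2) kappa_conf_map[OF B(1)] by (simp only: quad_def matrix_vector_mul_assoc[symmetric])
    also have "\<dots> = dot (transpose (B t) *v psi z) (S *v (transpose (B t) *v psi z))"
      by (metis dot_commute dot_matrix_left)
    finally show ?thesis .
  qed
  moreover have "((\<lambda>t. dot (transpose (B t) *v psi z) (S *v (transpose (B t) *v psi z))) has_vector_derivative
     (dot (transpose (B 0) *v psi z) (S *v (transpose A *v psi z)) +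
      dot (transpose A *v psi z) (S *v (transpose (B 0) *v psi z)))) (at 0)"
    by (intro bilinear_has_vector_derivative[OF bounded_bilinear_dot] Bt_deriv
        bounded_linear.has_vector_derivative[OF bounded_linear_matrix])
  moreover have "dot (transpose (B 0) *v psi z) (S *v (transpose A *v psi z)) +
      dot (transpose A *v psi z) (S *v (transpose (B 0) *v psi z)) = quad (matrix_bracket A S) z"
    by (simp only: quad_bracket[OF skew] B0 skew transpose_mat matrix_vector_mul_lid
        matrix_mult_left_linear matrix_mult_minus dot_simps) simp
  ultimately show "d_kappa (inf_field A) (quad S) z = quad (matrix_bracket A S) z"
    by (simp add: d_kappa_def vector_derivative_at)
qed

section \<open>Brackets of vector fields\<close>

text \<open>By skewness \<open>B *v psi z\<close> is tangent to the cone. Subtracting the multiple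
  of \<open>psi z\<close> with the same \<open>hplus\<close> makes it tangent to the slice
  \<open>hplus = 1\<close>, which \<open>psi\<close> parametrises.\<close>

lemma dpsi_inf_field:
  assumes "transpose B = - B"
  shows "dpsi z (inf_field B z) = B *v psi z - hplus (B *v psi z) *s psi z"
proof (rule mk_eqI)
  have "dot (psi z) (B *v psi z) = - dot (B *v psi z) (psi z)"
    using assms by (simp add: skew_iff_dot)
  then have "dot (psi z) (B *v psi z) = 0"
    by (simp add: dot_commute[of "B *v psi z"])
  then have "hminus (B *v psi z) = hplus (B *v psi z) * Delta z - 2 * dot z (mid (B *v psi z))"
    by (simp add: dot_ext psi_sel field_simps)
  then show "hminus (dpsi z (inf_field B z)) = hminus (B *v psi z - hplus (B *v psi z) *s psi z)"
    by (simp add: dpsi_def inf_field_def mk_sel sel_linear psi_sel dot_simps Delta_eq_dot algebra_simps)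
qed (simp_all add: dpsi_def inf_field_def mk_sel sel_linear psi_sel)

lemma inf_field_derivative:
  "frechet_derivative (inf_field A) (at z) h =
    mid (A *v dpsi z h) - hplus (A *v dpsi z h) *s z - hplus (A *v psi z) *s h"
proof -
  have Apsi: "((\<lambda>x. A *v psi x) has_derivative (\<lambda>h. A *v dpsi z h)) (at z)"
    by (rule bounded_linear.has_derivative[OF bounded_linear_matrix psi_has_derivative])
  have "((\<lambda>x. mid (A *v psi x) - hplus (A *v psi x) *s x) has_derivative
      (\<lambda>h. mid (A *v dpsi z h) - (hplus (A *v psi z) *s h + hplus (A *v dpsi z h) *s z))) (at z)"
    by (rule has_derivative_diff[OF bounded_linear.has_derivative[OF bounded_linear_mid Apsi]
        bounded_bilinear.FDERIV[OF bounded_bilinear_scale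
          bounded_linear.has_derivative[OF bounded_linear_hplus Apsi] has_derivative_ident]])
  then have "(inf_field A has_derivative
      (\<lambda>h. mid (A *v dpsi z h) - (hplus (A *v psi z) *s h + hplus (A *v dpsi z h) *s z))) (at z)"
    by (simp add: inf_field_def[abs_def])
  from frechet_derivative_at[OF this, symmetric] show ?thesis
    by (simp add: algebra_simps)
qed

text \<open>Besides the field of the product A B, the derivative of the first field along the second
  contains only terms symmetric in A and B, which cancel. The sign convention of
  \<open>field_bracket\<close> then gives the commutator without a sign.\<close>

lemma field_bracket_inf_field:
  assumes "transpose A = - A" "transpose B = - B"
  shows "field_bracket (inf_field A) (inf_field B) = inf_field (matrix_bracket A B)"
proof
  fix z
  show "field_bracket (inf_field A) (inf_field B) z = inf_field (matrix_bracket A B) z"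
    unfolding field_bracket_def inf_field_derivative dpsi_inf_field[OF assms(1)] dpsi_inf_field[OF assms(2)]
    by (simp add: inf_field_def matrix_bracket_def matrix_linear matrix_mult_left_linear sel_linear vec_eq_iff
        algebra_simps flip: matrix_vector_mul_assoc)
qed

section \<open>The real forms\<close>

lemma vec_cnj_mk: "vec_cnj (mk y a b) = mk (vec_cnj y) (cnj b) (cnj a)"
  by (auto simp: vec_cnj_def mk_def vec_eq_iff algebra_simps split: sum.splits)

lemma vec_cnj_sel: "mid (vec_cnj x) = vec_cnj (mid x)" "hplus (vec_cnj x) = cnj (hminus x)"
  "hminus (vec_cnj x) = cnj (hplus x)"
  by (metis mk_collapse mk_sel vec_cnj_mk)+

lemma cnj_dot: "cnj (dot x y) = dot (vec_cnj x) (vec_cnj y)"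
  by (simp add: dot_def vec_cnj_def)

lemma vec_cnj_psi: "vec_cnj (psi (vec_cnj z)) = swap_mat *v psi z"
proof -
  have "cnj (Delta (vec_cnj z)) = Delta z"
    by (simp add: Delta_eq_dot cnj_dot vec_cnj_vec_cnj)
  then show ?thesis
    by (simp add: psi_def vec_cnj_mk vec_cnj_vec_cnj swap_mat_apply mk_sel)
qed

lemma transpose_swap_mat: "transpose swap_mat = swap_mat"
  by (metis matrix_mul_assoc matrix_mul_lid matrix_mul_rid orthogonal_matrix_def orthogonal_swap_mat swap_mat_inverse)

lemma mat_cnj_orthogonal: "orthogonal_matrix A \<Longrightarrow> orthogonal_matrix (mat_cnj A)"
proof (rule orthogonal_matrixI)
  fix x y assume "orthogonal_matrix A"
  then have "dot (vec_cnj (A *v vec_cnj x)) (vec_cnj (A *v vec_cnj y)) = dot x y"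
    by (simp add: dot_orthogonal vec_cnj_vec_cnj flip: cnj_dot)
  then show "dot (mat_cnj A *v x) (mat_cnj A *v y) = dot x y"
    by (simp add: vec_cnj_matrix vec_cnj_vec_cnj)
qed

lemma conf_conj_conf_map: "conf_conj (conf_map B) = conf_map (swap_mat ** mat_cnj B ** swap_mat)"
proof
  fix z
  have "(swap_mat ** mat_cnj B ** swap_mat) *v psi z = swap_mat *v vec_cnj (B *v psi (vec_cnj z))"
    by (simp only: vec_cnj_matrix vec_cnj_psi matrix_vector_mul_assoc[symmetric])
  then have *: "(swap_mat ** mat_cnj B ** swap_mat) *v psi z =
      mk (vec_cnj (mid (B *v psi (vec_cnj z)))) (cnj (hplus (B *v psi (vec_cnj z)))) (cnj (hminus (B *v psi (vec_cnj z))))"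
    by (simp add: swap_mat_apply vec_cnj_sel)
  show "conf_conj (conf_map B) z = conf_map (swap_mat ** mat_cnj B ** swap_mat) z"
    unfolding conf_conj_def conf_map_def * by (simp add: mk_sel vec_cnj_linear)
qed

text \<open>The two swaps coming from conjugation on V cancel against the two coming from
  conjugation by \<open>sigma\<close>.\<close>

lemma alpha_conf_map:
  fixes B :: "complex^('n::finite + bool)^('n + bool)"
  assumes "orthogonal_matrix B"
  shows "alpha (conf_map B) = conf_map (mat_cnj B)"
proof -
  let ?S = "swap_mat :: complex^('n + bool)^('n + bool)"
  have "?S ** (?S ** mat_cnj B ** ?S) ** ?S = mat_cnj B"
    by (metis matrix_mul_assoc matrix_mul_lid matrix_mul_rid swap_mat_inverse)
  moreover have "alpha (conf_map B) = conf_map ?S \<circ>\<^sub>r conf_map (?S ** mat_cnj B ** ?S) \<circ>\<^sub>r conf_map ?S"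
    by (simp only: alpha_def conf_map_swap[symmetric] conf_inv_conf_map[OF orthogonal_swap_mat]
        transpose_swap_mat conf_conj_conf_map)
  ultimately show ?thesis
    by (simp add: conf_map_comp orthogonal_swap_mat orthogonal_matrix_mult mat_cnj_orthogonal assms)
qed

lemma mat_cnj_transpose: "mat_cnj (transpose A) = transpose (mat_cnj A)"
  and mat_cnj_minus: "mat_cnj (- A) = - mat_cnj A"
  by (simp_all add: mat_cnj_def transpose_def vec_eq_iff)

text \<open>Invariance under \<alpha> equates the maps of \<open>B t\<close> and of its entrywise
  conjugate, not the matrices. Comparing velocities at 0 avoids the sign and shows that the
  generator is real.\<close>

lemma lie_k_R_eq: "lie_k_R = inf_field ` {A. transpose A = - A \<and> mat_cnj A = A}"
proof (intro equalityI subsetI)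
  fix X assume "X \<in> (lie_k_R :: (complex^'n \<Rightarrow> complex^'n) set)"
  then obtain g where g: "one_parameter_subgroup Conf_R g X"
    by (auto simp: lie_k_R_def Lie_def)
  then have "one_parameter_subgroup Conf g X" and alpha: "\<And>t. alpha (g t) = g t"
    by (auto simp: one_parameter_subgroup_def Conf_R_def)
  then obtain B A where B: "\<And>t. orthogonal_matrix (B t)" "\<And>t. g t = conf_map (B t)"
    "deriv_at_0 B A" "transpose A = - A" "X = inf_field A"
    using one_parameter_subgroup_lift by blast
  have "deriv_at_0 (\<lambda>t. mat_cnj (B t)) (mat_cnj A)"
    unfolding deriv_at_0_def
  proof (intro conjI allI)
    show "mat_cnj (B 0) = mat 1"
      using B(3) by (simp add: deriv_at_0_def mat_cnj_def mat_def vec_eq_iff)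
    fix x
    have "((\<lambda>t. vec_cnj (B t *v vec_cnj x)) has_vector_derivative vec_cnj (A *v vec_cnj x)) (at 0)"
      using B(3) by (intro bounded_linear.has_vector_derivative[OF bounded_linear_vec_cnj]) (simp add: deriv_at_0_def)
    then show "((\<lambda>t. mat_cnj (B t) *v x) has_vector_derivative mat_cnj A *v x) (at 0)"
      by (simp add: vec_cnj_matrix vec_cnj_vec_cnj)
  qed
  moreover have "conf_map (mat_cnj (B t)) = conf_map (B t)" for t
    using alpha[of t] by (simp add: B(2) alpha_conf_map[OF B(1)])
  ultimately have "inf_field (mat_cnj A) z = inf_field A z" for z
    using conf_map_has_vector_derivative[of "\<lambda>t. mat_cnj (B t)" "mat_cnj A" z]
      conf_map_has_vector_derivative[OF B(3), of z]
    by (simp add: vector_derivative_unique_at)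
  then have "inf_field (mat_cnj A) = inf_field A" by (rule ext)
  moreover have "transpose (mat_cnj A) = - mat_cnj A"
    by (simp only: B(4) flip: mat_cnj_transpose mat_cnj_minus)
  ultimately have "mat_cnj A = A"
    using B(4) inf_field_inject by blast
  with B(4,5) show "X \<in> inf_field ` {A. transpose A = - A \<and> mat_cnj A = A}"
    by blast
next
  fix X :: "complex^'n \<Rightarrow> complex^'n"
  assume "X \<in> inf_field ` {A. transpose A = - A \<and> mat_cnj A = A}"
  then obtain A where A: "transpose A = - A" "mat_cnj A = A" "X = inf_field A" by auto
  obtain E where E: "\<And>t. orthogonal_matrix (E t)" "\<And>s t. E (s + t) = E s ** E t" "deriv_at_0 E A"
    "\<And>t. mat_cnj A = A \<Longrightarrow> mat_cnj (E t) = E t"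
    using skew_exponential[OF A(1)] by metis
  have "conf_map (E t) \<in> Conf_R" for t
    using E A by (simp add: Conf_R_def conf_map_in_Conf alpha_conf_map)
  then show "X \<in> lie_k_R"
    unfolding lie_k_R_def Lie_def A(3) using one_parameter_subgroup_conf_map[OF E(3,1,2)] by blast
qed

text \<open>Conjugating the function surrounds the conjugate matrix by two swaps, and the action of
  \<open>sigma\<close> removes them.\<close>

lemma kappa_sigma_cnj:
  fixes S :: "complex^('n::finite + bool)^('n + bool)"
  shows "kappa sigma (\<lambda>z. cnj (quad S (vec_cnj z))) = quad (mat_cnj S)"
proof -
  let ?R = "swap_mat :: complex^('n + bool)^('n + bool)"
  have "cnj (quad S (vec_cnj z)) = quad (?R ** mat_cnj S ** ?R) z" for z
  proof -
    have "cnj (quad S (vec_cnj z)) = dot (?R *v psi z) (mat_cnj S *v (?R *v psi z))"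
      by (simp only: quad_def cnj_dot vec_cnj_psi vec_cnj_matrix)
    also have "\<dots> = dot (psi z) (?R *v (mat_cnj S *v (?R *v psi z)))"
      by (simp only: dot_matrix_left transpose_swap_mat)
    finally show ?thesis
      by (simp only: quad_def matrix_vector_mul_assoc matrix_mul_assoc)
  qed
  then have "kappa sigma (\<lambda>z. cnj (quad S (vec_cnj z))) = kappa (conf_map ?R) (quad (?R ** mat_cnj S ** ?R))"
    by (simp add: conf_map_swap)
  also have "\<dots> = quad (?R ** (?R ** mat_cnj S ** ?R) ** ?R)"
    by (simp only: kappa_conf_map[OF orthogonal_swap_mat] transpose_swap_mat)
  also have "?R ** (?R ** mat_cnj S ** ?R) ** ?R = mat_cnj S"
    by (metis matrix_mul_assoc matrix_mul_lid matrix_mul_rid swap_mat_inverse)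
  finally show ?thesis .
qed

section \<open>Traceless symmetric representatives and their real forms\<close>

lemma trace_linear:
  fixes A B :: "complex^'k^'k"
  shows "trace (matrix_scale c A) = c * trace A" "trace (transpose A) = trace A" "trace (- A) = - trace A"
  by (simp_all add: trace_def matrix_scale_def transpose_def sum_distrib_left sum_negf)

text \<open>\<open>quad\<close> sees neither the skew part nor multiples of the identity, so both
  can be projected away.\<close>

lemma space_p_eq_traceless:
  "space_p = (quad ` {S. transpose S = S \<and> trace S = 0} :: (complex^'n::finite \<Rightarrow> complex) set)"
proof -
  have "quad T \<in> quad ` {S. transpose S = S \<and> trace S = 0}" for T :: "complex^('n + bool)^('n + bool)"
  proof -
    define S where "S = matrix_scale (1/2) (T + transpose T) - matrix_scale (trace T / (2 + of_nat CARD('n))) (mat 1)"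
    have "trace (mat 1 :: complex^('n + bool)^('n + bool)) = 2 + of_nat CARD('n)"
      by (simp add: trace_def mat_def)
    then have "trace S = 0"
      using two_plus_of_nat by (simp add: S_def trace_linear trace_add trace_sub)
    moreover have "transpose S = S"
      by (simp add: S_def transpose_def matrix_scale_def mat_def vec_eq_iff add.commute)
    moreover have "quad S = quad T"
      by (rule ext) (simp only: S_def quad_linear quad_transpose quad_id, simp)
    ultimately show ?thesis by (intro image_eqI[of _ _ S]) simp_all
  qed
  then show ?thesis
    unfolding space_p_eq by auto
qed

text \<open>Uniqueness of the traceless symmetric representative turns invariance of the function
  into reality of its matrix.\<close>

lemma space_p_R_eq: "space_p_R = quad ` {S. transpose S = S \<and> trace S = 0 \<and> mat_cnj S = S}"
proof (intro equalityI subsetI)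
  fix f assume "f \<in> (space_p_R :: (complex^'n \<Rightarrow> complex) set)"
  then obtain S where S: "f = quad S" "transpose S = S" "trace S = 0"
    and f: "kappa sigma (\<lambda>z. cnj (f (vec_cnj z))) = f"
    unfolding space_p_R_def space_p_eq_traceless by blast
  have "mat_cnj S - S = 0"
  proof (rule quad_eq_0)
    show "transpose (mat_cnj S - S) = mat_cnj S - S"
      using arg_cong[OF S(2), of mat_cnj] S(2) unfolding mat_cnj_transpose
      by (simp add: transpose_def vec_eq_iff)
    have "trace (mat_cnj S) = cnj (trace S)"
      by (simp add: trace_def mat_cnj_def)
    then show "trace (mat_cnj S - S) = 0"
      using S(3) by (simp add: trace_sub)
    show "quad (mat_cnj S - S) z = 0" for z
      using f unfolding S(1) kappa_sigma_cnj by (simp add: quad_linear)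
  qed
  then show "f \<in> quad ` {S. transpose S = S \<and> trace S = 0 \<and> mat_cnj S = S}"
    using S by auto
next
  fix f :: "complex^'n \<Rightarrow> complex"
  assume "f \<in> quad ` {S. transpose S = S \<and> trace S = 0 \<and> mat_cnj S = S}"
  then obtain S where S: "f = quad S" "transpose S = S" "trace S = 0" "mat_cnj S = S" by auto
  then show "f \<in> space_p_R"
    by (auto simp: space_p_R_def space_p_eq kappa_sigma_cnj)
qed

section \<open>Lie algebras of matrices\<close>

lemma matrix_scale_mult:
  fixes A B :: "'k::field^'m::finite^'m"
  shows "matrix_scale c A ** B = matrix_scale c (A ** B)" "A ** matrix_scale c B = matrix_scale c (A ** B)"
  by (simp_all add: matrix_scale_def matrix_matrix_mult_def vec_eq_iff sum_distrib_left algebra_simps)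

lemma matrix_mult_add:
  fixes A B C :: "'k::field^'m::finite^'m"
  shows "(A + B) ** C = A ** C + B ** C" "C ** (A + B) = C ** A + C ** B"
    "(A - B) ** C = A ** C - B ** C" "C ** (A - B) = C ** A - C ** B"
  by (simp_all add: matrix_matrix_mult_def vec_eq_iff sum.distrib sum_subtractf algebra_simps)

lemma matrix_scale_linear:
  fixes A B :: "'k::field^'m::finite^'m"
  shows "matrix_scale c (A + B) = matrix_scale c A + matrix_scale c B"
    "matrix_scale c (A - B) = matrix_scale c A - matrix_scale c B"
    "matrix_scale (c + d) A = matrix_scale c A + matrix_scale d A"
    "matrix_scale c (matrix_scale d A) = matrix_scale (c * d) A" "matrix_scale 1 A = A"
  by (simp_all add: matrix_scale_def vec_eq_iff algebra_simps)

lemma lie_algebra_special_linear: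
  "lie_algebra_on (matrix_scale :: 'k::field \<Rightarrow> 'k^'m::finite^'m \<Rightarrow> _) special_linear_algebra matrix_bracket"
proof (unfold_locales)
  fix x y z :: "'k^'m^'m" and a b
  show "matrix_scale a (x + y) = matrix_scale a x + matrix_scale a y"
    "matrix_scale (a + b) x = matrix_scale a x + matrix_scale b x"
    "matrix_scale a (matrix_scale b x) = matrix_scale (a * b) x" "matrix_scale 1 x = x"
    by (simp_all add: matrix_scale_linear)
  interpret vector_space "matrix_scale :: 'k::field \<Rightarrow> 'k^'m^'m \<Rightarrow> _"
    by unfold_locales (simp_all add: matrix_scale_linear)
  show "subspace (special_linear_algebra :: ('k^'m^'m) set)"
    by (rule subspaceI) (simp_all add: special_linear_algebra_def trace_def matrix_scale_def sum.distrib
        flip: sum_distrib_left)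
  have "trace (matrix_bracket x y) = 0"
    unfolding matrix_bracket_def trace_sub by (simp add: trace_mul_sym[of x y])
  then show "matrix_bracket x y \<in> special_linear_algebra"
    by (simp add: special_linear_algebra_def)
  show "matrix_bracket x (matrix_bracket y z) + matrix_bracket y (matrix_bracket z x)
      + matrix_bracket z (matrix_bracket x y) = 0"
    by (simp add: matrix_bracket_def matrix_mult_add matrix_mul_assoc)
qed (simp_all add: matrix_bracket_def matrix_mult_add matrix_scale_mult matrix_scale_linear)

text \<open>Only the second side is assumed to be a Lie algebra; its axioms are carried over along
  \<Phi>. The same argument thus serves both to construct a bracket and to obtain the final
  isomorphisms.\<close>

lemma lie_algebra_iso_inverse:
  fixes s1 :: "'k::field \<Rightarrow> 'a::ab_group_add \<Rightarrow> 'a" and s2 :: "'k \<Rightarrow> 'b::ab_group_add \<Rightarrow> 'b"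
  assumes L2: "lie_algebra_on s2 L2 br2" and V: "vector_space s1" and bij: "bij_betw \<Phi> L2 L1"
    and add: "\<And>x y. x \<in> L2 \<Longrightarrow> y \<in> L2 \<Longrightarrow> \<Phi> (x + y) = \<Phi> x + \<Phi> y"
    and scale: "\<And>c x. x \<in> L2 \<Longrightarrow> \<Phi> (s2 c x) = s1 c (\<Phi> x)"
    and br: "\<And>x y. x \<in> L2 \<Longrightarrow> y \<in> L2 \<Longrightarrow> br1 (\<Phi> x) (\<Phi> y) = \<Phi> (br2 x y)"
  shows "lie_algebra_iso s1 L1 br1 s2 L2 br2 (inv_into L2 \<Phi>)"
proof -
  interpret L2: lie_algebra_on s2 L2 br2 by (rule L2)
  interpret V: vector_space s1 by (rule V)
  note closed = L2.subspace_add[OF L2.subspace_carrier] L2.subspace_scale[OF L2.subspace_carrier]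
    L2.bracket_closed L2.subspace_0[OF L2.subspace_carrier]
  have img: "\<Phi> ` L2 = L1" and inj: "inj_on \<Phi> L2"
    using bij by (auto simp: bij_betw_def)
  have zero: "\<Phi> 0 = 0"
    using add[of 0 0] closed(4) by simp
  have L1: "lie_algebra_on s1 L1 br1"
  proof (unfold_locales)
    show "V.subspace L1"
      unfolding img[symmetric]
    proof (rule V.subspaceI)
      show "0 \<in> \<Phi> ` L2" using zero closed(4) by force
    qed (auto simp: closed simp flip: add scale)
  qed (auto simp: closed br L2.bracket_add_left L2.bracket_add_right L2.bracket_scale_left
      L2.bracket_scale_right L2.bracket_alternating zero L2.jacobi simp flip: img add scale)
  have inv: "inv_into L2 \<Phi> (\<Phi> x) = x" if "x \<in> L2" for x
    using inj that by (rule inv_into_f_f)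
  show ?thesis
    unfolding lie_algebra_iso_def
  proof (intro conjI L1 L2 bij_betw_inv_into bij)
  qed (auto simp: closed br inv simp flip: img add scale)
qed

section \<open>Uniqueness of the bracket\<close>

lemma (in lie_algebra_on) bracket_antisym:
  assumes "x \<in> L" "y \<in> L"
  shows "br x y = - br y x"
proof -
  have xy: "x + y \<in> L"
    using assms by (rule subspace_add[OF subspace_carrier])
  have "br (x + y) (x + y) = br x (x + y) + br y (x + y)"
    using assms xy by (intro bracket_add_left)
  also have "\<dots> = br x y + br y x"
    using assms by (simp add: bracket_add_right bracket_alternating)
  finally have "br x y + br y x = 0"
    using xy by (simp add: bracket_alternating)
  then show ?thesis by (simp add: eq_neg_iff_add_eq_0)
qed

lemma (in lie_algebra_on) bracket_minus_right:
  assumes "x \<in> L" "y \<in> L"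
  shows "br x (- y) = - br x y"
  using bracket_scale_right[OF assms, of "- 1"] by simp

lemma (in lie_algebra_on) bracket_derivation:
  assumes "x \<in> L" "y \<in> L" "z \<in> L"
  shows "br x (br y z) = br (br x y) z + br y (br x z)"
proof -
  have "br z (br x y) = - br (br x y) z" "br y (br z x) = - br y (br x z)"
    using assms bracket_antisym[of z "br x y"] bracket_antisym[of z x] bracket_minus_right[of y "br x z"]
    by (simp_all add: bracket_closed)
  with jacobi[OF assms] have "br x (br y z) - br y (br x z) - br (br x y) z = 0" by simp
  then show ?thesis by (simp add: algebra_simps)
qed

lemma g_scale_sel: "fst (g_scale c x) = (\<lambda>z. c *s fst x z)" "snd (g_scale c x) = (\<lambda>z. c * snd x z)"
  by (simp_all add: g_scale_def split_beta)

lemma vector_space_g_scale: "vector_space g_scale"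
  by unfold_locales
     (simp_all add: prod_eq_iff g_scale_sel fun_eq_iff vector_add_ldistrib vector_sadd_rdistrib
       vector_smult_assoc distrib_left distrib_right)

lemma zero_in_lie_k: "0 \<in> lie_k"
proof -
  have "inf_field 0 = 0"
    by (simp add: fun_eq_iff inf_field_def matrix_mult_left_linear sel_linear)
  moreover have "transpose (0 :: complex^('n::finite + bool)^('n + bool)) = - 0"
    by (simp add: transpose_def vec_eq_iff)
  ultimately show ?thesis
    unfolding lie_k_eq by (intro image_eqI[of _ _ 0]) simp_all
qed

lemma subspace_space_p: "fs.subspace space_p"
  unfolding space_p_def' by (rule fs.subspace_span)

lemma zero_in_space_p: "0 \<in> space_p"
  by (rule fs.subspace_0[OF subspace_space_p])

lemma F_elem_eq: "F_elem = quad (outer (mk 0 0 2) (mk 0 0 2))"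
  by (rule ext) (simp add: F_elem_def quad_outer dot_ext mk_sel psi_sel dot_simps)

lemma E_elem_eq: "E_elem = quad (outer (mk 0 2 0) (mk 0 2 0))"
  by (rule ext) (simp add: E_elem_def Q_def quad_outer dot_ext mk_sel psi_sel dot_simps power2_eq_square)

lemma outer_linear: "outer (c *s x) y = matrix_scale c (outer x y)" "outer x (c *s y) = matrix_scale c (outer x y)"
  "outer (- x) y = - outer x y" "outer x (- y) = - outer x y" "outer 0 y = 0" "outer x 0 = 0"
  by (simp_all add: outer_def matrix_scale_def vec_eq_iff)

lemma outer_mult: "outer x y ** outer x' y' = matrix_scale (dot y x') (outer x y')"
  by (simp add: outer_def matrix_scale_def matrix_matrix_mult_def dot_def vec_eq_iff sum_distrib_left
      sum_distrib_right mult_ac)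

text \<open>\<open>F\<close> is a lowest and \<open>E\<close> a highest weight vector; the raising operator below is nilpotent and
  its fourth power maps \<open>F\<close> to a multiple of \<open>E\<close>.\<close>

lemma quad_invariant_subspace:
  fixes W :: "(complex^'n::finite \<Rightarrow> complex) set"
  assumes W: "fs.subspace W" and F: "F_elem \<in> W"
    and closed: "\<And>S A. quad S \<in> W \<Longrightarrow> transpose A = - A \<Longrightarrow> quad (matrix_bracket A S) \<in> W"
  shows "quad S \<in> W"
proof (rule quad_generation[OF W])
  define u v e :: "complex^('n + bool)" where "u = mk 0 2 0" and "v = mk 0 0 2" and "e = mk (axis undefined 1) 0 0"
  have dots: "dot u u = 0" "dot u v = 2" "dot v u = 2" "dot v v = 0" "dot u e = 0" "dot e u = 0"
    "dot v e = 0" "dot e v = 0" "dot e e = 1"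
    using Delta_axis[of "undefined :: 'n"]
    by (simp_all add: u_def v_def e_def dot_ext mk_sel dot_simps Delta_eq_dot)
  \<comment> \<open>A skew raising operator: it sends v to 2 e, e to -u and u to 0.\<close>
  define A where "A = outer e u - outer u e"
  have A: "transpose A = - A"
    by (simp add: A_def outer_def transpose_def vec_eq_iff)
  have Av: "A *v v = 2 *s e" and Ae: "A *v e = - u" and Au: "A *v u = 0"
    by (simp_all add: A_def matrix_mult_left_linear outer_apply dots)
  have deriv_mem: "(\<lambda>z. quad (outer (A *v x) y) z + quad (outer x (A *v y)) z) \<in> W"
    if "quad (outer x y) \<in> W" for x y
    using closed[OF that A] by (simp add: quad_bracket_outer[OF A, abs_def])
  have unscale: "f \<in> W" if "(\<lambda>z. c * f z) \<in> W" "c \<noteq> 0" for c f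
    using fs.subspace_scale[OF W that(1), of "inverse c"] that(2) by (simp flip: mult.assoc)
  have sym: "quad (outer x y) z = quad (outer y x) z" for x y z
    by (simp add: quad_outer)
  have "quad (outer v v) \<in> W"
    using F by (simp add: F_elem_eq v_def)
  from deriv_mem[OF this] have 1: "quad (outer e v) \<in> W"
    by - (rule unscale[of 4], simp_all add: Av outer_linear quad_linear sym[of v e])
  \<comment> \<open>In the middle weight the image is a combination of two products. Both are raised
    to multiples of u e, with coefficients -4 and -2.\<close>
  let ?T = "matrix_scale 2 (outer e e) - outer u v"
  from deriv_mem[OF 1] have "quad ?T \<in> W"
    by (simp add: Av Ae outer_linear quad_linear[abs_def] algebra_simps)
  then have "quad (matrix_bracket A ?T) \<in> W"
    using A by (rule closed)
  moreover have "quad (matrix_bracket A ?T) = (\<lambda>z. - 6 * quad (outer u e) z)"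
  proof
    fix z
    have "matrix_bracket A ?T = matrix_scale 2 (matrix_bracket A (outer e e)) - matrix_bracket A (outer u v)"
      by (simp add: matrix_bracket_def matrix_mult_add matrix_scale_mult matrix_scale_linear)
    then show "quad (matrix_bracket A ?T) z = - 6 * quad (outer u e) z"
      by (simp add: quad_linear quad_bracket_outer[OF A] Ae Av Au outer_linear sym[of e u])
  qed
  ultimately have 2: "quad (outer u e) \<in> W"
    by - (rule unscale[of "- 6"], simp_all only:, simp)
  from deriv_mem[OF 2] show "quad (outer (mk 0 2 0) (mk 0 2 0)) \<in> W"
    unfolding u_def[symmetric] by - (rule unscale[of "- 1"], simp_all add: Au Ae outer_linear quad_linear)
qed (simp add: closed shift_mat_skew)

text \<open>Two brackets agree as soon as one argument lies in k, so their difference on p is an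
  equivariant bilinear map that vanishes at (E, F). Infinitesimal translations kill F and generate p
  from E, so the difference vanishes whenever its second argument is F. Since k generates p from F,
  it vanishes altogether.\<close>

lemma is_g_bracket_unique:
  fixes br br' :: "'n::finite gspace \<Rightarrow> 'n gspace \<Rightarrow> 'n gspace"
  assumes br: "is_g_bracket br" and br': "is_g_bracket br'" and xy: "x \<in> lie_g" "y \<in> lie_g"
  shows "br x y = br' x y"
proof -
  interpret L: lie_algebra_on g_scale lie_g br
    using br by (simp add: is_g_bracket_def)
  interpret L': lie_algebra_on g_scale lie_g br'
    using br' by (simp add: is_g_bracket_def)
  note sub = L.subspace_carrier
  have mem: "X \<in> lie_k \<Longrightarrow> (X, 0) \<in> lie_g" "f \<in> space_p \<Longrightarrow> (0, f) \<in> lie_g" for X :: "complex^'n \<Rightarrow> complex^'n" and f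
    by (simp_all add: lie_g_def zero_in_lie_k zero_in_space_p)
  have split: "w = (fst w, 0) + (0, snd w)" for w :: "'n gspace"
    by simp
  have parts: "fst w \<in> lie_k" "snd w \<in> space_p" if "w \<in> lie_g" for w
    using that by (auto simp: lie_g_def)
  have kk: "br (X, 0) (Y, 0) = br' (X, 0) (Y, 0)" if "X \<in> lie_k" "Y \<in> lie_k" for X Y
    using br br' that by (simp add: is_g_bracket_def)
  have kp: "br (X, 0) (0, f) = (0, d_kappa X f)" "br' (X, 0) (0, f) = (0, d_kappa X f)"
    if "X \<in> lie_k" "f \<in> space_p" for X f
    using br br' that by (simp_all add: is_g_bracket_def)
  have kg: "br (X, 0) w = br' (X, 0) w" if "X \<in> lie_k" "w \<in> lie_g" for X w
    by (subst (1 2) split[of w])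
       (simp only: L.bracket_add_right L'.bracket_add_right mem parts that kk kp)
  define D where "D f g = br (0, f) (0, g) - br' (0, f) (0, g)" for f g
  have D_mem: "D f g \<in> lie_g" if "f \<in> space_p" "g \<in> space_p" for f g
    unfolding D_def using that by (intro L.subspace_diff[OF sub] L.bracket_closed L'.bracket_closed mem)
  have D_equiv: "D (d_kappa X f) g + D f (d_kappa X g) = br (X, 0) (D f g)"
    if "X \<in> lie_k" "f \<in> space_p" "g \<in> space_p" for X f g
  proof -
    have "br (X, 0) (br (0, f) (0, g)) = br (0, d_kappa X f) (0, g) + br (0, f) (0, d_kappa X g)"
      using L.bracket_derivation[OF mem(1)[OF that(1)] mem(2)[OF that(2)] mem(2)[OF that(3)]] that
      by (simp add: kp)
    moreover have "br' (X, 0) (br' (0, f) (0, g)) = br' (0, d_kappa X f) (0, g) + br' (0, f) (0, d_kappa X g)"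
      using L'.bracket_derivation[OF mem(1)[OF that(1)] mem(2)[OF that(2)] mem(2)[OF that(3)]] that
      by (simp add: kp)
    moreover have "br (X, 0) (D f g) = br (X, 0) (br (0, f) (0, g)) - br' (X, 0) (br' (0, f) (0, g))"
    proof -
      have "br (X, 0) (br (0, f) (0, g)) = br (X, 0) (D f g + br' (0, f) (0, g))"
        by (simp add: D_def)
      also have "\<dots> = br (X, 0) (D f g) + br (X, 0) (br' (0, f) (0, g))"
        using that by (intro L.bracket_add_right D_mem mem L'.bracket_closed)
      also have "br (X, 0) (br' (0, f) (0, g)) = br' (X, 0) (br' (0, f) (0, g))"
        using that by (intro kg mem L'.bracket_closed)
      finally show ?thesis by (simp only: add_diff_cancel_right')
    qed
    ultimately show ?thesis
      by (simp add: D_def)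
  qed
  have zero_right: "br (X, 0) 0 = 0" if "X \<in> lie_k" for X
    using L.bracket_scale_right[OF mem(1)[OF that] L.subspace_0[OF sub], of 0] by simp
  have pair: "(0 :: complex^'n \<Rightarrow> complex^'n, f + g) = (0, f) + (0, g)" "(0 :: complex^'n \<Rightarrow> complex^'n, \<lambda>z. c * f z) = g_scale c (0, f)"
    for f g :: "complex^'n \<Rightarrow> complex" and c
    by (simp_all add: g_scale_def fun_eq_iff)
  have D_lin: "D (f + f') g = D f g + D f' g" "D f (g + g') = D f g + D f g'"
    "D (\<lambda>z. c * f z) g = g_scale c (D f g)" "D f (\<lambda>z. c * g z) = g_scale c (D f g)"
    if "f \<in> space_p" "g \<in> space_p" "f' \<in> space_p" "g' \<in> space_p" for f f' g g' c
    using that unfolding D_def pair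
    by (simp_all add: mem L.bracket_add_left L.bracket_add_right L'.bracket_add_left L'.bracket_add_right
        L.bracket_scale_left L.bracket_scale_right L'.bracket_scale_left L'.bracket_scale_right
        L.scale_right_diff_distrib del: add_Pair)
  have D_zero: "D 0 g = 0" "D g 0 = 0" if "g \<in> space_p" for g
    using D_lin(1)[of 0 g 0 g] D_lin(2)[of g 0 g 0] that zero_in_space_p by simp_all
  have F_mem: "F_elem \<in> space_p" and E_mem: "E_elem \<in> space_p"
    by (auto simp: F_elem_eq E_elem_eq space_p_eq)
  note sp = fs.subspace_add[OF subspace_space_p] fs.subspace_scale[OF subspace_space_p] zero_in_space_p
  have field: "inf_field A \<in> lie_k" if "transpose A = - A" for A
    using that by (auto simp: lie_k_eq)
  have D_F: "f \<in> {f \<in> space_p. D f F_elem = 0}" if "f \<in> space_p" for f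
  proof -
    from that obtain S where S: "f = quad S" by (auto simp: space_p_eq)
    have "quad S \<in> {f \<in> space_p. D f F_elem = 0}"
    proof (rule quad_generation)
      show "fs.subspace {f \<in> space_p. D f F_elem = 0}"
        by (rule fs.subspaceI) (auto simp: sp D_zero D_lin F_mem)
      have "D E_elem F_elem = 0"
        using br br' by (simp add: D_def is_g_bracket_def)
      then show "quad (outer (mk 0 2 0) (mk 0 2 0)) \<in> {f \<in> space_p. D f F_elem = 0}"
        using E_mem by (simp add: E_elem_eq)
      fix S and d :: "complex^'n"
      assume *: "quad S \<in> {f \<in> space_p. D f F_elem = 0}"
      let ?X = "inf_field (shift_mat d)"
      have X: "?X \<in> lie_k"
        by (intro field shift_mat_skew)
      have "shift_mat d *v mk 0 0 2 = 0"
        by (rule mk_eqI) (simp_all add: shift_mat_apply mk_sel sel_linear dot_simps)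
      then have "d_kappa ?X F_elem = 0"
        unfolding F_elem_eq d_kappa_inf_field[OF shift_mat_skew]
        by (simp add: fun_eq_iff quad_bracket_outer[OF shift_mat_skew] outer_linear quad_linear)
      then have "D (quad (matrix_bracket (shift_mat d) S)) F_elem = 0"
        using D_equiv[OF X _ F_mem, of "quad S"] *
        by (simp add: d_kappa_inf_field[OF shift_mat_skew] D_zero zero_right[OF X])
      then show "quad (matrix_bracket (shift_mat d) S) \<in> {f \<in> space_p. D f F_elem = 0}"
        by (simp add: space_p_eq)
    qed
    then show ?thesis by (simp only: S)
  qed
  have D_0: "D f g = 0" if "f \<in> space_p" "g \<in> space_p" for f g
  proof -
    from that obtain S where S: "g = quad S" by (auto simp: space_p_eq)
    have "quad S \<in> {g \<in> space_p. \<forall>f\<in>space_p. D f g = 0}"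
    proof (rule quad_invariant_subspace)
      show "fs.subspace {g \<in> space_p. \<forall>f\<in>space_p. D f g = 0}"
        by (rule fs.subspaceI) (auto simp: sp D_zero D_lin)
      show "F_elem \<in> {g \<in> space_p. \<forall>f\<in>space_p. D f g = 0}"
        using D_F F_mem by simp
      fix S and A :: "complex^('n + bool)^('n + bool)"
      assume *: "quad S \<in> {g \<in> space_p. \<forall>f\<in>space_p. D f g = 0}" and A: "transpose A = - A"
      have "D f (quad (matrix_bracket A S)) = 0" if "f \<in> space_p" for f
      proof -
        have "d_kappa (inf_field A) f \<in> space_p"
          using that by (auto simp: space_p_eq d_kappa_inf_field[OF A])
        then show ?thesis
          using D_equiv[OF field[OF A] that, of "quad S"] * that
          by (simp add: d_kappa_inf_field[OF A] zero_right[OF field[OF A]])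
      qed
      then show "quad (matrix_bracket A S) \<in> {g \<in> space_p. \<forall>f\<in>space_p. D f g = 0}"
        by (simp add: space_p_eq)
    qed
    then show ?thesis
      using that S by simp
  qed
  have pp: "br (0, f) (0, g) = br' (0, f) (0, g)" if "f \<in> space_p" "g \<in> space_p" for f g
    using D_0[OF that] by (simp add: D_def)
  have pk: "br (0, f) (X, 0) = br' (0, f) (X, 0)" if "X \<in> lie_k" "f \<in> space_p" for X f
    using that by (simp add: L.bracket_antisym[of "(0, f)"] L'.bracket_antisym[of "(0, f)"] mem kp)
  have pg: "br (0, f) w = br' (0, f) w" if "f \<in> space_p" "w \<in> lie_g" for f w
    by (subst (1 2) split[of w])
       (simp only: L.bracket_add_right L'.bracket_add_right mem parts that pp pk)
  show ?thesis
    by (subst (1 2) split[of x])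
       (simp only: L.bracket_add_left L'.bracket_add_left mem parts xy kg pg)
qed

section \<open>The isomorphism\<close>

definition skew_part :: "complex^'k^'k \<Rightarrow> complex^'k^'k" where
  "skew_part M = matrix_scale (1 / 2) (M - transpose M)"

lemma skew_part_skew: "transpose (skew_part M) = - skew_part M"
  by (simp add: skew_part_def matrix_scale_def transpose_def vec_eq_iff algebra_simps)

lemma skew_part_linear: "skew_part (M + N) = skew_part M + skew_part N"
    "skew_part (M - N) = skew_part M - skew_part N"
    "skew_part (matrix_scale c M) = matrix_scale c (skew_part M)"
  by (simp_all add: skew_part_def matrix_scale_def transpose_def vec_eq_iff field_simps)

lemma skew_part_of_skew: "transpose A = - A \<Longrightarrow> skew_part A = A"
  by (simp add: skew_part_def) (simp add: matrix_scale_def vec_eq_iff)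

lemma skew_part_of_sym: "transpose S = S \<Longrightarrow> skew_part S = 0"
  by (simp add: skew_part_def) (simp add: matrix_scale_def vec_eq_iff)

lemma skew_part_eq_0D: "skew_part M = 0 \<Longrightarrow> transpose M = M"
  by (simp add: skew_part_def matrix_scale_def transpose_def vec_eq_iff)

lemma transpose_linear: "transpose (A + B) = transpose A + transpose B"
    "transpose (A - B) = transpose A - transpose B" "transpose (matrix_scale c A) = matrix_scale c (transpose A)"
  by (simp_all add: matrix_scale_def transpose_def vec_eq_iff)

text \<open>The components see complementary parts of the matrix: \<open>skew_part\<close> drops the
  symmetric part and \<open>quad\<close> the skew part. The factor 2 assigns the polynomial
  \<open>quad S\<close> to half of S, as the normalisation of [E, F] requires.\<close>

definition Phi :: "complex^('n::finite + bool)^('n + bool) \<Rightarrow> 'n gspace" where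
  "Phi M = (inf_field (skew_part M), quad (matrix_scale 2 M))"

lemma Phi_linear: "Phi (M + N) = Phi M + Phi N" "Phi (matrix_scale c M) = g_scale c (Phi M)"
  by (simp_all add: Phi_def g_scale_def fun_eq_iff skew_part_linear inf_field_linear quad_linear
      distrib_left mult.left_commute)

lemma quad_skew: "transpose A = - A \<Longrightarrow> quad A z = 0"
  using quad_transpose[of A z] by (simp add: quad_linear)

lemma inf_field_zero: "inf_field 0 = 0"
  by (simp add: fun_eq_iff inf_field_def matrix_mult_left_linear sel_linear)

lemma Phi_skew: "transpose A = - A \<Longrightarrow> Phi A = (inf_field A, 0)"
  by (simp add: Phi_def skew_part_of_skew fun_eq_iff quad_linear quad_skew)

lemma Phi_sym: "transpose S = S \<Longrightarrow> Phi S = (0, quad (matrix_scale 2 S))"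
  by (simp add: Phi_def skew_part_of_sym inf_field_zero)

lemma Phi_combine:
  assumes "transpose A = - A" "transpose S = S"
  shows "Phi (A + matrix_scale (1 / 2) S) = (inf_field A, quad S)"
  using assms by (simp add: Phi_linear Phi_skew Phi_sym matrix_scale_linear g_scale_def)
     (simp add: fun_eq_iff quad_linear)

lemma trace_skew: "transpose A = - A \<Longrightarrow> trace A = 0" for A :: "complex^'k^'k"
  using trace_linear(2)[of A] trace_linear(3)[of A] by simp

lemma inj_on_Phi: "inj_on Phi special_linear_algebra"
proof (rule inj_onI)
  fix M N :: "complex^('n::finite + bool)^('n + bool)"
  assume tr: "M \<in> special_linear_algebra" "N \<in> special_linear_algebra" and eq: "Phi M = Phi N"
  have "skew_part M = skew_part N"
    by (rule inf_field_inject[OF skew_part_skew skew_part_skew]) (use eq in \<open>simp add: Phi_def\<close>)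
  then have sym: "transpose (M - N) = M - N"
    by (intro skew_part_eq_0D) (simp add: skew_part_linear)
  have "quad (matrix_scale 2 M) z = quad (matrix_scale 2 N) z" for z
    using eq by (simp add: Phi_def)
  then have "quad (M - N) z = 0" for z
    by (simp add: quad_linear)
  with sym have "M - N = 0"
    using tr by (intro quad_eq_0) (simp_all add: special_linear_algebra_def trace_sub)
  then show "M = N" by simp
qed

lemma Phi_image: "Phi ` special_linear_algebra = lie_g"
proof (intro equalityI subsetI)
  fix x :: "'n::finite gspace" assume "x \<in> lie_g"
  then obtain A S where AS: "x = (inf_field A, quad S)" "transpose A = - A" "transpose S = S" "trace S = 0"
    by (auto simp: lie_g_def lie_k_eq space_p_eq_traceless)
  then show "x \<in> Phi ` special_linear_algebra"
    by (intro image_eqI[of _ _ "A + matrix_scale (1 / 2) S"])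
       (simp_all add: Phi_combine special_linear_algebra_def trace_add trace_linear trace_skew)
next
  fix x :: "'n::finite gspace" assume "x \<in> Phi ` special_linear_algebra"
  then show "x \<in> lie_g"
    using skew_part_skew by (auto simp: Phi_def lie_g_def lie_k_eq space_p_eq)
qed

lemma bij_betw_Phi: "bij_betw Phi special_linear_algebra lie_g"
  by (simp add: bij_betw_def inj_on_Phi Phi_image)

lemma bracket_transpose: "transpose (matrix_bracket A B) = matrix_bracket (transpose B) (transpose A)"
  by (simp add: matrix_bracket_def transpose_linear matrix_transpose_mul)

lemma matrix_bracket_minus:
  fixes A B :: "'k::field^'m::finite^'m"
  shows "matrix_bracket (- A) B = - matrix_bracket A B" "matrix_bracket A (- B) = - matrix_bracket A B"
  by (simp_all add: matrix_bracket_def matrix_matrix_mult_def vec_eq_iff sum_negf)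

lemma matrix_bracket_swap: "matrix_bracket B A = - matrix_bracket A B"
  by (simp add: matrix_bracket_def)

lemma matrix_bracket_scale: "matrix_bracket A (matrix_scale c B) = matrix_scale c (matrix_bracket A B)"
  by (simp add: matrix_bracket_def matrix_scale_mult matrix_scale_linear)

lemma Phi_bracket_skew_skew:
  assumes "transpose A = - A" "transpose B = - B"
  shows "Phi (matrix_bracket A B) = (field_bracket (inf_field A) (inf_field B), 0)"
proof -
  have "transpose (matrix_bracket A B) = - matrix_bracket A B"
    by (simp add: bracket_transpose assms matrix_bracket_minus) (rule matrix_bracket_swap)
  then show ?thesis
    using assms by (simp add: Phi_skew field_bracket_inf_field)
qed

lemma Phi_bracket_skew_sym:
  assumes "transpose A = - A" "transpose S = S"
  shows "Phi (matrix_bracket A (matrix_scale (1 / 2) S)) = (0, d_kappa (inf_field A) (quad S))"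
proof -
  have "transpose (matrix_bracket A S) = matrix_bracket A S"
    by (simp add: bracket_transpose assms matrix_bracket_minus matrix_bracket_swap[of S A])
  then show ?thesis
    by (simp add: matrix_bracket_scale Phi_sym transpose_linear matrix_scale_linear d_kappa_inf_field[OF assms(1)])
qed

lemma H_elem_eq: "H_elem z = - z"
proof -
  have "((\<lambda>t. exp (- t) *\<^sub>R z) has_vector_derivative (- 1) *\<^sub>R z) (at (0 :: real))"
    by (auto intro!: derivative_eq_intros simp: has_vector_derivative_def)
  then show ?thesis
    by (simp add: H_elem_def vector_derivative_at)
qed

text \<open>This computation fixes the scale. As \<open>dot u v\<close> is 2, the commutator of the
  two rank-one matrices is twice the difference of \<open>outer u v\<close> and
  \<open>outer v u\<close>; the two factors 1/2 leave half of that difference, whose vector field is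
  -z.\<close>

lemma Phi_bracket_E_F:
  "Phi (matrix_bracket (matrix_scale (1 / 2) (outer (mk 0 2 0) (mk 0 2 0)))
     (matrix_scale (1 / 2) (outer (mk 0 0 2) (mk 0 0 2)))) = (H_elem :: complex^'n::finite \<Rightarrow> _, 0)"
    (is "Phi ?M = _")
proof -
  define u v :: "complex^('n + bool)" where "u = mk 0 2 0" and "v = mk 0 0 2"
  define A where "A = matrix_scale (1 / 2) (outer u v - outer v u)"
  have dots: "dot u v = 2" "dot v u = 2"
    by (simp_all add: u_def v_def dot_ext mk_sel dot_simps)
  have "?M = A"
    by (simp add: A_def matrix_bracket_def matrix_scale_mult outer_mult dots matrix_scale_linear flip: u_def v_def)
  moreover have "transpose A = - A"
    by (simp add: A_def transpose_def matrix_scale_def outer_def vec_eq_iff field_simps)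
  moreover have "inf_field A = H_elem"
  proof
    fix z
    have "A *v psi z = mk 0 1 (Delta z)"
      by (simp add: A_def matrix_mult_left_linear outer_apply u_def v_def dot_ext mk_sel psi_sel dot_simps mk_linear)
    then show "inf_field A z = H_elem z"
      by (simp add: inf_field_def mk_sel H_elem_eq)
  qed
  ultimately show ?thesis
    by (simp add: Phi_skew)
qed

text \<open>The bracket transported from the traceless matrices satisfies the three conditions, so
  the choice in \<open>g_bracket\<close> is not void; uniqueness then identifies the chosen bracket
  with it on \<open>lie_g\<close>.\<close>

lemma g_bracket_Phi:
  fixes M N :: "complex^('n::finite + bool)^('n + bool)"
  assumes "M \<in> special_linear_algebra" "N \<in> special_linear_algebra"
  shows "g_bracket (Phi M) (Phi N) = Phi (matrix_bracket M N)"
proof -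
  let ?sl = "special_linear_algebra :: (complex^('n + bool)^('n + bool)) set"
  let ?inv = "inv_into ?sl Phi"
  define br where "br x y = Phi (matrix_bracket (?inv x) (?inv y))" for x y :: "'n gspace"
  have br: "br (Phi M) (Phi N) = Phi (matrix_bracket M N)" if "M \<in> ?sl" "N \<in> ?sl" for M N
    using that by (simp add: br_def inv_into_f_f[OF inj_on_Phi])
  have sl: "A \<in> ?sl" if "transpose A = - A" for A
    using that by (simp add: special_linear_algebra_def trace_skew)
  have "is_g_bracket br"
    unfolding is_g_bracket_def
  proof (intro conjI ballI)
    show "lie_algebra_on g_scale lie_g br"
      using lie_algebra_iso_inverse[OF lie_algebra_special_linear vector_space_g_scale bij_betw_Phi, of br]
      by (simp add: Phi_linear br lie_algebra_iso_def)
    fix X :: "complex^'n \<Rightarrow> complex^'n" assume "X \<in> lie_k"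
    then obtain A where A: "X = inf_field A" "transpose A = - A" by (auto simp: lie_k_eq)
    {
      fix Y :: "complex^'n \<Rightarrow> complex^'n" assume "Y \<in> lie_k"
      then obtain B where B: "Y = inf_field B" "transpose B = - B" by (auto simp: lie_k_eq)
      show "br (X, 0) (Y, 0) = (field_bracket X Y, 0)"
        using br[OF sl[OF A(2)] sl[OF B(2)]] A B by (simp add: Phi_skew Phi_bracket_skew_skew)
    }
    fix f :: "complex^'n \<Rightarrow> complex" assume "f \<in> space_p"
    then obtain S where S: "f = quad S" "transpose S = S" "trace S = 0" by (auto simp: space_p_eq_traceless)
    have "br (Phi A) (Phi (matrix_scale (1 / 2) S)) = (0, d_kappa X f)"
      using br[OF sl[OF A(2)], of "matrix_scale (1 / 2) S"] A S
      by (simp add: Phi_bracket_skew_sym special_linear_algebra_def trace_linear)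
    then show "br (X, 0) (0, f) = (0, d_kappa X f)"
      using A S by (simp add: Phi_skew Phi_sym transpose_linear matrix_scale_linear)
  next
    have "Phi (matrix_scale (1 / 2) (outer x x)) = (0, quad (outer x x))" for x :: "complex^('n + bool)"
    proof -
      have "transpose (outer x x) = outer x x"
        by (simp add: outer_def transpose_def vec_eq_iff)
      then show ?thesis
        by (simp add: Phi_sym transpose_linear matrix_scale_linear)
    qed
    \<comment> \<open>E and F come from isotropic vectors, so their matrices are already traceless:
      the trace of \<open>outer x x\<close> is \<open>dot x x\<close>.\<close>
    moreover have "matrix_scale (1 / 2) (outer x x) \<in> ?sl" if "dot x x = 0" for x
      using that by (simp add: special_linear_algebra_def trace_linear) (simp add: trace_def outer_def dot_def)
    ultimately show "br (0, E_elem) (0, F_elem) = (H_elem, 0)"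
      using br[of "matrix_scale (1 / 2) (outer (mk 0 2 0) (mk 0 2 0))" "matrix_scale (1 / 2) (outer (mk 0 0 2) (mk 0 0 2))"]
      by (simp add: E_elem_eq F_elem_eq Phi_bracket_E_F dot_ext mk_sel dot_simps)
  qed
  moreover from this have "is_g_bracket (g_bracket :: 'n gspace \<Rightarrow> _)"
    unfolding g_bracket_def by (rule someI[where P = is_g_bracket])
  moreover have "Phi M \<in> lie_g" "Phi N \<in> lie_g"
    using assms by (simp_all flip: Phi_image)
  ultimately show ?thesis
    using is_g_bracket_unique br[OF assms] by metis
qed

lemma mat_cnj_linear: "mat_cnj (A + B) = mat_cnj A + mat_cnj B" "mat_cnj (A - B) = mat_cnj A - mat_cnj B"
  "mat_cnj (matrix_scale c A) = matrix_scale (cnj c) (mat_cnj A)"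
  by (simp_all add: mat_cnj_def matrix_scale_def vec_eq_iff)

text \<open>Taking skew and symmetric parts and scaling by the real factor 1/2 commute with
  entrywise conjugation, so the decomposition respects real matrices.\<close>

lemma Phi_image_real:
  "Phi ` {M \<in> special_linear_algebra. mat_cnj M = M} = lie_g_R"
proof (intro equalityI subsetI)
  fix x :: "'n::finite gspace" assume "x \<in> lie_g_R"
  then obtain A S where "x = (inf_field A, quad S)" "transpose A = - A" "mat_cnj A = A"
    "transpose S = S" "trace S = 0" "mat_cnj S = S"
    by (auto simp: lie_g_R_def lie_k_R_eq space_p_R_eq)
  then show "x \<in> Phi ` {M \<in> special_linear_algebra. mat_cnj M = M}"
    by (intro image_eqI[of _ _ "A + matrix_scale (1 / 2) S"])
       (simp_all add: Phi_combine special_linear_algebra_def trace_add trace_linear trace_skew mat_cnj_linear)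
next
  fix x :: "'n::finite gspace" assume "x \<in> Phi ` {M \<in> special_linear_algebra. mat_cnj M = M}"
  then obtain M where M: "x = Phi M" "trace M = 0" "mat_cnj M = M"
    by (auto simp: special_linear_algebra_def)
  have "quad (matrix_scale 2 M) = quad (M + transpose M)"
    by (rule ext) (simp add: quad_linear quad_transpose)
  moreover have "transpose (M + transpose M) = M + transpose M"
    by (simp add: transpose_linear add.commute)
  moreover have "mat_cnj (skew_part M) = skew_part M"
    using M(3) by (simp add: skew_part_def mat_cnj_linear mat_cnj_transpose)
  ultimately show "x \<in> lie_g_R"
    using M skew_part_skew[of M]
    by (auto simp: Phi_def lie_g_R_def lie_k_R_eq space_p_R_eq trace_add trace_linear mat_cnj_linear mat_cnj_transpose)
qed

lemma Phi_image_skew: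
  "Phi ` {A. transpose A = - A} = lie_k \<times> {0}"
  "Phi ` {A. transpose A = - A \<and> mat_cnj A = A} = lie_k_R \<times> {0}"
  by (auto simp: Phi_skew lie_k_eq lie_k_R_eq image_iff)

section \<open>Transport to an arbitrary index set and to real entries\<close>

definition reindex :: "('k \<Rightarrow> 'm) \<Rightarrow> 'a^'m^'m \<Rightarrow> 'a^'k^'k" where
  "reindex h M = (\<chi> i j. M $ h i $ h j)"

lemma reindex_linear: "reindex h (M + N) = reindex h M + reindex h N"
  "reindex h (M - N) = reindex h M - reindex h N"
  "reindex h (matrix_scale c L) = matrix_scale c (reindex h L)"
  by (simp_all add: reindex_def matrix_scale_def vec_eq_iff)

lemma reindex_mult:
  fixes h :: "'k::finite \<Rightarrow> 'm::finite" and M N :: "'a::field^'m^'m"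
  assumes "bij h"
  shows "reindex h (M ** N) = reindex h M ** reindex h N"
  by (simp add: reindex_def matrix_matrix_mult_def vec_eq_iff
      sum.reindex_bij_betw[OF assms, of "\<lambda>k. M $ _ $ k * N $ k $ _"])

lemma reindex_trace:
  fixes h :: "'k::finite \<Rightarrow> 'm::finite"
  assumes "bij h"
  shows "trace (reindex h M) = trace M"
  by (simp add: reindex_def trace_def sum.reindex_bij_betw[OF assms, of "\<lambda>k. M $ k $ k"])

lemma reindex_reindex: "reindex g (reindex h M) = reindex (h \<circ> g) M"
  by (simp add: reindex_def vec_eq_iff)

lemma reindex_id: "reindex id M = M"
  by (simp add: reindex_def vec_eq_iff)

lemma reindex_bij_betw:
  fixes h :: "'k::finite \<Rightarrow> 'm::finite"
  assumes h: "bij h" and P: "\<And>M. P M \<longleftrightarrow> P' (reindex h M)"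
  shows "bij_betw (reindex h) {M. P M} {M. P' M}"
proof (rule bij_betw_byWitness[where f' = "reindex (inv h)"])
  have inv: "reindex (inv h) (reindex h M) = M" "reindex h (reindex (inv h) N) = N" for M :: "'a^'m^'m" and N :: "'a^'k^'k"
    using bij_is_surj[OF h] bij_is_inj[OF h] by (simp_all add: reindex_reindex reindex_id surj_iff inj_iff)
  then show "\<forall>M\<in>{M. P M}. reindex (inv h) (reindex h M) = M" "\<forall>N\<in>{M. P' M}. reindex h (reindex (inv h) N) = N"
    by simp_all
  show "reindex h ` {M. P M} \<subseteq> {M. P' M}" "reindex (inv h) ` {M. P' M} \<subseteq> {M. P M}"
    using P inv by auto
qed

definition complexify :: "real^'m^'m \<Rightarrow> complex^'m^'m" where
  "complexify M = (\<chi> i j. complex_of_real (M $ i $ j))"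

lemma complexify_linear: "complexify (M + N) = complexify M + complexify N"
  "complexify (M - N) = complexify M - complexify N" "complexify (- M) = - complexify M"
  "complexify (matrix_scale c M) = matrix_scale (complex_of_real c) (complexify M)"
  "complexify (transpose M) = transpose (complexify M)"
  by (simp_all add: complexify_def matrix_scale_def transpose_def vec_eq_iff)

lemma complexify_mult: "complexify (M ** N) = complexify M ** complexify N"
  by (simp add: complexify_def matrix_matrix_mult_def vec_eq_iff)

lemma complexify_trace: "trace (complexify M) = complex_of_real (trace M)"
  by (simp add: complexify_def trace_def)

lemma complexify_inj: "complexify M = complexify N \<longleftrightarrow> M = N"
  by (simp add: complexify_def vec_eq_iff)

lemma mat_cnj_eq_iff: "mat_cnj M = M \<longleftrightarrow> M \<in> range complexify"
proof
  assume "mat_cnj M = M"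
  then have "complexify (\<chi> i j. Re (M $ i $ j)) = M"
    by (simp add: complexify_def mat_cnj_def vec_eq_iff complex_eq_iff)
  then show "M \<in> range complexify" by (metis rangeI)
qed (auto simp: mat_cnj_def complexify_def vec_eq_iff)

lemma complexify_bij_betw:
  assumes "\<And>M. P M \<longleftrightarrow> P' (complexify M)"
  shows "bij_betw complexify {M. P M} {M. P' M \<and> mat_cnj M = M}"
  using assms by (auto simp: bij_betw_def inj_on_def complexify_inj mat_cnj_eq_iff)

theorem theorem3p1:
  assumes "CARD('n::finite) \<ge> 3"
    and "CARD('m::finite) = CARD('n) + 2"
  shows
    "(\<exists>\<phi> :: 'n gspace \<Rightarrow> complex^'m^'m.
        lie_algebra_iso g_scale lie_g g_bracket
          matrix_scale special_linear_algebra matrix_bracket \<phi> \<and>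
        \<phi> ` (lie_k \<times> {0}) = orthogonal_algebra) \<and>
     (\<exists>\<psi> :: 'n gspace \<Rightarrow> real^'m^'m.
        lie_algebra_iso (\<lambda>r. g_scale (complex_of_real r)) lie_g_R g_bracket
          matrix_scale special_linear_algebra matrix_bracket \<psi> \<and>
        \<psi> ` (lie_k_R \<times> {0}) = orthogonal_algebra)"
proof -
  \<comment> \<open>The model is indexed by \<open>'n + bool\<close>, the statement by any type with
    two more elements than \<open>'n\<close>; a bijection reconciles them.\<close>
  have "card (UNIV :: ('n + bool) set) = card (UNIV :: 'm set)"
    using assms(2) by simp
  then obtain h :: "'n + bool \<Rightarrow> 'm" where h: "bij h"
    using finite_same_card_bij[of "UNIV :: ('n + bool) set" "UNIV :: 'm set"] by auto
  have reindex_transpose: "transpose (reindex h M) = - reindex h M \<longleftrightarrow> transpose M = - M" for M :: "complex^'m^'m"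
  proof -
    have "transpose (reindex h M) = - reindex h M \<longleftrightarrow> (\<forall>i j. M $ h j $ h i = - M $ h i $ h j)"
      by (simp add: reindex_def transpose_def vec_eq_iff)
    also have "\<dots> \<longleftrightarrow> (\<forall>i j. M $ j $ i = - M $ i $ j)"
      using h by (metis bij_pointE)
    finally show ?thesis
      by (simp add: transpose_def vec_eq_iff)
  qed
  have reindex_cnj: "mat_cnj (reindex h M) = reindex h M \<longleftrightarrow> mat_cnj M = M" for M :: "complex^'m^'m"
  proof -
    have "mat_cnj (reindex h M) = reindex h M \<longleftrightarrow> (\<forall>i j. cnj (M $ h i $ h j) = M $ h i $ h j)"
      by (simp add: reindex_def mat_cnj_def vec_eq_iff)
    also have "\<dots> \<longleftrightarrow> (\<forall>i j. cnj (M $ i $ j) = M $ i $ j)"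
      using h by (metis bij_pointE)
    finally show ?thesis
      by (simp add: mat_cnj_def vec_eq_iff)
  qed
  \<comment> \<open>This map runs from matrices to g; the required isomorphism is its
    inverse.\<close>
  define \<Phi> :: "complex^'m^'m \<Rightarrow> 'n gspace" where "\<Phi> M = Phi (reindex h M)" for M
  have \<Phi>_linear: "\<Phi> (M + N) = \<Phi> M + \<Phi> N" "\<Phi> (matrix_scale c M) = g_scale c (\<Phi> M)" for M N c
    by (simp_all add: \<Phi>_def reindex_linear Phi_linear)
  have \<Phi>_bracket: "g_bracket (\<Phi> M) (\<Phi> N) = \<Phi> (matrix_bracket M N)" if "trace M = 0" "trace N = 0" for M N
    using that g_bracket_Phi[of "reindex h M" "reindex h N"]
    by (simp add: \<Phi>_def matrix_bracket_def reindex_linear reindex_mult[OF h] special_linear_algebra_def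
        reindex_trace[OF h])
  have bij: "bij_betw \<Phi> special_linear_algebra lie_g"
  proof -
    have "bij_betw (Phi \<circ> reindex h) special_linear_algebra lie_g"
    proof (rule bij_betw_trans[OF _ bij_betw_Phi])
      show "bij_betw (reindex h) special_linear_algebra special_linear_algebra"
        unfolding special_linear_algebra_def by (rule reindex_bij_betw[OF h]) (simp add: reindex_trace[OF h])
    qed
    then show ?thesis
      by (simp add: \<Phi>_def[abs_def] comp_def)
  qed
  have skew_sl: "orthogonal_algebra \<subseteq> (special_linear_algebra :: (complex^'m^'m) set)"
    by (auto simp: orthogonal_algebra_def special_linear_algebra_def trace_skew)
  have \<Phi>_orth: "\<Phi> ` orthogonal_algebra = lie_k \<times> {0}"
  proof -
    have "bij_betw (reindex h) {A :: complex^'m^'m. transpose A = - A} {A. transpose A = - A}"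
      by (rule reindex_bij_betw[OF h]) (simp add: reindex_transpose)
    then have "reindex h ` (orthogonal_algebra :: (complex^'m^'m) set) = {A. transpose A = - A}"
      by (simp add: bij_betw_def orthogonal_algebra_def)
    then show ?thesis
      by (simp add: \<Phi>_def[abs_def] Phi_image_skew flip: image_image)
  qed
  have iso: "lie_algebra_iso g_scale lie_g g_bracket matrix_scale special_linear_algebra matrix_bracket
      (inv_into special_linear_algebra \<Phi>)"
    by (rule lie_algebra_iso_inverse[OF lie_algebra_special_linear vector_space_g_scale bij])
       (simp_all add: \<Phi>_linear \<Phi>_bracket special_linear_algebra_def)
  have img: "inv_into special_linear_algebra \<Phi> ` (lie_k \<times> {0}) = orthogonal_algebra"
    unfolding \<Phi>_orth[symmetric]
    using bij skew_sl by (intro inv_into_image_cancel) (auto simp: bij_betw_def)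

  \<comment> \<open>Real matrices enter as the fixed points of entrywise conjugation, so the real
    isomorphism is inverse to a restriction of \<Phi>.\<close>
  define \<Psi> :: "real^'m^'m \<Rightarrow> 'n gspace" where "\<Psi> M = \<Phi> (complexify M)" for M
  let ?slR = "special_linear_algebra :: (real^'m^'m) set"
  have bij_complexify: "bij_betw complexify ?slR {M :: complex^'m^'m. trace M = 0 \<and> mat_cnj M = M}"
    unfolding special_linear_algebra_def by (rule complexify_bij_betw) (simp add: complexify_trace)
  have \<Phi>_real: "\<Phi> ` {M. trace M = 0 \<and> mat_cnj M = M} = lie_g_R"
  proof -
    have "bij_betw (reindex h) {M :: complex^'m^'m. trace M = 0 \<and> mat_cnj M = M} {M. trace M = 0 \<and> mat_cnj M = M}"
      by (rule reindex_bij_betw[OF h]) (simp add: reindex_trace[OF h] reindex_cnj)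
    then have "reindex h ` {M :: complex^'m^'m. trace M = 0 \<and> mat_cnj M = M} = {M \<in> special_linear_algebra. mat_cnj M = M}"
      by (simp add: bij_betw_def special_linear_algebra_def)
    then show ?thesis
      by (simp add: \<Phi>_def[abs_def] Phi_image_real flip: image_image)
  qed
  have bij_R: "bij_betw \<Psi> ?slR lie_g_R"
  proof -
    have "inj_on \<Phi> {M. trace M = 0 \<and> mat_cnj M = M}"
      using bij by (auto simp: bij_betw_def special_linear_algebra_def intro: inj_on_subset)
    then have "bij_betw \<Phi> {M. trace M = 0 \<and> mat_cnj M = M} lie_g_R"
      by (simp add: bij_betw_def \<Phi>_real)
    from bij_betw_trans[OF bij_complexify this] show ?thesis
      by (simp add: \<Psi>_def[abs_def] comp_def)
  qed
  have \<Psi>_orth: "\<Psi> ` orthogonal_algebra = lie_k_R \<times> {0}"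
  proof -
    have "bij_betw complexify {A :: real^'m^'m. transpose A = - A} {A. transpose A = - A \<and> mat_cnj A = A}"
      by (rule complexify_bij_betw) (simp add: complexify_inj flip: complexify_linear)
    moreover have "bij_betw (reindex h) {A :: complex^'m^'m. transpose A = - A \<and> mat_cnj A = A}
        {A. transpose A = - A \<and> mat_cnj A = A}"
      by (rule reindex_bij_betw[OF h]) (simp add: reindex_transpose reindex_cnj)
    ultimately have "reindex h ` complexify ` orthogonal_algebra = {A. transpose A = - A \<and> mat_cnj A = A}"
      by (simp add: bij_betw_def orthogonal_algebra_def)
    moreover have "\<Psi> ` orthogonal_algebra = Phi ` reindex h ` complexify ` orthogonal_algebra"
      by (simp add: \<Psi>_def[abs_def] \<Phi>_def image_image)
    ultimately show ?thesis
      by (simp add: Phi_image_skew)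
  qed
  have "vector_space (\<lambda>r. g_scale (complex_of_real r) :: 'n gspace \<Rightarrow> _)"
  proof -
    interpret vector_space "g_scale :: complex \<Rightarrow> 'n gspace \<Rightarrow> _" by (rule vector_space_g_scale)
    show ?thesis
      by unfold_locales (simp_all add: scale_right_distrib scale_left_distrib)
  qed
  then have iso_R: "lie_algebra_iso (\<lambda>r. g_scale (complex_of_real r)) lie_g_R g_bracket matrix_scale ?slR matrix_bracket
      (inv_into ?slR \<Psi>)"
    by (rule lie_algebra_iso_inverse[OF lie_algebra_special_linear _ bij_R])
       (simp_all add: \<Psi>_def complexify_linear \<Phi>_linear \<Phi>_bracket special_linear_algebra_def complexify_trace
         matrix_bracket_def complexify_mult)
  have "orthogonal_algebra \<subseteq> ?slR"
  proof
    fix A :: "real^'m^'m" assume "A \<in> orthogonal_algebra"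
    then have "transpose (complexify A) = - complexify A"
      by (simp add: orthogonal_algebra_def flip: complexify_linear)
    from trace_skew[OF this] show "A \<in> ?slR"
      by (simp add: complexify_trace special_linear_algebra_def)
  qed
  then have img_R: "inv_into ?slR \<Psi> ` (lie_k_R \<times> {0}) = orthogonal_algebra"
    unfolding \<Psi>_orth[symmetric]
    using bij_R by (intro inv_into_image_cancel) (auto simp: bij_betw_def)
  show ?thesis
    using iso img iso_R img_R by blast
qed

end
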